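(* Assume (H1)–(H4). Let $\Omega\subset\mathbb R^{N+1}$ be open, $f\in C(\Omega)$, and let $u$ be a classical solution of $\mathscr H_{\mathbb G}u=f$ in $\Omega$. Suppose $c\le 0$, $\mathrm{div}_{\mathbb G}b-c\ge 0$ and $f\ge 0$ in $\Omega$. If there is $\zeta\in\Omega$ with $u(\zeta)=\max_{\Omega}u\ge 0$, then $$u(z)=u(\zeta)\quad\text{and}\quad f(z)=u(\zeta)\,c(z)\qquad\text{for every } z\in\overline{\mathscr A_\zeta(\Omega)}.$$ Analogously, if $f\le 0$ and there is $\zeta\in\Omega$ with $u(\zeta)=\min_\Omega u\le 0$, the same conclusion holds. If $c\equiv 0$, the sign assumptions on $u(\zeta)$ can be dropped.
   Context: Points of $\mathbb R^{N+1}=\mathbb R^N\times\mathbb R$ are written $z=(x,t)$, $\zeta=(\xi,\tau)$. $X_1,\dots,X_{m_1}$ ($m_1<N$) are smooth vector fields on $\mathbb R^N$, $X_i=\sum_{j=1}^N\varphi^i_j(x)\partial_{x_j}$, $\varphi^i_j\in C^\infty(\mathbb R^N)$; $\mathfrak g$ is the Lie algebra of vector fields generated by them. Standing assumptions: (H1) $X_1,\dots,X_{m_1}$ are linearly independent and $\dim\mathfrak g=N$; (H2) $\{X(x):X\in\mathfrak g\}=\mathbb R^N$ for every $x\in\mathbb R^N$, and $X_i(0)=\partial_{x_i}$; (H3) there are integers $1=\sigma_1\le\dots\le\sigma_N$ such that, with $\delta_r(x)=(r^{\sigma_1}x_1,\dots,r^{\sigma_N}x_N)$, each $X_i$ is $\delta_r$-homogeneous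 of degree one: $X_i(f\circ\delta_r)=r\,(X_if)\circ\delta_r$ for all $r>0$, $f\in C^\infty(\mathbb R^N)$. Under (H1)–(H3) there is a Carnot group $\mathbb G=(\mathbb R^N,\circ,\delta_r)$ on which the $X_i$ are left invariant and span the first layer $V_1$ of the stratification $\mathfrak g=V_1\oplus\dots\oplus V_\kappa$ ($V_{k+1}=[V_1,V_k]$); $Q=\sum_k k\dim V_k$ is its homogeneous dimension. The Carnot–Carathéodory distance $d_X(x,y)$ is the infimum of $\int_0^1|\alpha(s)|ds$ over absolutely continuous $\gamma:[0,1]\to\mathbb R^N$ with $\gamma(0)=x$, $\gamma(1)=y$, $\dot\gamma(s)=\sum_i\alpha_i(s)X_i(\gamma(s))$ a.e., $\alpha=(\alpha_1,\dots,\alpha_{m_1})$ bounded; $B_r(x)=\{y:d_X(x,y)\le r\}$; $k_1\ge1$ is a constant with $d_X(x,\xi)\le k_1(d_X(x,y)+d_X(y,\xi))$. The parabolic distance is $d((x,t),(\xi,\tau))=d_X(x,\xi)+|t-\tau|^{1/2}$. (H4): the functions $a_{ij}=a_{ji}$, $b_i$, $c$, $X_ja_{ij}$, $X_ib_i$ ($1\le i,j\le m_1$) are continuous on $\mathbb R^{N+1}$, bounded in absolute value by $M_1$, and each such $g$ satisfies $|g(z)-g(\zeta)|\le M_2\,d(z,\zeta)^\alpha$ for some $\alpha\in(0,1]$; moreover $\lambda^{-1}|v|^2\le\langle A(z)v,v\rangle\le\lambda|v|^2$ for all $z$, $v\in\mathbb R^{m_1}$, where $A=(a_{ij})$ and $\lambda\ge1$.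 The operator is $\mathscr H_{\mathbb G}u=\sum_{i,j=1}^{m_1}X_i(a_{ij}X_ju)+\sum_{i=1}^{m_1}b_iX_iu+cu-\partial_tu$, and $\mathrm{div}_{\mathbb G}b=\sum_iX_ib_i$. For a vector field $X$, the Lie derivative is $Xu(x,t)=\lim_{s\to0}\big(u(\exp(sX)(x),t)-u(x,t)\big)/s$, where $s\mapsto\exp(sX)(x)$ is the integral curve of $X$ starting at $x$. $C^2_{\mathbb G}(\Omega)$ is the set of $u\in C(\Omega)$ whose Lie derivatives $X_iu$, $X_iX_ju$ and $\partial_tu$ exist and are continuous in $\Omega$; a classical solution of $\mathscr H_{\mathbb G}u=f$ in $\Omega$ is $u\in C^2_{\mathbb G}(\Omega)$ satisfying the equation at every point. An absolutely continuous curve $\gamma:[0,1]\to\mathbb R^{N+1}$ is $\mathscr H_{\mathbb G}$-admissible if $\dot\gamma(s)=\sum_{i=1}^{m_1}\omega_i(s)X_i(\gamma(s))+(0,\dots,0,-1)$ for a.e. $s$, with $\omega_i\in L^\infty([0,1])$ (the $X_i$ acting on the first $N$ coordinates). The attainable set $\mathscr A_\zeta(\Omega)$ is the set of $z\in\Omega$ for which there is an admissible curve with $\gamma(0)=\zeta$, $\gamma(1)=z$ (and, as used, with values in $\Omega$). *)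

theory Defs
  imports "HOL-Analysis.Analysis"
begin

text \<open>Points of R^N are vectors of type real^'n (N = CARD('n)); points of R^(N+1) are
  pairs (x,t) :: (real^'n) * real. Vector fields X_1..X_m1 are indexed by i < m (0-based).\<close>

type_synonym ('n) vfield = "real^('n::finite) \<Rightarrow> real^'n"

coinductive smooth_fun :: "(real^('n::finite) \<Rightarrow> real) \<Rightarrow> bool" where
  "(\<forall>x. f differentiable (at x)) \<Longrightarrow>
   (\<forall>j. smooth_fun (\<lambda>x. frechet_derivative f (at x) (axis j 1))) \<Longrightarrow> smooth_fun f"

definition smooth_vfield :: "('n::finite) vfield \<Rightarrow> bool" where
  "smooth_vfield Y \<longleftrightarrow> (\<forall>j. smooth_fun (\<lambda>x. Y x $ j))"

definition vf_apply :: "('n::finite) vfield \<Rightarrow> (real^('n::finite) \<Rightarrow> real) \<Rightarrow> real^('n::finite) \<Rightarrow> real" where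
  "vf_apply Y f x = frechet_derivative f (at x) (Y x)"

text \<open>Lie bracket [Y,Z] = YZ - ZY of vector fields.\<close>
definition lie_bracket :: "('n::finite) vfield \<Rightarrow> ('n::finite) vfield \<Rightarrow> ('n::finite) vfield" where
  "lie_bracket Y Z x = frechet_derivative Z (at x) (Y x) - frechet_derivative Y (at x) (Z x)"

inductive_set lie_algebra :: "(nat \<Rightarrow> ('n::finite) vfield) \<Rightarrow> nat \<Rightarrow> ('n::finite) vfield set"
  for X :: "nat \<Rightarrow> ('n::finite) vfield" and m :: nat where
  gen: "i < m \<Longrightarrow> X i \<in> lie_algebra X m"
| lin: "Y \<in> lie_algebra X m \<Longrightarrow> Z \<in> lie_algebra X m \<Longrightarrow>
        (\<lambda>x. a *\<^sub>R Y x + b *\<^sub>R Z x) \<in> lie_algebra X m"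
| brk: "Y \<in> lie_algebra X m \<Longrightarrow> Z \<in> lie_algebra X m \<Longrightarrow>
        lie_bracket Y Z \<in> lie_algebra X m"

definition lin_indep_vfields :: "(nat \<Rightarrow> ('n::finite) vfield) \<Rightarrow> nat \<Rightarrow> bool" where
  "lin_indep_vfields Y n \<longleftrightarrow>
     (\<forall>c. (\<forall>x. (\<Sum>k<n. c k *\<^sub>R Y k x) = 0) \<longrightarrow> (\<forall>k<n. c k = 0))"

definition vfield_space_dim :: "('n::finite) vfield set \<Rightarrow> nat \<Rightarrow> bool" where
  "vfield_space_dim S n \<longleftrightarrow>
     (\<exists>Y. (\<forall>k<n. Y k \<in> S) \<and> lin_indep_vfields Y n \<and>
          (\<forall>Z\<in>S. \<exists>c. Z = (\<lambda>x. \<Sum>k<n. c k *\<^sub>R Y k x)))"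

definition dil :: "('n \<Rightarrow> nat) \<Rightarrow> real \<Rightarrow> real^('n::finite) \<Rightarrow> real^('n::finite)" where
  "dil \<sigma> r x = (\<chi> j. r ^ \<sigma> j * x $ j)"

text \<open>Standing assumptions (H1)-(H3). The bijection e : {0..N-1} -> 'n enumerates the coordinates
  x_1..x_N (coordinate x_(k+1) is component e k).\<close>
definition H1_H3 :: "(nat \<Rightarrow> ('n::finite) vfield) \<Rightarrow> nat \<Rightarrow> (nat \<Rightarrow> 'n) \<Rightarrow> ('n \<Rightarrow> nat) \<Rightarrow> bool" where
  "H1_H3 X m e \<sigma> \<longleftrightarrow>
     bij_betw e {..<CARD('n)} UNIV \<and> m < CARD('n) \<and>
     (\<forall>i<m. smooth_vfield (X i)) \<and>
     \<comment> \<open>(H1)\<close>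
     lin_indep_vfields X m \<and> vfield_space_dim (lie_algebra X m) CARD('n) \<and>
     \<comment> \<open>(H2)\<close>
     (\<forall>x. {Y x | Y. Y \<in> lie_algebra X m} = UNIV) \<and>
     (\<forall>i<m. X i 0 = axis (e i) 1) \<and>
     \<comment> \<open>(H3)\<close>
     \<sigma> (e 0) = 1 \<and> (\<forall>j k. j \<le> k \<and> k < CARD('n) \<longrightarrow> \<sigma> (e j) \<le> \<sigma> (e k)) \<and>
     (\<forall>i<m. \<forall>r>0. \<forall>f. smooth_fun f \<longrightarrow>
        (\<forall>x. vf_apply (X i) (f \<circ> dil \<sigma> r) x = r * vf_apply (X i) f (dil \<sigma> r x)))"

definition abs_continuous_on :: "real \<Rightarrow> real \<Rightarrow> (real \<Rightarrow> 'a::metric_space) \<Rightarrow> bool" where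
  "abs_continuous_on a b g \<longleftrightarrow>
     (\<forall>\<epsilon>>0. \<exists>\<delta>>0. \<forall>(n::nat) lo hi.
        (\<forall>k<n. a \<le> lo k \<and> lo k \<le> hi k \<and> hi k \<le> b) \<and>
        (\<forall>k<n. \<forall>l<n. k \<noteq> l \<longrightarrow> hi k \<le> lo l \<or> hi l \<le> lo k) \<and>
        (\<Sum>k<n. hi k - lo k) < \<delta> \<longrightarrow>
        (\<Sum>k<n. dist (g (hi k)) (g (lo k))) < \<epsilon>)"

definition X_curve :: "(nat \<Rightarrow> ('n::finite) vfield) \<Rightarrow> nat \<Rightarrow> (real \<Rightarrow> real^('n::finite)) \<Rightarrow> (nat \<Rightarrow> real \<Rightarrow> real) \<Rightarrow> bool" where
  "X_curve X m \<gamma> \<alpha> \<longleftrightarrow>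
     abs_continuous_on 0 1 \<gamma> \<and>
     (\<forall>i<m. set_borel_measurable lborel {0..1} (\<alpha> i) \<and> (\<exists>B. \<forall>s\<in>{0..1}. \<bar>\<alpha> i s\<bar> \<le> B)) \<and>
     (AE s in lborel. s \<in> {0..1} \<longrightarrow>
        (\<gamma> has_vector_derivative (\<Sum>i<m. \<alpha> i s *\<^sub>R X i (\<gamma> s))) (at s))"

definition cc_dist :: "(nat \<Rightarrow> ('n::finite) vfield) \<Rightarrow> nat \<Rightarrow> real^('n::finite) \<Rightarrow> real^('n::finite) \<Rightarrow> real" where
  "cc_dist X m x y = Inf {integral {0..1} (\<lambda>s. sqrt (\<Sum>i<m. (\<alpha> i s)\<^sup>2)) | \<gamma> \<alpha>.
                          X_curve X m \<gamma> \<alpha> \<and> \<gamma> 0 = x \<and> \<gamma> 1 = y}"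

definition par_dist :: "(nat \<Rightarrow> ('n::finite) vfield) \<Rightarrow> nat \<Rightarrow> ((real^('n::finite)) \<times> real) \<Rightarrow> ((real^('n::finite)) \<times> real) \<Rightarrow> real" where
  "par_dist X m z w = cc_dist X m (fst z) (fst w) + sqrt \<bar>snd z - snd w\<bar>"

text \<open>Yu(x,t) = L: the derivative at s = 0 of s |-> u(exp(sY)(x),t), where s |-> exp(sY)(x) is the
  integral curve of Y through x (unique, Y being smooth).\<close>
definition has_lie_deriv :: "('n::finite) vfield \<Rightarrow> ((real^('n::finite)) \<times> real \<Rightarrow> real) \<Rightarrow> (real^('n::finite)) \<times> real \<Rightarrow> real \<Rightarrow> bool" where
  "has_lie_deriv Y u z L \<longleftrightarrow>
     (\<exists>\<gamma> \<epsilon>. \<epsilon> > 0 \<and> \<gamma> 0 = fst z \<and>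
        (\<forall>s. \<bar>s\<bar> < \<epsilon> \<longrightarrow> (\<gamma> has_vector_derivative Y (\<gamma> s)) (at s)) \<and>
        ((\<lambda>s. u (\<gamma> s, snd z)) has_real_derivative L) (at 0))"

definition lie_exists :: "('n::finite) vfield \<Rightarrow> ((real^('n::finite)) \<times> real \<Rightarrow> real) \<Rightarrow> (real^('n::finite)) \<times> real \<Rightarrow> bool" where
  "lie_exists Y u z \<longleftrightarrow> (\<exists>L. has_lie_deriv Y u z L)"

definition lie :: "('n::finite) vfield \<Rightarrow> ((real^('n::finite)) \<times> real \<Rightarrow> real) \<Rightarrow> (real^('n::finite)) \<times> real \<Rightarrow> real" where
  "lie Y u z = (THE L. has_lie_deriv Y u z L)"

definition dt_exists :: "((real^('n::finite)) \<times> real \<Rightarrow> real) \<Rightarrow> (real^('n::finite)) \<times> real \<Rightarrow> bool" where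
  "dt_exists u z \<longleftrightarrow> (\<lambda>s. u (fst z, s)) differentiable (at (snd z))"

definition dt :: "((real^('n::finite)) \<times> real \<Rightarrow> real) \<Rightarrow> (real^('n::finite)) \<times> real \<Rightarrow> real" where
  "dt u z = deriv (\<lambda>s. u (fst z, s)) (snd z)"

definition H4 :: "(nat \<Rightarrow> ('n::finite) vfield) \<Rightarrow> nat \<Rightarrow> (nat \<Rightarrow> nat \<Rightarrow> (real^('n::finite)) \<times> real \<Rightarrow> real) \<Rightarrow>
    (nat \<Rightarrow> (real^('n::finite)) \<times> real \<Rightarrow> real) \<Rightarrow> ((real^('n::finite)) \<times> real \<Rightarrow> real) \<Rightarrow>
    real \<Rightarrow> real \<Rightarrow> real \<Rightarrow> real \<Rightarrow> bool" where
  "H4 X m a b c M1 M2 \<alpha> lam \<longleftrightarrow>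
     0 < \<alpha> \<and> \<alpha> \<le> 1 \<and> lam \<ge> 1 \<and>
     (\<forall>i<m. \<forall>j<m. a i j = a j i) \<and>
     (\<forall>i<m. \<forall>j<m. \<forall>z. lie_exists (X j) (a i j) z) \<and>
     (\<forall>i<m. \<forall>z. lie_exists (X i) (b i) z) \<and>
     (\<forall>g \<in> {a i j | i j. i < m \<and> j < m} \<union> {b i | i. i < m} \<union> {c}
            \<union> {lie (X j) (a i j) | i j. i < m \<and> j < m} \<union> {lie (X i) (b i) | i. i < m}.
        continuous_on UNIV g \<and> (\<forall>z. \<bar>g z\<bar> \<le> M1) \<and>
        (\<forall>z w. \<bar>g z - g w\<bar> \<le> M2 * par_dist X m z w powr \<alpha>)) \<and>
     (\<forall>z (v :: nat \<Rightarrow> real).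
        (1 / lam) * (\<Sum>i<m. (v i)\<^sup>2) \<le> (\<Sum>i<m. \<Sum>j<m. a i j z * v i * v j) \<and>
        (\<Sum>i<m. \<Sum>j<m. a i j z * v i * v j) \<le> lam * (\<Sum>i<m. (v i)\<^sup>2))"

definition H_op :: "(nat \<Rightarrow> ('n::finite) vfield) \<Rightarrow> nat \<Rightarrow> (nat \<Rightarrow> nat \<Rightarrow> (real^('n::finite)) \<times> real \<Rightarrow> real) \<Rightarrow>
    (nat \<Rightarrow> (real^('n::finite)) \<times> real \<Rightarrow> real) \<Rightarrow> ((real^('n::finite)) \<times> real \<Rightarrow> real) \<Rightarrow>
    ((real^('n::finite)) \<times> real \<Rightarrow> real) \<Rightarrow> (real^('n::finite)) \<times> real \<Rightarrow> real" where
  "H_op X m a b c u z =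
     (\<Sum>i<m. \<Sum>j<m. lie (X i) (\<lambda>w. a i j w * lie (X j) u w) z)
     + (\<Sum>i<m. b i z * lie (X i) u z) + c z * u z - dt u z"

definition div_G :: "(nat \<Rightarrow> ('n::finite) vfield) \<Rightarrow> nat \<Rightarrow> (nat \<Rightarrow> (real^('n::finite)) \<times> real \<Rightarrow> real) \<Rightarrow> (real^('n::finite)) \<times> real \<Rightarrow> real" where
  "div_G X m b z = (\<Sum>i<m. lie (X i) (b i) z)"

definition C2_G :: "(nat \<Rightarrow> ('n::finite) vfield) \<Rightarrow> nat \<Rightarrow> ((real^('n::finite)) \<times> real) set \<Rightarrow> ((real^('n::finite)) \<times> real \<Rightarrow> real) \<Rightarrow> bool" where
  "C2_G X m \<Omega> u \<longleftrightarrow>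
     continuous_on \<Omega> u \<and>
     (\<forall>i<m. (\<forall>z\<in>\<Omega>. lie_exists (X i) u z) \<and> continuous_on \<Omega> (lie (X i) u)) \<and>
     (\<forall>i<m. \<forall>j<m. (\<forall>z\<in>\<Omega>. lie_exists (X i) (lie (X j) u) z) \<and>
                   continuous_on \<Omega> (lie (X i) (lie (X j) u))) \<and>
     (\<forall>z\<in>\<Omega>. dt_exists u z) \<and> continuous_on \<Omega> (dt u)"

definition classical_solution where
  "classical_solution X m a b c \<Omega> u f \<longleftrightarrow>
     C2_G X m \<Omega> u \<and> (\<forall>z\<in>\<Omega>. H_op X m a b c u z = f z)"

definition H_admissible :: "(nat \<Rightarrow> ('n::finite) vfield) \<Rightarrow> nat \<Rightarrow> (real \<Rightarrow> (real^('n::finite)) \<times> real) \<Rightarrow> (nat \<Rightarrow> real \<Rightarrow> real) \<Rightarrow> bool" where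
  "H_admissible X m \<gamma> \<omega> \<longleftrightarrow>
     abs_continuous_on 0 1 \<gamma> \<and>
     (\<forall>i<m. set_borel_measurable lborel {0..1} (\<omega> i) \<and>
            (\<exists>B. AE s in lborel. s \<in> {0..1} \<longrightarrow> \<bar>\<omega> i s\<bar> \<le> B)) \<and>
     (AE s in lborel. s \<in> {0..1} \<longrightarrow>
        (\<gamma> has_vector_derivative ((\<Sum>i<m. \<omega> i s *\<^sub>R X i (fst (\<gamma> s))), -1)) (at s))"

definition attainable :: "(nat \<Rightarrow> ('n::finite) vfield) \<Rightarrow> nat \<Rightarrow> (real^('n::finite)) \<times> real \<Rightarrow> ((real^('n::finite)) \<times> real) set \<Rightarrow> ((real^('n::finite)) \<times> real) set" where
  "attainable X m \<zeta> \<Omega> = {z \<in> \<Omega>. \<exists>\<gamma> \<omega>. H_admissible X m \<gamma> \<omega> \<and> \<gamma> 0 = \<zeta> \<and> \<gamma> 1 = z \<and> \<gamma> ` {0..1} \<subseteq> \<Omega>}"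

end

theory Submission
  imports Defs
begin

text \<open>
  Bony's approach to the strong maximum principle. In nondivergence form the equation is a degenerate
  parabolic one for the Lie derivatives of \<open>u\<close>, and at a spatial maximum the second-order part is
  nonpositive: moving along the flows of \<open>X 0, ..., X (m - 1)\<close> one after the other, in this order and
  in the reversed one, and adding the two second-order expansions gives the full symmetrised Hessian.
  Hopf barriers then show that every exterior normal \<open>\<nu>\<close> of the contact set \<open>F = {u = M}\<close> is orthogonal
  to the \<open>X i\<close>. Orthogonality to the normals passes to brackets, because a small explicit loop built
  from two tangential fields stays close to \<open>F\<close> while its endpoint is displaced by the bracket. By
  the rank condition the normals have no spatial component, so \<open>F\<close> is locally a union of time slices,
  and a paraboloid barrier shows that the set of these times has no gap below any of its points.
  Hence \<open>F\<close> contains every curve in \<open>\<Omega>\<close> from \<open>\<zeta>\<close> along which time does not increase.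
\<close>

text \<open>The obstacle is regularity: \<open>u\<close> has Lie derivatives along the
  \<open>X i\<close> and a time derivative, but no Hessian is available, and the iterated
  derivatives in the two orders of a pair of fields need not agree. Second-order information has to
  be read off along integral curves, and bracket directions are never differentiated: they are
  reached through the geometry of the contact set, which only asks for smooth barriers. The Hopf
  barrier says nothing about the time component of a normal. The operator is one-sided in time,
  hence the separate barrier for the downward step. One comparison lemma with an error \<eta> serves
  twice: with \<eta> a small multiple of \<delta>^2 for the bracket loop, and with \<eta> = 0 for
  motion along horizontal vectors. The sign of the maximum enters only as
  \<open>c z * y \<le> 0\<close> for \<open>y \<ge> M\<close>. This follows from
  \<open>M \<ge> 0\<close> and also from \<open>c = 0\<close>, so all cases of the theorem share one
  argument.\<close>

section \<open>Smooth functions and vector fields\<close>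

text \<open>The algebra generated by the smooth functions is closed under partial derivatives, so by
  coinduction it contains nothing new.\<close>
inductive smooth_alg :: "(real^('n::finite) \<Rightarrow> real) \<Rightarrow> bool" where
  base: "smooth_fun f \<Longrightarrow> smooth_alg f"
| const: "smooth_alg (\<lambda>x. k)"
| add: "smooth_alg f \<Longrightarrow> smooth_alg g \<Longrightarrow> smooth_alg (\<lambda>x. f x + g x)"
| mult: "smooth_alg f \<Longrightarrow> smooth_alg g \<Longrightarrow> smooth_alg (\<lambda>x. f x * g x)"

lemma smooth_fun_differentiable: "smooth_fun f \<Longrightarrow> f differentiable (at x)"
  by (auto elim: smooth_fun.cases)

lemma smooth_fun_partial:
  "smooth_fun f \<Longrightarrow> smooth_fun (\<lambda>x. frechet_derivative f (at x) (axis j 1))"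
  by (auto elim: smooth_fun.cases)

lemma smooth_alg_partials:
  assumes "smooth_alg f"
  shows "(\<forall>x. f differentiable (at x)) \<and> (\<forall>j. smooth_alg (\<lambda>x. frechet_derivative f (at x) (axis j 1)))"
  using assms
proof induction
  case (base f)
  then show ?case by (blast intro: smooth_alg.base smooth_fun_differentiable smooth_fun_partial)
next
  case (const k)
  then show ?case by (auto intro: smooth_alg.const)
next
  case (add f g)
  have "frechet_derivative (\<lambda>x. f x + g x) (at x) v
      = frechet_derivative f (at x) v + frechet_derivative g (at x) v" for x v
    using add by (subst frechet_derivative_at[OF has_derivative_add, symmetric])
      (auto simp: frechet_derivative_works[symmetric])
  with add show ?case by (auto intro!: smooth_alg.intros(3))
next
  case (mult f g)
  have "frechet_derivative (\<lambda>x. f x * g x) (at x) v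
      = f x * frechet_derivative g (at x) v + frechet_derivative f (at x) v * g x" for x v
    using mult by (subst frechet_derivative_at[OF has_derivative_mult, symmetric])
      (auto simp: frechet_derivative_works[symmetric])
  with mult show ?case by (auto intro!: smooth_alg.intros(3,4))
qed

lemma smooth_alg_smooth: "smooth_alg f \<Longrightarrow> smooth_fun f"
  by (coinduction arbitrary: f) (use smooth_alg_partials in blast)

lemma smooth_fun_const: "smooth_fun (\<lambda>x. k)"
  and smooth_fun_add: "smooth_fun f \<Longrightarrow> smooth_fun g \<Longrightarrow> smooth_fun (\<lambda>x. f x + g x)"
  and smooth_fun_mult: "smooth_fun f \<Longrightarrow> smooth_fun g \<Longrightarrow> smooth_fun (\<lambda>x. f x * g x)"
  by (blast intro: smooth_alg_smooth smooth_alg.intros)+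

lemma smooth_fun_sum:
  assumes "\<And>i. i \<in> A \<Longrightarrow> smooth_fun (f i)"
  shows "smooth_fun (\<lambda>x. \<Sum>i\<in>A. f i x)"
  using assms by (induction A rule: infinite_finite_induct) (auto intro: smooth_fun_const smooth_fun_add)

lemma smooth_vfield_differentiable: "smooth_vfield Y \<Longrightarrow> Y differentiable (at x)"
  unfolding smooth_vfield_def
  by (subst differentiable_componentwise_within)
     (auto simp: Basis_vec_def inner_axis smooth_fun_differentiable)

lemma smooth_vfield_has_derivative:
  "smooth_vfield Y \<Longrightarrow> (Y has_derivative frechet_derivative Y (at x)) (at x)"
  using smooth_vfield_differentiable frechet_derivative_works by blast

lemma smooth_vfield_continuous: "smooth_vfield Y \<Longrightarrow> continuous_on S Y"
  by (meson continuous_at_imp_continuous_on differentiable_imp_continuous_within smooth_vfield_differentiable)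

text \<open>\<open>smooth_fun\<close> speaks of partial derivatives only, so directional derivatives
  of a field are expanded in partials before smoothness can be passed on to them.\<close>

lemma frechet_derivative_vfield_component:
  assumes "smooth_vfield Z"
  shows "frechet_derivative Z (at x) v $ j
    = (\<Sum>k\<in>UNIV. v $ k * frechet_derivative (\<lambda>x. Z x $ j) (at x) (axis k 1))"
proof -
  let ?D = "frechet_derivative (\<lambda>x. Z x $ j) (at x)"
  have "((\<lambda>x. Z x $ j) has_derivative (\<lambda>v. frechet_derivative Z (at x) v $ j)) (at x)"
    by (rule bounded_linear.has_derivative[OF bounded_linear_vec_nth smooth_vfield_has_derivative[OF assms]])
  then have eq: "?D = (\<lambda>v. frechet_derivative Z (at x) v $ j)"
    using frechet_derivative_at by metis
  have lin: "linear ?D"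
    using assms by (auto simp: smooth_vfield_def intro: linear_frechet_derivative smooth_fun_differentiable)
  have "?D v = ?D (\<Sum>k\<in>UNIV. v $ k *\<^sub>R axis k 1)"
    by (simp add: basis_expansion flip: scalar_mult_eq_scaleR)
  also have "\<dots> = (\<Sum>k\<in>UNIV. v $ k * ?D (axis k 1))"
    by (simp add: linear_sum[OF lin] linear_cmul[OF lin])
  finally show ?thesis by (simp add: eq)
qed

text \<open>The building block of brackets and of the second Lie derivatives of the barriers. With a
  constant \<open>Y\<close> it also yields continuity of the partial derivatives.\<close>

lemma smooth_vfield_derivative_along:
  assumes "smooth_vfield Y" "smooth_vfield Z"
  shows "smooth_vfield (\<lambda>x. frechet_derivative Z (at x) (Y x))"
  using assms unfolding smooth_vfield_def
  by (auto simp: frechet_derivative_vfield_component[OF assms(2)]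
    intro!: smooth_fun_sum smooth_fun_mult smooth_fun_partial)

lemma smooth_vfield_lin:
  assumes "smooth_vfield Y" "smooth_vfield Z"
  shows "smooth_vfield (\<lambda>x. p *\<^sub>R Y x + q *\<^sub>R Z x)"
  using assms unfolding smooth_vfield_def
  by (auto intro!: smooth_fun_add smooth_fun_mult smooth_fun_const)

lemma smooth_vfield_bracket:
  assumes "smooth_vfield Y" "smooth_vfield Z"
  shows "smooth_vfield (lie_bracket Y Z)"
proof -
  have "lie_bracket Y Z = (\<lambda>x. 1 *\<^sub>R frechet_derivative Z (at x) (Y x) + (-1) *\<^sub>R frechet_derivative Y (at x) (Z x))"
    by (auto simp: lie_bracket_def)
  then show ?thesis
    by (simp only:) (intro smooth_vfield_lin smooth_vfield_derivative_along assms)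
qed

lemma lie_algebra_smooth:
  assumes "\<And>i. i < m \<Longrightarrow> smooth_vfield (X i)" "Y \<in> lie_algebra X m"
  shows "smooth_vfield Y"
  using assms(2) by induction (auto intro: assms(1) smooth_vfield_lin smooth_vfield_bracket)

text \<open>Continuous partial derivatives are bounded on the compact ball, and convexity of the
  ball turns the bound into a Lipschitz constant by the mean value inequality.\<close>

lemma smooth_vfield_lipschitz:
  assumes "smooth_vfield Y"
  shows "\<exists>L>0. \<forall>x\<in>cball x0 r. \<forall>y\<in>cball x0 r. norm (Y x - Y y) \<le> L * norm (x - y)"
proof -
  have "\<exists>B. \<forall>x\<in>cball x0 r. norm (frechet_derivative Y (at x) (axis k 1)) \<le> B" for k
  proof -
    have "smooth_vfield (\<lambda>x. frechet_derivative Y (at x) ((\<lambda>x. axis k 1) x))"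
      by (rule smooth_vfield_derivative_along)
        (auto simp: smooth_vfield_def assms[unfolded smooth_vfield_def] intro: smooth_fun_const)
    then have "compact ((\<lambda>x. frechet_derivative Y (at x) (axis k 1)) ` cball x0 r)"
      by (intro compact_continuous_image smooth_vfield_continuous) auto
    then show ?thesis
      by (auto dest!: compact_imp_bounded simp: bounded_iff)
  qed
  then obtain B where B: "\<And>k x. x \<in> cball x0 r \<Longrightarrow> norm (frechet_derivative Y (at x) (axis k 1)) \<le> B k"
    by metis
  define L where "L = (\<Sum>k\<in>UNIV. \<bar>B k\<bar>) + 1"
  have Lpos: "L > 0" unfolding L_def by (smt (verit) sum_nonneg abs_ge_zero)
  have onorm: "onorm (frechet_derivative Y (at x)) \<le> L" if x: "x \<in> cball x0 r" for x
  proof (rule onorm_bound)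
    fix v
    have lin: "linear (frechet_derivative Y (at x))"
      by (simp add: assms linear_frechet_derivative smooth_vfield_differentiable)
    have "frechet_derivative Y (at x) v = frechet_derivative Y (at x) (\<Sum>k\<in>UNIV. v $ k *\<^sub>R axis k 1)"
      by (simp add: basis_expansion flip: scalar_mult_eq_scaleR)
    also have "\<dots> = (\<Sum>k\<in>UNIV. v $ k *\<^sub>R frechet_derivative Y (at x) (axis k 1))"
      by (simp add: linear_sum[OF lin] linear_cmul[OF lin])
    also have "norm \<dots> \<le> (\<Sum>k\<in>UNIV. norm v * \<bar>B k\<bar>)"
    proof (intro sum_norm_le)
      fix k
      have "norm (frechet_derivative Y (at x) (axis k 1)) \<le> \<bar>B k\<bar>" using B[OF x, of k] by linarith
      then show "norm (v $ k *\<^sub>R frechet_derivative Y (at x) (axis k 1)) \<le> norm v * \<bar>B k\<bar>"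
        by (simp add: mult_mono component_le_norm_cart)
    qed
    also have "\<dots> \<le> L * norm v"
      by (simp add: L_def algebra_simps sum_distrib_left)
    finally show "norm (frechet_derivative Y (at x) v) \<le> L * norm v" .
  qed (use Lpos in simp)
  have "norm (Y x - Y y) \<le> L * norm (x - y)" if "x \<in> cball x0 r" "y \<in> cball x0 r" for x y
    by (rule differentiable_bound[where S="cball x0 r" and f'="\<lambda>x. frechet_derivative Y (at x)"])
       (use that onorm in \<open>auto intro: has_derivative_at_withinI smooth_vfield_has_derivative[OF assms]\<close>)
  with Lpos show ?thesis by blast
qed

section \<open>Local flows and Lie derivatives\<close>

text \<open>Picard iteration as a contraction of the bounded continuous functions on the whole line.
  The integral starts at \<open>-T\<close>, so that one formula covers both signs of time, and
  subtracting its value at 0 restores the initial condition. Two integrals over length at most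
  \<open>2 * T\<close> give the factor \<open>4 * L * T\<close>.\<close>

lemma picard_lindelof_global:
  fixes G :: "'a::euclidean_space \<Rightarrow> 'a"
  assumes lip: "\<And>x y. norm (G x - G y) \<le> L * norm (x - y)" and "L \<ge> 0" "T > 0" and small: "4 * L * T < 1"
  shows "\<exists>\<phi>. \<phi> 0 = x \<and> (\<forall>s. \<bar>s\<bar> < T \<longrightarrow> (\<phi> has_vector_derivative G (\<phi> s)) (at s))"
proof -
  have "(L)-lipschitz_on UNIV G"
    using lip \<open>L \<ge> 0\<close> by (auto simp: lipschitz_on_def dist_norm)
  then have Gcont: "continuous_on S G" for S
    using lipschitz_on_continuous_on continuous_on_subset by blast
  \<comment> \<open>Clamping time to \<open>{-T..T}\<close> makes the iterate bounded on the whole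
    line; inside the interval nothing changes, and there the differential equation is read
    off.\<close>
  define cl where "cl t = max (-T) (min T t)" for t
  define I where "I \<phi> t = integral {-T..t} (\<lambda>s. G (\<phi> s))" for \<phi> t
  have cl_mem: "cl t \<in> {-T..T}" for t using \<open>T > 0\<close> by (auto simp: cl_def)
  have cl_cont: "continuous_on UNIV cl" unfolding cl_def by (intro continuous_intros)
  have Gphi: "continuous_on S (\<lambda>s. G (apply_bcontfun \<phi> s))" for S and \<phi> :: "real \<Rightarrow>\<^sub>C 'a"
    by (rule continuous_on_compose2[OF Gcont[of UNIV]]) auto
  have int: "(\<lambda>s. G (apply_bcontfun \<phi> s)) integrable_on {-T..t}" for t and \<phi> :: "real \<Rightarrow>\<^sub>C 'a"
    by (rule integrable_continuous_real[OF Gphi])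
  have Icont: "continuous_on {-T..T} (I (apply_bcontfun \<phi>))" for \<phi> :: "real \<Rightarrow>\<^sub>C 'a"
    unfolding I_def by (rule indefinite_integral_continuous_1[OF int])
  have Iclcont: "continuous_on UNIV (\<lambda>t. I (apply_bcontfun \<phi>) (cl t))" for \<phi> :: "real \<Rightarrow>\<^sub>C 'a"
    by (rule continuous_on_compose2[OF Icont cl_cont]) (use cl_mem in auto)
  have Pb: "(\<lambda>t. x + I (apply_bcontfun \<phi>) (cl t) - I (apply_bcontfun \<phi>) 0) \<in> bcontfun" for \<phi> :: "real \<Rightarrow>\<^sub>C 'a"
  proof -
    have "compact ((\<lambda>t. x + I (apply_bcontfun \<phi>) t - I (apply_bcontfun \<phi>) 0) ` {-T..T})"
      by (intro compact_continuous_image continuous_intros Icont) auto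
    moreover have "range (\<lambda>t. x + I (apply_bcontfun \<phi>) (cl t) - I (apply_bcontfun \<phi>) 0)
      \<subseteq> (\<lambda>t. x + I (apply_bcontfun \<phi>) t - I (apply_bcontfun \<phi>) 0) ` {-T..T}"
      using cl_mem by auto
    ultimately have "bounded (range (\<lambda>t. x + I (apply_bcontfun \<phi>) (cl t) - I (apply_bcontfun \<phi>) 0))"
      using bounded_subset compact_imp_bounded by blast
    moreover have "continuous_on UNIV (\<lambda>t. x + I (apply_bcontfun \<phi>) (cl t) - I (apply_bcontfun \<phi>) 0)"
      by (intro continuous_intros Iclcont)
    ultimately show ?thesis by (simp add: bcontfun_def)
  qed
  define P where "P \<phi> = Bcontfun (\<lambda>t. x + I (apply_bcontfun \<phi>) (cl t) - I (apply_bcontfun \<phi>) 0)"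
    for \<phi> :: "real \<Rightarrow>\<^sub>C 'a"
  have P: "apply_bcontfun (P \<phi>) t = x + I (apply_bcontfun \<phi>) (cl t) - I (apply_bcontfun \<phi>) 0" for \<phi> t
    by (simp add: P_def Bcontfun_inverse[OF Pb])
  have Idiff: "norm (I (apply_bcontfun \<phi>) t - I (apply_bcontfun \<psi>) t) \<le> 2 * T * L * dist \<phi> \<psi>"
    if t: "t \<in> {-T..T}" for t and \<phi> \<psi> :: "real \<Rightarrow>\<^sub>C 'a"
  proof -
    have "I (apply_bcontfun \<phi>) t - I (apply_bcontfun \<psi>) t = integral {-T..t} (\<lambda>s. G (\<phi> s) - G (\<psi> s))"
      unfolding I_def by (rule integral_diff[symmetric]) (rule int)+
    also have "norm \<dots> \<le> L * dist \<phi> \<psi> * (t - (-T))"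
    proof (rule integral_bound)
      fix s
      have "norm (G (\<phi> s) - G (\<psi> s)) \<le> L * dist (\<phi> s) (\<psi> s)" using lip by (simp add: dist_norm)
      also have "\<dots> \<le> L * dist \<phi> \<psi>" by (intro mult_left_mono dist_bounded \<open>L \<ge> 0\<close>)
      finally show "norm (G (\<phi> s) - G (\<psi> s)) \<le> L * dist \<phi> \<psi>" .
    qed (use t in \<open>auto intro!: continuous_intros Gphi\<close>)
    also have "\<dots> \<le> L * dist \<phi> \<psi> * (2 * T)"
      using t \<open>L \<ge> 0\<close> by (intro mult_left_mono) auto
    finally show ?thesis by (simp add: mult_ac)
  qed
  have "dist (P \<phi>) (P \<psi>) \<le> (4 * L * T) * dist \<phi> \<psi>" for \<phi> \<psi>
  proof (rule dist_bound)
    fix t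
    have "dist (P \<phi> t) (P \<psi> t) = norm ((I \<phi> (cl t) - I \<psi> (cl t)) - (I \<phi> 0 - I \<psi> 0))"
      by (simp add: P dist_norm algebra_simps)
    also have "\<dots> \<le> 2 * T * L * dist \<phi> \<psi> + 2 * T * L * dist \<phi> \<psi>"
      using norm_triangle_ineq4 Idiff[OF cl_mem] Idiff[of 0] \<open>T > 0\<close>
      by (smt (verit) atLeastAtMost_iff)
    finally show "dist (P \<phi> t) (P \<psi> t) \<le> (4 * L * T) * dist \<phi> \<psi>" by (simp add: algebra_simps)
  qed
  then have "\<exists>!\<phi>. P \<phi> = \<phi>"
    using small \<open>L \<ge> 0\<close> \<open>T > 0\<close> by (intro banach_fix_type[of "4 * L * T"]) auto
  then obtain \<phi> where \<phi>: "P \<phi> = \<phi>" by blast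
  have "apply_bcontfun \<phi> 0 = x"
    using P[of \<phi> 0] \<open>T > 0\<close> by (simp add: \<phi> cl_def)
  moreover have "(apply_bcontfun \<phi> has_vector_derivative G (\<phi> s)) (at s)" if s: "\<bar>s\<bar> < T" for s
  proof -
    have s': "s \<in> {-T<..<T}" using s by auto
    have "(I \<phi> has_vector_derivative G (\<phi> s)) (at s within {-T..T})"
      unfolding I_def by (rule integral_has_vector_derivative[OF Gphi]) (use s' in auto)
    then have "(I \<phi> has_vector_derivative G (\<phi> s)) (at s)"
      by (metis (no_types) at_within_Icc_at greaterThanLessThan_iff s')
    then have "((\<lambda>t. x + I \<phi> t - I \<phi> 0) has_vector_derivative G (\<phi> s)) (at s)"
      by (auto intro!: derivative_eq_intros)
    then show ?thesis
    proof (rule has_vector_derivative_transform_within_open[where S="{-T<..<T}"])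
      fix t assume "t \<in> {-T<..<T}"
      then show "x + I \<phi> t - I \<phi> 0 = apply_bcontfun \<phi> t"
        using P[of \<phi> t] by (simp add: \<phi> cl_def)
    qed (use s' in auto)
  qed
  ultimately show ?thesis by blast
qed

text \<open>A smooth field is only locally Lipschitz. Composed with the nearest-point projection
  onto a ball of radius 2 it becomes globally Lipschitz, and curves from the unit ball stay where
  the projection is the identity. The bounds \<open>T\<close> and \<open>K\<close> are common to all
  starting points because broken curves start their legs at moving corners.\<close>

lemma local_flow_ex:
  fixes Y :: "('n::finite) vfield"
  assumes Y: "smooth_vfield Y"
  shows "\<exists>T>0. \<exists>K>0. \<exists>\<theta>. \<forall>x\<in>ball x1 1. \<theta> x 0 = x \<and>
    (\<forall>s. \<bar>s\<bar> < T \<longrightarrow> (\<theta> x has_vector_derivative Y (\<theta> x s)) (at s) \<and> norm (\<theta> x s - x) \<le> K * \<bar>s\<bar>)"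
proof -
  let ?B = "cball x1 2"
  have B: "closed ?B" "convex ?B" "?B \<noteq> {}" by auto
  obtain L where L: "L > 0" "\<And>x y. x \<in> ?B \<Longrightarrow> y \<in> ?B \<Longrightarrow> norm (Y x - Y y) \<le> L * norm (x - y)"
    using smooth_vfield_lipschitz[OF Y] by meson
  have "compact (Y ` ?B)" by (intro compact_continuous_image smooth_vfield_continuous[OF Y]) auto
  then obtain K0 where K0: "\<And>x. x \<in> ?B \<Longrightarrow> norm (Y x) \<le> K0"
    using compact_imp_bounded by (fastforce simp: bounded_iff)
  define K where "K = \<bar>K0\<bar> + 1"
  have K: "norm (Y x) \<le> K" if "x \<in> ?B" for x using K0[OF that] by (simp add: K_def)
  have "K > 0" by (simp add: K_def)
  define G where "G x = Y (closest_point ?B x)" for x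
  have cp: "closest_point ?B x \<in> ?B" for x by (rule closest_point_in_set) auto
  have Glip: "norm (G x - G y) \<le> L * norm (x - y)" for x y
  proof -
    have "norm (G x - G y) \<le> L * dist (closest_point ?B x) (closest_point ?B y)"
      unfolding G_def dist_norm by (intro L cp)
    also have "\<dots> \<le> L * norm (x - y)"
      using closest_point_lipschitz[OF B(2,1,3), of x y] L(1) by (simp add: dist_norm)
    finally show ?thesis .
  qed
  \<comment> \<open>The first bound gives \<open>4 * L * T \<le> 1 / 2\<close> for the contraction,
    the second limits the displacement to 1.\<close>
  define T where "T = min (1 / (8 * L)) (1 / K)"
  have T: "T > 0" using L \<open>K > 0\<close> by (simp add: T_def)
  have "4 * L * T \<le> 4 * L * (1 / (8 * L))"
    using L(1) unfolding T_def by (intro mult_left_mono) auto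
  then have TL: "4 * L * T < 1" using L(1) by simp
  have TK: "K * T \<le> 1"
    using \<open>K > 0\<close> by (simp add: T_def min_def field_simps)
  have "\<exists>\<phi>. \<phi> 0 = x \<and> (\<forall>s. \<bar>s\<bar> < T \<longrightarrow> (\<phi> has_vector_derivative G (\<phi> s)) (at s))" for x
    by (rule picard_lindelof_global[OF Glip]) (use L T TL in auto)
  then obtain \<theta> where \<theta>: "\<And>x. \<theta> x 0 = x"
      "\<And>x s. \<bar>s\<bar> < T \<Longrightarrow> (\<theta> x has_vector_derivative G (\<theta> x s)) (at s)"
    by metis
  have bd: "norm (\<theta> x s - x) \<le> K * \<bar>s\<bar>" if "\<bar>s\<bar> < T" for x s
  proof -
    have "norm (\<theta> x s - \<theta> x 0) \<le> K * norm (s - 0)"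
    proof (rule differentiable_bound[where S="{-T<..<T}" and f'="\<lambda>\<sigma> h. h *\<^sub>R G (\<theta> x \<sigma>)"])
      fix \<sigma> assume "\<sigma> \<in> {-T<..<T}"
      then show "(\<theta> x has_derivative (\<lambda>h. h *\<^sub>R G (\<theta> x \<sigma>))) (at \<sigma> within {-T<..<T})"
        using \<theta>(2)[of \<sigma> x] by (auto simp: has_vector_derivative_def intro: has_derivative_at_withinI)
      show "onorm (\<lambda>h. h *\<^sub>R G (\<theta> x \<sigma>)) \<le> K"
        using mult_left_mono[OF K[OF cp[of "\<theta> x \<sigma>"]] abs_ge_zero]
        by (intro onorm_le) (auto simp: G_def mult.commute)
    qed (use that T in auto)
    then show ?thesis by (simp add: \<theta>(1))
  qed
  have "(\<theta> x has_vector_derivative Y (\<theta> x s)) (at s)" if "x \<in> ball x1 1" "\<bar>s\<bar> < T" for x s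
  proof -
    have "K * \<bar>s\<bar> \<le> K * T" using that \<open>K > 0\<close> by simp
    then have "norm (\<theta> x s - x) \<le> 1" using bd[OF that(2), of x] TK by linarith
    then have "dist (\<theta> x s) x1 \<le> 2"
      using that(1) dist_triangle[of "\<theta> x s" x1 x] by (simp add: dist_norm norm_minus_commute)
    then have "closest_point ?B (\<theta> x s) = \<theta> x s"
      by (intro closest_point_self) (simp add: dist_commute)
    then show ?thesis using \<theta>(2)[OF that(2), of x] by (simp add: G_def)
  qed
  then show ?thesis using \<theta>(1) bd T \<open>K > 0\<close> by blast
qed

text \<open>Gronwall's argument for the squared distance \<open>D\<close> of the curves: its
  derivative is at most \<open>2 * L * D\<close> in absolute value, so after multiplication by an
  exponential weight it cannot grow away from 0 on either side. Since \<open>has_lie_deriv\<close>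
  refers to some integral curve, this is what makes \<open>lie\<close> well defined.\<close>

lemma integral_curve_unique:
  fixes Y :: "('n::finite) vfield"
  assumes Y: "smooth_vfield Y" and "\<epsilon> > 0"
    and g1: "\<And>s. \<bar>s\<bar> < \<epsilon> \<Longrightarrow> (\<gamma>1 has_vector_derivative Y (\<gamma>1 s)) (at s)"
    and g2: "\<And>s. \<bar>s\<bar> < \<epsilon> \<Longrightarrow> (\<gamma>2 has_vector_derivative Y (\<gamma>2 s)) (at s)"
    and eq0: "\<gamma>1 0 = \<gamma>2 0"
  shows "\<exists>\<delta>>0. \<forall>s. \<bar>s\<bar> < \<delta> \<longrightarrow> \<gamma>1 s = \<gamma>2 s"
proof -
  let ?x = "\<gamma>1 0"
  obtain L where L: "L > 0" "\<And>x y. x \<in> cball ?x 1 \<Longrightarrow> y \<in> cball ?x 1 \<Longrightarrow> norm (Y x - Y y) \<le> L * norm (x - y)"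
    using smooth_vfield_lipschitz[OF Y] by meson
  have c: "isCont \<gamma>1 0" "isCont \<gamma>2 0"
    using g1[of 0] g2[of 0] \<open>\<epsilon> > 0\<close> by (auto intro: has_vector_derivative_continuous)
  obtain d1 where d1: "d1 > 0" "\<And>s. \<bar>s\<bar> < d1 \<Longrightarrow> dist (\<gamma>1 s) ?x < 1"
    using c(1)[unfolded continuous_at_eps_delta, rule_format, of 1] by (auto simp: dist_norm)
  obtain d2 where d2: "d2 > 0" "\<And>s. \<bar>s\<bar> < d2 \<Longrightarrow> dist (\<gamma>2 s) ?x < 1"
    using c(2)[unfolded continuous_at_eps_delta, rule_format, of 1] by (auto simp: dist_norm eq0)
  define \<delta> where "\<delta> = min \<epsilon> (min d1 d2)"
  define D where "D s = (\<gamma>1 s - \<gamma>2 s) \<bullet> (\<gamma>1 s - \<gamma>2 s)" for s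
  define D' where "D' s = 2 * ((\<gamma>1 s - \<gamma>2 s) \<bullet> (Y (\<gamma>1 s) - Y (\<gamma>2 s)))" for s
  have DD: "(D has_real_derivative D' s) (at s)" and D'b: "\<bar>D' s\<bar> \<le> 2 * L * D s" if s: "\<bar>s\<bar> < \<delta>" for s
  proof -
    have "((\<lambda>s. \<gamma>1 s - \<gamma>2 s) has_vector_derivative Y (\<gamma>1 s) - Y (\<gamma>2 s)) (at s)"
      using s by (auto intro!: has_vector_derivative_diff g1 g2 simp: \<delta>_def)
    then have "((\<lambda>s. \<gamma>1 s - \<gamma>2 s) has_derivative (\<lambda>h. h *\<^sub>R (Y (\<gamma>1 s) - Y (\<gamma>2 s)))) (at s)"
      by (simp add: has_vector_derivative_def)
    from has_derivative_inner[OF this this] show "(D has_real_derivative D' s) (at s)"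
      unfolding D_def D'_def has_field_derivative_def
      by (rule has_derivative_eq_rhs) (auto simp: inner_commute algebra_simps)
    have "\<bar>D' s\<bar> \<le> 2 * (norm (\<gamma>1 s - \<gamma>2 s) * norm (Y (\<gamma>1 s) - Y (\<gamma>2 s)))"
      unfolding D'_def abs_mult using Cauchy_Schwarz_ineq2 by (simp add: abs_mult)
    also have "\<dots> \<le> 2 * (norm (\<gamma>1 s - \<gamma>2 s) * (L * norm (\<gamma>1 s - \<gamma>2 s)))"
      using d1(2)[of s] d2(2)[of s] s
      by (intro mult_left_mono L) (auto simp: \<delta>_def dist_commute less_imp_le)
    also have "\<dots> = 2 * L * D s"
      by (simp add: D_def dot_square_norm power2_eq_square mult_ac)
    finally show "\<bar>D' s\<bar> \<le> 2 * L * D s" .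
  qed
  have D0: "D 0 = 0" by (simp add: D_def eq0)
  have Dnn: "D s \<ge> 0" for s by (simp add: D_def)
  have "D s = 0" if s: "\<bar>s\<bar> < \<delta>" for s
  proof (cases "s \<ge> 0")
    case True
    have "D s * exp (- 2 * L * s) \<le> D 0 * exp (- 2 * L * 0)"
    proof (rule DERIV_nonpos_imp_nonincreasing[OF True])
      fix x assume x: "0 \<le> x" "x \<le> s"
      have "((\<lambda>s. D s * exp (- 2 * L * s)) has_real_derivative (D' x - 2 * L * D x) * exp (- 2 * L * x)) (at x)"
        using x s by (auto intro!: derivative_eq_intros DD simp: algebra_simps)
      moreover have "(D' x - 2 * L * D x) * exp (- 2 * L * x) \<le> 0"
        using D'b[of x] x s by (intro mult_nonpos_nonneg) auto
      ultimately show "\<exists>y. ((\<lambda>s. D s * exp (- 2 * L * s)) has_real_derivative y) (at x) \<and> y \<le> 0" by blast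
    qed
    then have "D s \<le> 0" by (simp add: D0 mult_le_0_iff)
    with Dnn[of s] show ?thesis by simp
  next
    case False
    have "D s * exp (2 * L * s) \<le> D 0 * exp (2 * L * 0)"
    proof (rule DERIV_nonneg_imp_nondecreasing[where f="\<lambda>s. D s * exp (2 * L * s)"])
      fix x assume x: "s \<le> x" "x \<le> 0"
      have "((\<lambda>s. D s * exp (2 * L * s)) has_real_derivative (D' x + 2 * L * D x) * exp (2 * L * x)) (at x)"
        using x s by (auto intro!: derivative_eq_intros DD simp: algebra_simps)
      moreover have "(D' x + 2 * L * D x) * exp (2 * L * x) \<ge> 0"
        using D'b[of x] x s by (intro mult_nonneg_nonneg) auto
      ultimately show "\<exists>y. ((\<lambda>s. D s * exp (2 * L * s)) has_real_derivative y) (at x) \<and> y \<ge> 0" by blast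
    qed (use False in simp)
    then have "D s \<le> 0" by (simp add: D0 mult_le_0_iff)
    with Dnn[of s] show ?thesis by simp
  qed
  then have "\<forall>s. \<bar>s\<bar> < \<delta> \<longrightarrow> \<gamma>1 s = \<gamma>2 s" by (simp add: D_def)
  moreover have "\<delta> > 0" using d1 d2 \<open>\<epsilon> > 0\<close> by (simp add: \<delta>_def)
  ultimately show ?thesis by blast
qed

text \<open>After a shift of time \<gamma> starts at \<open>\<gamma> s0\<close> and agrees near 0
  with the curve hidden in \<open>has_lie_deriv\<close>. This is what permits Taylor expansion along
  a whole piece of an integral curve.\<close>

lemma has_lie_deriv_along:
  fixes Y :: "('n::finite) vfield"
  assumes Y: "smooth_vfield Y" and u: "has_lie_deriv Y u (\<gamma> s0, t) l" and s0: "\<bar>s0\<bar> < \<epsilon>"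
    and g: "\<And>s. \<bar>s\<bar> < \<epsilon> \<Longrightarrow> (\<gamma> has_vector_derivative Y (\<gamma> s)) (at s)"
  shows "((\<lambda>s. u (\<gamma> s, t)) has_real_derivative l) (at s0)"
proof -
  obtain \<eta> \<epsilon>' where \<eta>: "\<epsilon>' > 0" "\<eta> 0 = \<gamma> s0" "\<And>s. \<bar>s\<bar> < \<epsilon>' \<Longrightarrow> (\<eta> has_vector_derivative Y (\<eta> s)) (at s)"
    and l: "((\<lambda>s. u (\<eta> s, t)) has_real_derivative l) (at 0)"
    using u unfolding has_lie_deriv_def by auto
  define \<epsilon>'' where "\<epsilon>'' = min \<epsilon>' (\<epsilon> - \<bar>s0\<bar>)"
  have sh: "((\<lambda>s. \<gamma> (s0 + s)) has_vector_derivative Y (\<gamma> (s0 + s))) (at s)" if "\<bar>s\<bar> < \<epsilon>''" for s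
  proof -
    have "(\<gamma> has_vector_derivative Y (\<gamma> (s0 + s))) (at (s0 + s))"
      using that by (intro g) (auto simp: \<epsilon>''_def)
    moreover have "((\<lambda>s. s0 + s) has_vector_derivative 1) (at s)"
      by (auto intro!: derivative_eq_intros)
    ultimately show ?thesis
      using vector_diff_chain_at[of "\<lambda>s. s0 + s" 1 s \<gamma>] by (simp add: o_def)
  qed
  obtain \<delta> where \<delta>: "\<delta> > 0" "\<And>s. \<bar>s\<bar> < \<delta> \<Longrightarrow> \<eta> s = \<gamma> (s0 + s)"
    using integral_curve_unique[OF Y, of \<epsilon>'' \<eta> "\<lambda>s. \<gamma> (s0 + s)"] \<eta> sh s0
    by (auto simp: \<epsilon>''_def)
  have "((\<lambda>s. u (\<gamma> (s0 + s), t)) has_real_derivative l) (at 0)"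
    by (rule DERIV_cong_ev[THEN iffD1, OF refl _ refl l])
       (use \<delta> in \<open>auto simp: eventually_nhds_metric dist_norm intro!: exI[of _ \<delta>]\<close>)
  then show ?thesis using DERIV_shift[of "\<lambda>s. u (\<gamma> s, t)" l 0 s0] by (simp add: add.commute)
qed

lemma has_lie_deriv_unique:
  assumes "smooth_vfield Y" "has_lie_deriv Y u z l" "has_lie_deriv Y u z l'"
  shows "l = l'"
proof -
  obtain \<gamma> \<epsilon> where g: "\<epsilon> > 0" "\<gamma> 0 = fst z" "\<And>s. \<bar>s\<bar> < \<epsilon> \<Longrightarrow> (\<gamma> has_vector_derivative Y (\<gamma> s)) (at s)"
    using assms(2) unfolding has_lie_deriv_def by blast
  then have "has_lie_deriv Y u (\<gamma> 0, snd z) l" "has_lie_deriv Y u (\<gamma> 0, snd z) l'"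
    using assms(2,3) by simp_all
  then have "((\<lambda>s. u (\<gamma> s, snd z)) has_real_derivative l) (at 0)"
      "((\<lambda>s. u (\<gamma> s, snd z)) has_real_derivative l') (at 0)"
    using has_lie_deriv_along[OF assms(1) _ _ g(3)] g(1) by auto
  then show ?thesis by (rule DERIV_unique)
qed

lemma lie_eqI: "smooth_vfield Y \<Longrightarrow> has_lie_deriv Y u z l \<Longrightarrow> lie Y u z = l"
  unfolding lie_def by (rule the_equality) (auto dest: has_lie_deriv_unique)

lemma has_lie_deriv_lie: "smooth_vfield Y \<Longrightarrow> lie_exists Y u z \<Longrightarrow> has_lie_deriv Y u z (lie Y u z)"
  unfolding lie_exists_def using lie_eqI by metis

text \<open>Some integral curve through the point exists, so a property shown for all of them yields
  the existential definition; the calculus rules then reduce to those for real functions.\<close>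

lemma has_lie_derivI_curves:
  fixes Y :: "('n::finite) vfield"
  assumes Y: "smooth_vfield Y"
    and "\<And>\<gamma> \<epsilon>. \<epsilon> > 0 \<Longrightarrow> \<gamma> 0 = fst z \<Longrightarrow> (\<And>s. \<bar>s\<bar> < \<epsilon> \<Longrightarrow> (\<gamma> has_vector_derivative Y (\<gamma> s)) (at s)) \<Longrightarrow>
      ((\<lambda>s. u (\<gamma> s, snd z)) has_real_derivative l) (at 0)"
  shows "has_lie_deriv Y u z l"
proof -
  obtain T K \<theta> where "T > 0" "\<forall>x\<in>ball (fst z) 1. \<theta> x 0 = x \<and>
    (\<forall>s. \<bar>s\<bar> < T \<longrightarrow> (\<theta> x has_vector_derivative Y (\<theta> x s)) (at s) \<and> norm (\<theta> x s - x) \<le> K * \<bar>s\<bar>)"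
    using local_flow_ex[OF Y, of "fst z"] by blast
  then show ?thesis
    unfolding has_lie_deriv_def using assms(2)[of T "\<theta> (fst z)"]
    by (intro exI[of _ "\<theta> (fst z)"] exI[of _ T]) auto
qed

lemma has_lie_deriv_at0:
  fixes Y :: "('n::finite) vfield"
  assumes "smooth_vfield Y" "has_lie_deriv Y u z l" "\<epsilon> > 0" "\<gamma> 0 = fst z"
    "\<And>s. \<bar>s\<bar> < \<epsilon> \<Longrightarrow> (\<gamma> has_vector_derivative Y (\<gamma> s)) (at s)"
  shows "((\<lambda>s. u (\<gamma> s, snd z)) has_real_derivative l) (at 0)"
  by (rule has_lie_deriv_along[of Y u \<gamma> 0 "snd z" l \<epsilon>]) (use assms in auto)

section \<open>Calculus rules for Lie derivatives\<close>

lemma has_lie_deriv_mult: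
  assumes "smooth_vfield Y" "has_lie_deriv Y u z l" "has_lie_deriv Y v z k"
  shows "has_lie_deriv Y (\<lambda>w. u w * v w) z (l * v z + u z * k)"
proof (rule has_lie_derivI_curves[OF assms(1)])
  fix \<gamma> and \<epsilon> :: real
  assume g: "\<epsilon> > 0" "\<gamma> 0 = fst z" "\<And>s. \<bar>s\<bar> < \<epsilon> \<Longrightarrow> (\<gamma> has_vector_derivative Y (\<gamma> s)) (at s)"
  show "((\<lambda>s. u (\<gamma> s, snd z) * v (\<gamma> s, snd z)) has_real_derivative l * v z + u z * k) (at 0)"
    using DERIV_mult[OF has_lie_deriv_at0[OF assms(1,2) g] has_lie_deriv_at0[OF assms(1,3) g]] g(2)
    by (simp add: mult.commute)
qed

lemma has_lie_deriv_add_scaled: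
  assumes "smooth_vfield Y" "has_lie_deriv Y u z l" "has_lie_deriv Y v z k"
  shows "has_lie_deriv Y (\<lambda>w. u w + q * v w) z (l + q * k)"
proof (rule has_lie_derivI_curves[OF assms(1)])
  fix \<gamma> and \<epsilon> :: real
  assume g: "\<epsilon> > 0" "\<gamma> 0 = fst z" "\<And>s. \<bar>s\<bar> < \<epsilon> \<Longrightarrow> (\<gamma> has_vector_derivative Y (\<gamma> s)) (at s)"
  show "((\<lambda>s. u (\<gamma> s, snd z) + q * v (\<gamma> s, snd z)) has_real_derivative l + q * k) (at 0)"
    by (intro DERIV_add DERIV_cmult has_lie_deriv_at0[OF assms(1,2) g] has_lie_deriv_at0[OF assms(1,3) g])
qed

text \<open>Barriers are smooth in space, so their Lie derivatives come from the chain rule at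
  frozen time.\<close>

lemma has_lie_deriv_frechet:
  fixes Y :: "('n::finite) vfield"
  assumes Y: "smooth_vfield Y" and h: "((\<lambda>x. h (x, snd z)) has_derivative D) (at (fst z))"
  shows "has_lie_deriv Y h z (D (Y (fst z)))"
proof (rule has_lie_derivI_curves[OF Y])
  fix \<gamma> and \<epsilon> :: real
  assume g: "\<epsilon> > 0" "\<gamma> 0 = fst z" "\<And>s. \<bar>s\<bar> < \<epsilon> \<Longrightarrow> (\<gamma> has_vector_derivative Y (\<gamma> s)) (at s)"
  have "(\<gamma> has_derivative (\<lambda>k. k *\<^sub>R Y (fst z))) (at 0)"
    using g(3)[of 0] g(1,2) by (simp add: has_vector_derivative_def)
  then have "((\<lambda>s. h (\<gamma> s, snd z)) has_derivative (\<lambda>k. D (k *\<^sub>R Y (fst z)))) (at 0)"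
    using has_derivative_compose[of \<gamma> _ 0 UNIV "\<lambda>x. h (x, snd z)" D] h g(2) by (simp add: o_def)
  moreover have "(\<lambda>k. D (k *\<^sub>R Y (fst z))) = (\<lambda>k. D (Y (fst z)) * k)"
    using linear_cmul[OF has_derivative_linear[OF h]] by (auto simp: mult.commute)
  ultimately show "((\<lambda>s. h (\<gamma> s, snd z)) has_real_derivative D (Y (fst z))) (at 0)"
    by (simp add: has_field_derivative_def)
qed

section \<open>Second-order conditions at a maximum\<close>

text \<open>Induction on the dimension by completing the square in the last variable: what remains
  is the Schur complement, again symmetric and positive definite.\<close>

lemma positive_definite_sum_squares:
  fixes A :: "nat \<Rightarrow> nat \<Rightarrow> real"
  assumes "\<And>i j. i < m \<Longrightarrow> j < m \<Longrightarrow> A i j = A j i"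
    and "\<And>v. (\<exists>i<m. v i \<noteq> 0) \<Longrightarrow> 0 < (\<Sum>i<m. \<Sum>j<m. A i j * v i * v j)"
  shows "\<exists>V. \<forall>i<m. \<forall>j<m. A i j = (\<Sum>k<m. V k i * V k j)"
  using assms
proof (induction m arbitrary: A)
  case 0
  then show ?case by simp
next
  case (Suc m)
  let ?d = "A m m"
  have form: "(\<Sum>i<Suc m. \<Sum>j<Suc m. A i j * w i * w j)
      = (\<Sum>i<m. \<Sum>j<m. A i j * w i * w j) + 2 * (\<Sum>i<m. A i m * w i) * w m + ?d * (w m)\<^sup>2" for w
  proof -
    have "(\<Sum>j<m. A m j * w m * w j) = (\<Sum>i<m. A i m * w i) * w m"
      unfolding sum_distrib_right by (rule sum.cong) (use Suc.prems(1)[of m] in auto)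
    then show ?thesis
      by (simp add: sum.distrib sum_distrib_right power2_eq_square)
  qed
  have d: "?d > 0"
    using Suc.prems(2)[of "\<lambda>i. if i = m then 1 else 0"] unfolding form by auto
  define A' where "A' i j = A i j - A i m * A m j / ?d" for i j
  have "\<exists>V. \<forall>i<m. \<forall>j<m. A' i j = (\<Sum>k<m. V k i * V k j)"
  proof (rule Suc.IH)
    show "A' i j = A' j i" if "i < m" "j < m" for i j
      using Suc.prems(1)[of i j] Suc.prems(1)[of i m] Suc.prems(1)[of j m] that by (simp add: A'_def)
    fix v :: "nat \<Rightarrow> real" assume v: "\<exists>i<m. v i \<noteq> 0"
    define t where "t = (\<Sum>i<m. A i m * v i)"
    \<comment> \<open>This last coordinate minimises the form for given \<open>v\<close>, so that
      the form at \<open>w\<close> equals the Schur complement at \<open>v\<close>.\<close>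
    define w where "w = v(m := - t / ?d)"
    have "0 < (\<Sum>i<Suc m. \<Sum>j<Suc m. A i j * w i * w j)"
      using v by (intro Suc.prems(2)) (auto simp: w_def)
    also have "\<dots> = (\<Sum>i<m. \<Sum>j<m. A i j * v i * v j) + 2 * t * (- t / ?d) + ?d * (- t / ?d)\<^sup>2"
      unfolding form by (simp add: w_def t_def)
    also have "\<dots> = (\<Sum>i<m. \<Sum>j<m. A i j * v i * v j) - t * t / ?d"
      using d by (simp add: field_simps power2_eq_square)
    also have "t * t = (\<Sum>i<m. \<Sum>j<m. A i m * A m j * v i * v j)"
      unfolding t_def sum_product
      by (intro sum.cong refl) (use Suc.prems(1)[of _ m] in \<open>auto simp: mult_ac\<close>)
    also have "(\<Sum>i<m. \<Sum>j<m. A i j * v i * v j) - (\<Sum>i<m. \<Sum>j<m. A i m * A m j * v i * v j) / ?d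
        = (\<Sum>i<m. \<Sum>j<m. A' i j * v i * v j)"
      by (simp add: A'_def sum_divide_distrib sum_subtractf algebra_simps)
    finally show "0 < (\<Sum>i<m. \<Sum>j<m. A' i j * v i * v j)" .
  qed
  then obtain V where V: "\<And>i j. i < m \<Longrightarrow> j < m \<Longrightarrow> A' i j = (\<Sum>k<m. V k i * V k j)" by blast
  \<comment> \<open>The new row \<open>m\<close> carries the eliminated square; the old rows are
    extended by 0 in the new column.\<close>
  define W where "W k i = (if k < m then (if i < m then V k i else 0) else A i m / sqrt ?d)" for k i
  have "A i j = (\<Sum>k<Suc m. W k i * W k j)" if ij: "i < Suc m" "j < Suc m" for i j
  proof -
    have "(\<Sum>k<m. W k i * W k j) = (if i < m \<and> j < m then A' i j else 0)"
    proof (cases "i < m \<and> j < m")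
      case False
      then have "W k i * W k j = 0" if "k < m" for k using that by (auto simp: W_def)
      then show ?thesis using False by (auto intro: sum.neutral)
    qed (simp add: W_def V)
    moreover have "W m i * W m j = A i m * A m j / ?d"
      using d Suc.prems(1)[of j m] ij by (simp add: W_def)
    moreover have "A i m * A m j / ?d = A i j" if "\<not> (i < m \<and> j < m)"
      using that ij d by (cases "i = m") (auto simp: less_Suc_eq)
    ultimately show ?thesis by (simp add: A'_def)
  qed
  then show ?case by blast
qed

text \<open>The Lie derivatives only control \<open>w\<close> along single fields, so the second-order expansion is taken
  along broken curves following \<open>Y 0, Y 1, ...\<close> for the times \<open>v 0 * s, v 1 * s, ...\<close>\<close>
lemma zigzag_expansion:
  fixes Y :: "nat \<Rightarrow> ('n::finite) vfield"
  assumes Y: "\<And>k. k < n \<Longrightarrow> smooth_vfield (Y k)"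
    and U: "open U" "x1 \<in> U"
    and w: "\<And>x k. x \<in> U \<Longrightarrow> k < n \<Longrightarrow> has_lie_deriv (Y k) w (x,t) (g k (x,t))"
    and g: "\<And>x k l. x \<in> U \<Longrightarrow> k < n \<Longrightarrow> l < n \<Longrightarrow> has_lie_deriv (Y k) (g l) (x,t) (q k l (x,t))"
    and q: "\<And>k l. k < n \<Longrightarrow> l < n \<Longrightarrow> isCont (\<lambda>x. q k l (x,t)) x1"
    and g0: "\<And>l. l < n \<Longrightarrow> g l (x1,t) = 0"
    and "N \<le> n"
  shows "\<exists>E. (E \<longlongrightarrow> x1) (at_right 0) \<and>
    (\<forall>l<n. ((\<lambda>s. g l (E s,t) / s) \<longlongrightarrow> (\<Sum>k<N. v k * q k l (x1,t))) (at_right 0)) \<and>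
    ((\<lambda>s. (w (E s,t) - w (x1,t)) / s\<^sup>2) \<longlongrightarrow>
      (\<Sum>k<N. (v k)\<^sup>2 * q k k (x1,t) / 2 + v k * (\<Sum>j<k. v j * q j k (x1,t)))) (at_right 0)"
  using \<open>N \<le> n\<close>
proof (induction N)
  case 0
  then show ?case by (intro exI[of _ "\<lambda>_. x1"]) (auto simp: g0)
next
  case (Suc N)
  then have N: "N < n" by simp
  from Suc obtain E where E: "(E \<longlongrightarrow> x1) (at_right 0)"
    and Eg: "\<And>l. l < n \<Longrightarrow> ((\<lambda>s. g l (E s,t) / s) \<longlongrightarrow> (\<Sum>k<N. v k * q k l (x1,t))) (at_right 0)"
    and Ew: "((\<lambda>s. (w (E s,t) - w (x1,t)) / s\<^sup>2) \<longlongrightarrow>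
      (\<Sum>k<N. (v k)\<^sup>2 * q k k (x1,t) / 2 + v k * (\<Sum>j<k. v j * q j k (x1,t)))) (at_right 0)"
    by auto
  obtain T K \<theta> where T: "T > 0" "K > 0"
    and \<theta>0: "\<And>x. x \<in> ball x1 1 \<Longrightarrow> \<theta> x 0 = x"
    and \<theta>: "\<And>x s. x \<in> ball x1 1 \<Longrightarrow> \<bar>s\<bar> < T \<Longrightarrow> (\<theta> x has_vector_derivative Y N (\<theta> x s)) (at s)"
    and \<theta>K: "\<And>x s. x \<in> ball x1 1 \<Longrightarrow> \<bar>s\<bar> < T \<Longrightarrow> norm (\<theta> x s - x) \<le> K * \<bar>s\<bar>"
    using local_flow_ex[OF Y[OF N], of x1] by metis
  obtain r where r: "r > 0" "ball x1 r \<subseteq> U" using U open_contains_ball by blast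
  define E' where "E' s = \<theta> (E s) (v N * s)" for s
  have vs0: "((\<lambda>s. v N * s) \<longlongrightarrow> 0) (at_right 0)"
    by (rule tendsto_eq_intros | simp)+
  have ev: "\<forall>\<^sub>F s in at_right 0. dist (E s) x1 < min 1 (r/2) \<and> \<bar>v N * s\<bar> < min T (r / (2 * K)) \<and> s > 0"
  proof (intro eventually_conj)
    show "\<forall>\<^sub>F s in at_right 0. dist (E s) x1 < min 1 (r/2)"
      using tendstoD[OF E, of "min 1 (r/2)"] r by simp
    show "\<forall>\<^sub>F s in at_right 0. \<bar>v N * s\<bar> < min T (r / (2 * K))"
      using tendstoD[OF vs0, of "min T (r / (2 * K))"] r T by simp
    show "\<forall>\<^sub>F s::real in at_right 0. s > 0" by (simp add: eventually_at_right_less)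
  qed
  have inU: "\<theta> (E s) \<sigma> \<in> U \<and> \<bar>\<sigma>\<bar> < T \<and> dist (\<theta> (E s) \<sigma>) x1 \<le> K * \<bar>v N * s\<bar> + dist (E s) x1"
    if s: "dist (E s) x1 < min 1 (r/2) \<and> \<bar>v N * s\<bar> < min T (r / (2 * K)) \<and> s > 0" and \<sigma>: "\<bar>\<sigma>\<bar> \<le> \<bar>v N * s\<bar>" for s \<sigma>
  proof -
    have 1: "E s \<in> ball x1 1" "\<bar>\<sigma>\<bar> < T" using s \<sigma> by (auto simp: dist_commute)
    have "K * \<bar>\<sigma>\<bar> \<le> K * \<bar>v N * s\<bar>" using \<sigma> T by simp
    moreover have "K * \<bar>v N * s\<bar> < r / 2" using s T by (simp add: field_simps)
    moreover have "dist (\<theta> (E s) \<sigma>) x1 \<le> dist (\<theta> (E s) \<sigma>) (E s) + dist (E s) x1" by (rule dist_triangle)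
    moreover have "dist (\<theta> (E s) \<sigma>) (E s) \<le> K * \<bar>\<sigma>\<bar>" using \<theta>K[OF 1] by (simp add: dist_norm)
    ultimately have "dist (\<theta> (E s) \<sigma>) x1 \<le> K * \<bar>v N * s\<bar> + dist (E s) x1 \<and> dist (\<theta> (E s) \<sigma>) x1 < r"
      using s by linarith
    with r 1 show ?thesis by (auto simp: dist_commute)
  qed
  have Dw: "((\<lambda>\<sigma>. w (\<theta> (E s) \<sigma>, t)) has_real_derivative g N (\<theta> (E s) \<sigma>, t)) (at \<sigma>)"
    and Dg: "\<And>l. l < n \<Longrightarrow> ((\<lambda>\<sigma>. g l (\<theta> (E s) \<sigma>, t)) has_real_derivative q N l (\<theta> (E s) \<sigma>, t)) (at \<sigma>)"
    if s: "dist (E s) x1 < min 1 (r/2) \<and> \<bar>v N * s\<bar> < min T (r / (2 * K)) \<and> s > 0" and \<sigma>: "\<bar>\<sigma>\<bar> \<le> \<bar>v N * s\<bar>" for s \<sigma>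
  proof -
    have Es: "E s \<in> ball x1 1" using s by (auto simp: dist_commute)
    note al = has_lie_deriv_along[OF Y[OF N] _ _ \<theta>[OF Es], of _ \<sigma> t]
    show "((\<lambda>\<sigma>. w (\<theta> (E s) \<sigma>, t)) has_real_derivative g N (\<theta> (E s) \<sigma>, t)) (at \<sigma>)"
      using inU[OF s \<sigma>] w[OF _ N] by (intro al) auto
    show "((\<lambda>\<sigma>. g l (\<theta> (E s) \<sigma>, t)) has_real_derivative q N l (\<theta> (E s) \<sigma>, t)) (at \<sigma>)" if "l < n" for l
      using inU[OF s \<sigma>] g[OF _ N that] by (intro al) auto
  qed
  \<comment> \<open>The mean value points on the last leg depend on \<open>s\<close> in an
    uncontrolled way, but the whole leg shrinks to \<open>x1\<close>, where \<open>q\<close> is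
    continuous.\<close>
  have qlim: "((\<lambda>s. q N l (\<theta> (E s) (\<xi> s), t)) \<longlongrightarrow> q N l (x1,t)) (at_right 0)"
    if \<xi>: "\<forall>\<^sub>F s in at_right 0. \<bar>\<xi> s\<bar> \<le> \<bar>v N * s\<bar>" and l: "l < n" for \<xi> l
  proof -
    have "((\<lambda>s. dist (\<theta> (E s) (\<xi> s)) x1) \<longlongrightarrow> 0) (at_right 0)"
    proof (rule tendsto_sandwich[of "\<lambda>_. 0"])
      show "\<forall>\<^sub>F s in at_right 0. dist (\<theta> (E s) (\<xi> s)) x1 \<le> K * \<bar>v N * s\<bar> + dist (E s) x1"
        using ev \<xi> by eventually_elim (use inU in blast)
      have "((\<lambda>s. K * \<bar>v N * s\<bar> + dist (E s) x1) \<longlongrightarrow> K * \<bar>0\<bar> + dist x1 x1) (at_right 0)"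
        by (intro tendsto_intros vs0 E)
      then show "((\<lambda>s. K * \<bar>v N * s\<bar> + dist (E s) x1) \<longlongrightarrow> 0) (at_right 0)" by simp
    qed auto
    then have "((\<lambda>s. \<theta> (E s) (\<xi> s)) \<longlongrightarrow> x1) (at_right 0)"
      using tendsto_dist_iff by blast
    then show ?thesis by (rule isCont_tendsto_compose[OF q[OF N l]])
  qed
  have E'lim: "(E' \<longlongrightarrow> x1) (at_right 0)"
  proof -
    have "((\<lambda>s. dist (E' s) x1) \<longlongrightarrow> 0) (at_right 0)"
    proof (rule tendsto_sandwich[of "\<lambda>_. 0"])
      show "\<forall>\<^sub>F s in at_right 0. dist (E' s) x1 \<le> K * \<bar>v N * s\<bar> + dist (E s) x1"
        using ev by eventually_elim (use inU in \<open>auto simp: E'_def\<close>)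
      have "((\<lambda>s. K * \<bar>v N * s\<bar> + dist (E s) x1) \<longlongrightarrow> K * \<bar>0\<bar> + dist x1 x1) (at_right 0)"
        by (intro tendsto_intros vs0 E)
      then show "((\<lambda>s. K * \<bar>v N * s\<bar> + dist (E s) x1) \<longlongrightarrow> 0) (at_right 0)" by simp
    qed auto
    then show ?thesis using tendsto_dist_iff by blast
  qed
  have E'g: "((\<lambda>s. g l (E' s,t) / s) \<longlongrightarrow> (\<Sum>k<Suc N. v k * q k l (x1,t))) (at_right 0)" if l: "l < n" for l
  proof -
    have "\<forall>\<^sub>F s in at_right 0. \<exists>\<xi>. \<bar>\<xi>\<bar> \<le> \<bar>v N * s\<bar> \<and> g l (E' s,t) = g l (E s,t) + q N l (\<theta> (E s) \<xi>, t) * (v N * s)"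
      using ev
    proof eventually_elim
      case (elim s)
      have "E s \<in> ball x1 1" using elim by (auto simp: dist_commute)
      then show ?case
        using Maclaurin_bi_le[of "\<lambda>k \<sigma>. if k = 0 then g l (\<theta> (E s) \<sigma>, t) else q N l (\<theta> (E s) \<sigma>, t)"
            "\<lambda>\<sigma>. g l (\<theta> (E s) \<sigma>, t)" 1 "v N * s"] Dg[OF elim _ l]
        by (auto simp: E'_def \<theta>0)
    qed
    then obtain \<xi> where \<xi>: "\<forall>\<^sub>F s in at_right 0. \<bar>\<xi> s\<bar> \<le> \<bar>v N * s\<bar> \<and> g l (E' s,t) = g l (E s,t) + q N l (\<theta> (E s) (\<xi> s), t) * (v N * s)"
      unfolding eventually_ex by blast
    have "((\<lambda>s. g l (E s,t) / s + v N * q N l (\<theta> (E s) (\<xi> s), t)) \<longlongrightarrow>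
      (\<Sum>k<N. v k * q k l (x1,t)) + v N * q N l (x1,t)) (at_right 0)"
      by (intro tendsto_intros Eg l qlim eventually_mono[OF \<xi>]) auto
    moreover have "\<forall>\<^sub>F s in at_right 0. g l (E s,t) / s + v N * q N l (\<theta> (E s) (\<xi> s), t) = g l (E' s,t) / s"
      using \<xi> ev by eventually_elim (auto simp: field_simps)
    ultimately show ?thesis by (auto intro: Lim_transform_eventually)
  qed
  \<comment> \<open>Second-order Taylor expansion along the last leg. The derivative
    \<open>g N\<close> at the corner, divided by \<open>s\<close>, has the limit known from the
    earlier legs, and this supplies the mixed terms \<open>q j N\<close> with
    \<open>j < N\<close>.\<close>
  have E'w: "((\<lambda>s. (w (E' s,t) - w (x1,t)) / s\<^sup>2) \<longlongrightarrow>
      (\<Sum>k<Suc N. (v k)\<^sup>2 * q k k (x1,t) / 2 + v k * (\<Sum>j<k. v j * q j k (x1,t)))) (at_right 0)"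
  proof -
    have "\<forall>\<^sub>F s in at_right 0. \<exists>\<xi>. \<bar>\<xi>\<bar> \<le> \<bar>v N * s\<bar> \<and>
      w (E' s,t) = w (E s,t) + g N (E s,t) * (v N * s) + q N N (\<theta> (E s) \<xi>, t) * (v N * s)\<^sup>2 / 2"
      using ev
    proof eventually_elim
      case (elim s)
      have "E s \<in> ball x1 1" using elim by (auto simp: dist_commute)
      then show ?case
        using Maclaurin_bi_le[of "\<lambda>k \<sigma>. if k = 0 then w (\<theta> (E s) \<sigma>, t) else if k = 1 then g N (\<theta> (E s) \<sigma>, t) else q N N (\<theta> (E s) \<sigma>, t)"
            "\<lambda>\<sigma>. w (\<theta> (E s) \<sigma>, t)" 2 "v N * s"] Dg[OF elim _ N] Dw[OF elim]
        by (auto simp: E'_def \<theta>0 less_2_cases_iff numeral_2_eq_2)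
    qed
    then obtain \<xi> where \<xi>: "\<forall>\<^sub>F s in at_right 0. \<bar>\<xi> s\<bar> \<le> \<bar>v N * s\<bar> \<and>
      w (E' s,t) = w (E s,t) + g N (E s,t) * (v N * s) + q N N (\<theta> (E s) (\<xi> s), t) * (v N * s)\<^sup>2 / 2"
      unfolding eventually_ex by blast
    have "((\<lambda>s. (w (E s,t) - w (x1,t)) / s\<^sup>2 + ((v N)\<^sup>2 * q N N (\<theta> (E s) (\<xi> s), t) / 2 + v N * (g N (E s,t) / s))) \<longlongrightarrow>
      (\<Sum>k<N. (v k)\<^sup>2 * q k k (x1,t) / 2 + v k * (\<Sum>j<k. v j * q j k (x1,t)))
      + ((v N)\<^sup>2 * q N N (x1,t) / 2 + v N * (\<Sum>k<N. v k * q k N (x1,t)))) (at_right 0)"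
      by (intro tendsto_intros Ew Eg N qlim eventually_mono[OF \<xi>]) auto
    moreover have "\<forall>\<^sub>F s in at_right 0. (w (E s,t) - w (x1,t)) / s\<^sup>2 + ((v N)\<^sup>2 * q N N (\<theta> (E s) (\<xi> s), t) / 2 + v N * (g N (E s,t) / s))
        = (w (E' s,t) - w (x1,t)) / s\<^sup>2"
      using \<xi> ev
    proof eventually_elim
      case (elim s)
      then have "s \<noteq> 0" by simp
      then show ?case
        by (simp add: elim(1) field_simps power2_eq_square)
    qed
    ultimately show ?thesis by (auto intro: Lim_transform_eventually)
  qed
  show ?case using E'lim E'g E'w by blast
qed

lemma second_order_max:
  fixes Y :: "nat \<Rightarrow> ('n::finite) vfield"
  assumes Y: "\<And>k. k < n \<Longrightarrow> smooth_vfield (Y k)"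
    and U: "open U" "x1 \<in> U"
    and w: "\<And>x k. x \<in> U \<Longrightarrow> k < n \<Longrightarrow> has_lie_deriv (Y k) w (x,t) (g k (x,t))"
    and g: "\<And>x k l. x \<in> U \<Longrightarrow> k < n \<Longrightarrow> l < n \<Longrightarrow> has_lie_deriv (Y k) (g l) (x,t) (q k l (x,t))"
    and q: "\<And>k l. k < n \<Longrightarrow> l < n \<Longrightarrow> isCont (\<lambda>x. q k l (x,t)) x1"
    and max: "\<And>x. x \<in> U \<Longrightarrow> w (x,t) \<le> w (x1,t)"
  shows "\<And>l. l < n \<Longrightarrow> g l (x1,t) = 0"
    and "(\<Sum>k<n. \<Sum>j<n. v k * v j * q j k (x1,t)) \<le> 0"
proof -
  show g0: "g l (x1,t) = 0" if l: "l < n" for l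
  proof -
    obtain \<gamma> \<epsilon> where \<gamma>: "\<epsilon> > 0" "\<gamma> 0 = x1" "\<And>s. \<bar>s\<bar> < \<epsilon> \<Longrightarrow> (\<gamma> has_vector_derivative Y l (\<gamma> s)) (at s)"
      "((\<lambda>s. w (\<gamma> s, t)) has_real_derivative g l (x1,t)) (at 0)"
      using w[OF U(2) l] unfolding has_lie_deriv_def by auto
    have "isCont \<gamma> 0" using \<gamma>(1) \<gamma>(3)[of 0] by (auto intro: has_vector_derivative_continuous)
    then have "\<forall>\<^sub>F s in at 0. \<gamma> s \<in> U"
      using U \<gamma>(2) unfolding isCont_def by (intro topological_tendstoD) auto
    then obtain d where d: "d > 0" "\<And>s. s \<noteq> 0 \<Longrightarrow> \<bar>s\<bar> < d \<Longrightarrow> \<gamma> s \<in> U"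
      unfolding eventually_at by (auto simp: dist_norm)
    have "w (\<gamma> s, t) \<le> w (\<gamma> 0, t)" if "\<bar>0 - s\<bar> < d" for s
      using d(2)[of s] that max[of "\<gamma> s"] by (cases "s = 0") (auto simp: \<gamma>(2))
    then show ?thesis
      using DERIV_local_max[OF \<gamma>(4) d(1)] by blast
  qed
  \<comment> \<open>One order of the legs sees \<open>q j k\<close> only for \<open>j\<close> before
    \<open>k\<close>, and \<open>q k j\<close> may differ from it by a bracket term. Hence the
    reordering \<pi>, into which the given and the reversed order are inserted.\<close>
  have half: "(\<Sum>k<n. (u k)\<^sup>2 * q (\<pi> k) (\<pi> k) (x1,t) / 2 + u k * (\<Sum>j<k. u j * q (\<pi> j) (\<pi> k) (x1,t))) \<le> 0"
    if \<pi>: "\<And>k. k < n \<Longrightarrow> \<pi> k < n" for \<pi> u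
  proof -
    have "\<exists>E. (E \<longlongrightarrow> x1) (at_right 0) \<and>
      (\<forall>l<n. ((\<lambda>s. g (\<pi> l) (E s,t) / s) \<longlongrightarrow> (\<Sum>k<n. u k * q (\<pi> k) (\<pi> l) (x1,t))) (at_right 0)) \<and>
      ((\<lambda>s. (w (E s,t) - w (x1,t)) / s\<^sup>2) \<longlongrightarrow>
      (\<Sum>k<n. (u k)\<^sup>2 * q (\<pi> k) (\<pi> k) (x1,t) / 2 + u k * (\<Sum>j<k. u j * q (\<pi> j) (\<pi> k) (x1,t)))) (at_right 0)"
      by (rule zigzag_expansion[of n "\<lambda>k. Y (\<pi> k)" U x1 w t "\<lambda>k. g (\<pi> k)" "\<lambda>k l. q (\<pi> k) (\<pi> l)"])
         (use \<pi> in \<open>auto intro!: Y U w g q g0\<close>)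
    then obtain E where E: "(E \<longlongrightarrow> x1) (at_right 0)"
      and lim: "((\<lambda>s. (w (E s,t) - w (x1,t)) / s\<^sup>2) \<longlongrightarrow>
      (\<Sum>k<n. (u k)\<^sup>2 * q (\<pi> k) (\<pi> k) (x1,t) / 2 + u k * (\<Sum>j<k. u j * q (\<pi> j) (\<pi> k) (x1,t)))) (at_right 0)"
      by blast
    have "\<forall>\<^sub>F s in at_right 0. E s \<in> U" using E U by (rule topological_tendstoD)
    then have "\<forall>\<^sub>F s in at_right 0. (w (E s,t) - w (x1,t)) / s\<^sup>2 \<le> 0"
      by eventually_elim (use max in \<open>auto intro: divide_nonpos_nonneg\<close>)
    then show ?thesis using lim by (intro tendsto_upperbound[OF lim]) auto
  qed
  let ?F = "\<lambda>j k. v j * v k * q j k (x1,t)"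
  have 1: "(\<Sum>k<n. ?F k k / 2 + (\<Sum>j<k. ?F j k)) \<le> 0"
    using half[of "\<lambda>k. k" v] by (simp add: sum_distrib_left power2_eq_square mult_ac)
  define \<pi> where "\<pi> k = n - 1 - k" for k
  have "(\<Sum>k<n. ?F (\<pi> k) (\<pi> k) / 2 + (\<Sum>j<k. ?F (\<pi> j) (\<pi> k))) \<le> 0"
    using half[of \<pi> "\<lambda>k. v (\<pi> k)"] by (simp add: \<pi>_def sum_distrib_left power2_eq_square mult_ac)
  also have "(\<Sum>k<n. ?F (\<pi> k) (\<pi> k) / 2 + (\<Sum>j<k. ?F (\<pi> j) (\<pi> k)))
      = (\<Sum>k<n. ?F k k / 2 + (\<Sum>j\<in>{k<..<n}. ?F j k))"
  proof (rule sum.reindex_bij_witness[of _ \<pi> \<pi>])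
    fix k assume k: "k \<in> {..<n}"
    have "(\<Sum>j<k. ?F (\<pi> j) (\<pi> k)) = (\<Sum>j\<in>{\<pi> k<..<n}. ?F j (\<pi> k))"
      by (rule sum.reindex_bij_witness[of _ \<pi> \<pi>]) (use k in \<open>auto simp: \<pi>_def\<close>)
    then show "?F (\<pi> k) (\<pi> k) / 2 + (\<Sum>j\<in>{\<pi> k<..<n}. ?F j (\<pi> k)) = ?F (\<pi> k) (\<pi> k) / 2 + (\<Sum>j<k. ?F (\<pi> j) (\<pi> k))"
      by simp
  qed (auto simp: \<pi>_def)
  finally have 2: "(\<Sum>k<n. ?F k k / 2 + (\<Sum>j\<in>{k<..<n}. ?F j k)) \<le> 0" .
  have "(\<Sum>j<n. ?F j k) = (\<Sum>j<k. ?F j k) + ?F k k + (\<Sum>j\<in>{k<..<n}. ?F j k)" if "k < n" for k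
  proof -
    have "{..<n} = insert k ({..<k} \<union> {k<..<n})" using that by auto
    moreover have "(\<Sum>j\<in>insert k ({..<k} \<union> {k<..<n}). ?F j k) = ?F k k + (\<Sum>j\<in>{..<k} \<union> {k<..<n}. ?F j k)"
      by (rule sum.insert) auto
    moreover have "(\<Sum>j\<in>{..<k} \<union> {k<..<n}. ?F j k) = (\<Sum>j<k. ?F j k) + (\<Sum>j\<in>{k<..<n}. ?F j k)"
      by (rule sum.union_disjoint) auto
    ultimately show ?thesis by simp
  qed
  \<comment> \<open>Both sums contain half of each diagonal term, so the two triangles add up to the
    full square.\<close>
  then have "(\<Sum>k<n. \<Sum>j<n. ?F j k) = (\<Sum>k<n. ?F k k / 2 + (\<Sum>j<k. ?F j k)) + (\<Sum>k<n. ?F k k / 2 + (\<Sum>j\<in>{k<..<n}. ?F j k))"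
    unfolding sum.distrib[symmetric] by (intro sum.cong refl) simp
  then have "(\<Sum>k<n. \<Sum>j<n. ?F j k) \<le> 0" using 1 2 by linarith
  then show "(\<Sum>k<n. \<Sum>j<n. v k * v j * q j k (x1,t)) \<le> 0" by (simp add: mult_ac)
qed

text \<open>With \<open>A\<close> written as a sum of squares, the trace of the product becomes a
  sum of values of the quadratic form of \<open>B\<close>. This covers nonsymmetric
  \<open>B\<close>, such as the matrix of iterated Lie derivatives.\<close>

lemma trace_product_nonpos:
  fixes A B :: "nat \<Rightarrow> nat \<Rightarrow> real"
  assumes "\<And>i j. i < m \<Longrightarrow> j < m \<Longrightarrow> A i j = A j i"
    and "\<And>v. (\<exists>i<m. v i \<noteq> 0) \<Longrightarrow> 0 < (\<Sum>i<m. \<Sum>j<m. A i j * v i * v j)"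
    and B: "\<And>v. (\<Sum>k<m. \<Sum>j<m. v k * v j * B j k) \<le> 0"
  shows "(\<Sum>i<m. \<Sum>j<m. A i j * B i j) \<le> 0"
proof -
  obtain V where V: "\<And>i j. i < m \<Longrightarrow> j < m \<Longrightarrow> A i j = (\<Sum>k<m. V k i * V k j)"
    using positive_definite_sum_squares[of m A] assms(1,2) by blast
  have "(\<Sum>i<m. \<Sum>j<m. A i j * B i j) = (\<Sum>i<m. \<Sum>j<m. \<Sum>k<m. V k j * V k i * B i j)"
    by (intro sum.cong refl) (simp add: V sum_distrib_right sum_distrib_left mult_ac)
  also have "\<dots> = (\<Sum>i<m. \<Sum>k<m. \<Sum>j<m. V k j * V k i * B i j)"
    by (intro sum.cong refl sum.swap)
  also have "\<dots> = (\<Sum>k<m. \<Sum>i<m. \<Sum>j<m. V k j * V k i * B i j)"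
    by (rule sum.swap)
  also have "\<dots> = (\<Sum>k<m. \<Sum>j<m. \<Sum>i<m. V k j * V k i * B i j)"
    by (intro sum.cong refl sum.swap)
  also have "\<dots> \<le> 0" by (intro sum_nonpos B)
  finally show ?thesis .
qed

section \<open>Barriers\<close>

text \<open>The setting is a nondivergence equation whose derivatives \<open>g\<close>,
  \<open>q\<close>, \<open>p\<close> are given as functions, so that it can be instantiated with
  \<open>u\<close> and with \<open>- u\<close>; the drift \<beta> absorbs the derivatives of the
  matrix \<open>a\<close>. The assumption \<open>c_M\<close> stands for the sign condition on the
  extremum: it holds for \<open>M \<ge> 0\<close> and also for vanishing \<open>c\<close>.\<close>

locale max_propagation =
  fixes X :: "nat \<Rightarrow> ('n::finite) vfield" and m :: nat
    and a q :: "nat \<Rightarrow> nat \<Rightarrow> (real^'n) \<times> real \<Rightarrow> real"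
    and \<beta> g :: "nat \<Rightarrow> (real^'n) \<times> real \<Rightarrow> real"
    and c u f p :: "(real^'n) \<times> real \<Rightarrow> real"
    and \<Omega> :: "((real^'n) \<times> real) set" and M C lam :: real
  assumes X: "\<And>i. i < m \<Longrightarrow> smooth_vfield (X i)"
    and span: "\<And>x. {Y x | Y. Y \<in> lie_algebra X m} = UNIV"
    and \<Omega>: "open \<Omega>"
    and lam: "lam \<ge> 1"
    and a_sym: "\<And>i j z. i < m \<Longrightarrow> j < m \<Longrightarrow> a i j z = a j i z"
    and ellip: "\<And>z v. (1 / lam) * (\<Sum>i<m. (v i)\<^sup>2) \<le> (\<Sum>i<m. \<Sum>j<m. a i j z * v i * v j)"
    and C: "C \<ge> 0"
    and a_bd: "\<And>i j z. i < m \<Longrightarrow> j < m \<Longrightarrow> \<bar>a i j z\<bar> \<le> C"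
    and \<beta>_bd: "\<And>i z. i < m \<Longrightarrow> \<bar>\<beta> i z\<bar> \<le> C"
    and c_bd: "\<And>z. \<bar>c z\<bar> \<le> C"
    and c_nonpos: "\<And>z. z \<in> \<Omega> \<Longrightarrow> c z \<le> 0"
    and u_cont: "continuous_on \<Omega> u"
    and Xu: "\<And>i z. i < m \<Longrightarrow> z \<in> \<Omega> \<Longrightarrow> has_lie_deriv (X i) u z (g i z)"
    and XXu: "\<And>i j z. i < m \<Longrightarrow> j < m \<Longrightarrow> z \<in> \<Omega> \<Longrightarrow> has_lie_deriv (X i) (g j) z (q i j z)"
    and q_cont: "\<And>i j. i < m \<Longrightarrow> j < m \<Longrightarrow> continuous_on \<Omega> (q i j)"
    and u_t: "\<And>z. z \<in> \<Omega> \<Longrightarrow> ((\<lambda>s. u (fst z, s)) has_real_derivative p z) (at (snd z))"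
    and eq: "\<And>z. z \<in> \<Omega> \<Longrightarrow> (\<Sum>i<m. \<Sum>j<m. a i j z * q i j z) + (\<Sum>i<m. \<beta> i z * g i z) + c z * u z - p z = f z"
    and f_nonneg: "\<And>z. z \<in> \<Omega> \<Longrightarrow> f z \<ge> 0"
    and u_le: "\<And>z. z \<in> \<Omega> \<Longrightarrow> u z \<le> M"
    and c_M: "\<And>z y. z \<in> \<Omega> \<Longrightarrow> y \<ge> M \<Longrightarrow> c z * y \<le> 0"
begin

lemma spatial_max:
  assumes U: "open U" "z1 \<in> U"
    and w: "\<And>z k. z \<in> U \<Longrightarrow> k < m \<Longrightarrow> has_lie_deriv (X k) w z (gw k z)"
    and gw: "\<And>z k l. z \<in> U \<Longrightarrow> k < m \<Longrightarrow> l < m \<Longrightarrow> has_lie_deriv (X k) (gw l) z (qw k l z)"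
    and qw: "\<And>k l. k < m \<Longrightarrow> l < m \<Longrightarrow> continuous_on U (qw k l)"
    and max: "\<And>z. z \<in> U \<Longrightarrow> w z \<le> w z1"
  shows "\<And>l. l < m \<Longrightarrow> gw l z1 = 0"
    and "(\<Sum>i<m. \<Sum>j<m. a i j z1 * qw i j z1) \<le> 0"
proof -
  obtain x1 t where z1: "z1 = (x1, t)" by force
  define V where "V = (\<lambda>x. (x, t)) -` U"
  have V: "open V" "x1 \<in> V"
    unfolding V_def using U z1 by (auto intro!: open_vimage continuous_intros)
  have cont: "isCont (\<lambda>x. qw k l (x, t)) x1" if "k < m" "l < m" for k l
  proof -
    have "continuous_on V (\<lambda>x. qw k l (x, t))"
      by (rule continuous_on_compose2[OF qw[OF that]]) (auto simp: V_def intro!: continuous_intros)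
    then show ?thesis using V continuous_on_eq_continuous_at by blast
  qed
  note max2 = second_order_max[where n=m and Y=X and U=V and ?x1.0=x1 and w=w and t=t and g=gw and q=qw]
  show "gw l z1 = 0" if "l < m" for l
    unfolding z1 by (rule max2) (use that V w gw max cont X z1 in \<open>auto simp: V_def\<close>)
  have quad: "(\<Sum>k<m. \<Sum>j<m. v k * v j * qw j k (x1,t)) \<le> 0" for v
    by (rule max2) (use V w gw max cont X z1 in \<open>auto simp: V_def\<close>)
  show "(\<Sum>i<m. \<Sum>j<m. a i j z1 * qw i j z1) \<le> 0"
  proof (rule trace_product_nonpos)
    fix v :: "nat \<Rightarrow> real" assume "\<exists>i<m. v i \<noteq> 0"
    then have "0 < (\<Sum>i<m. (v i)\<^sup>2)"
      by (metis finite_lessThan lessThan_iff sum_pos2 zero_le_power2 zero_less_power2)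
    then have "0 < (1 / lam) * (\<Sum>i<m. (v i)\<^sup>2)" using lam by simp
    also note ellip
    finally show "0 < (\<Sum>i<m. \<Sum>j<m. a i j z1 * v i * v j)" .
  qed (use a_sym quad z1 in auto)
qed

lemma time_deriv_max:
  assumes "z \<in> \<Omega>" "u z = M"
  shows "p z = 0"
proof -
  obtain x t where z: "z = (x, t)" by force
  have "open ((\<lambda>s. (x, s)) -` \<Omega>)" by (intro open_vimage \<Omega> continuous_intros)
  then obtain d where d: "d > 0" "\<And>s. \<bar>t - s\<bar> < d \<Longrightarrow> (x, s) \<in> \<Omega>"
    using assms(1) unfolding z open_dist by (force simp: dist_real_def abs_minus_commute)
  have "((\<lambda>s. u (x, s)) has_real_derivative p z) (at t)" using u_t[OF assms(1)] z by simp
  then show ?thesis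
    by (rule DERIV_local_max[OF _ d(1)]) (use d(2) u_le assms z in auto)
qed

text \<open>At a contact point the first-order terms and the time derivative vanish, the
  second-order part and \<open>c z * M\<close> are nonpositive, and \<open>f z\<close> is
  nonnegative. The equation then forces all of them to be 0.\<close>

lemma f_at_max:
  assumes "z \<in> \<Omega>" "u z = M"
  shows "f z = M * c z"
proof -
  have "\<And>l. l < m \<Longrightarrow> g l z = 0" "(\<Sum>i<m. \<Sum>j<m. a i j z * q i j z) \<le> 0"
    using spatial_max[OF \<Omega> assms(1), of u g q] Xu XXu q_cont u_le assms(2) by auto
  with eq[OF assms(1)] assms time_deriv_max[OF assms] f_nonneg[OF assms(1)] c_M[OF assms(1), of M]
  show ?thesis by (simp add: mult.commute)
qed

text \<open>Adding a small multiple of a strict subsolution makes the equation strict. At an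
  interior maximum the first derivatives vanish and the second-order part is nonpositive; the bound
  \<open>ge\<close> is there to give the zero-order term the same sign through
  \<open>c_M\<close>.\<close>

lemma no_interior_max:
  assumes U: "open U" "U \<subseteq> \<Omega>" "z1 \<in> U"
    and h: "\<And>z k. z \<in> U \<Longrightarrow> k < m \<Longrightarrow> has_lie_deriv (X k) h z (gh k z)"
    and gh: "\<And>z k l. z \<in> U \<Longrightarrow> k < m \<Longrightarrow> l < m \<Longrightarrow> has_lie_deriv (X k) (gh l) z (qh k l z)"
    and qh: "\<And>k l. k < m \<Longrightarrow> l < m \<Longrightarrow> continuous_on U (qh k l)"
    and h_t: "((\<lambda>s. h (fst z1, s)) has_real_derivative ph) (at (snd z1))"
    and \<epsilon>: "\<epsilon> > 0"
    and max: "\<And>z. z \<in> U \<Longrightarrow> u z + \<epsilon> * h z \<le> u z1 + \<epsilon> * h z1"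
    and ge: "M \<le> u z1 + \<epsilon> * h z1"
    and Lh: "(\<Sum>i<m. \<Sum>j<m. a i j z1 * qh i j z1) + (\<Sum>i<m. \<beta> i z1 * gh i z1) + c z1 * h z1 - ph > 0"
  shows False
proof -
  obtain x1 t where z1: "z1 = (x1, t)" by force
  let ?w = "\<lambda>z. u z + \<epsilon> * h z"
  have z1\<Omega>: "z1 \<in> \<Omega>" using U by blast
  note sm = spatial_max[OF U(1,3), of ?w "\<lambda>k z. g k z + \<epsilon> * gh k z" "\<lambda>k l z. q k l z + \<epsilon> * qh k l z"]
  have g1: "g l z1 + \<epsilon> * gh l z1 = 0" if "l < m" for l
    by (rule sm) (use that U max in \<open>auto intro!: has_lie_deriv_add_scaled X Xu XXu h gh continuous_intros qh continuous_on_subset[OF q_cont]\<close>)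
  have q1: "(\<Sum>i<m. \<Sum>j<m. a i j z1 * (q i j z1 + \<epsilon> * qh i j z1)) \<le> 0"
    by (rule sm) (use U max in \<open>auto intro!: has_lie_deriv_add_scaled X Xu XXu h gh continuous_intros qh continuous_on_subset[OF q_cont]\<close>)
  have "open ((\<lambda>s. (x1, s)) -` U)" by (intro open_vimage U continuous_intros)
  then obtain d where d: "d > 0" "\<And>s. \<bar>t - s\<bar> < d \<Longrightarrow> (x1, s) \<in> U"
    using U(3) unfolding z1 open_dist by (force simp: dist_real_def abs_minus_commute)
  have "((\<lambda>s. u (x1, s) + \<epsilon> * h (x1, s)) has_real_derivative p z1 + \<epsilon> * ph) (at t)"
    using u_t[OF z1\<Omega>] h_t z1 by (intro DERIV_add DERIV_cmult) auto
  then have p1: "p z1 + \<epsilon> * ph = 0"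
    by (rule DERIV_local_max[OF _ d(1)]) (use d(2) max z1 in auto)
  have "0 < f z1 + \<epsilon> * ((\<Sum>i<m. \<Sum>j<m. a i j z1 * qh i j z1) + (\<Sum>i<m. \<beta> i z1 * gh i z1) + c z1 * h z1 - ph)"
    using f_nonneg[OF z1\<Omega>] \<epsilon> Lh by (intro add_nonneg_pos mult_pos_pos)
  also have "\<dots> = (\<Sum>i<m. \<Sum>j<m. a i j z1 * (q i j z1 + \<epsilon> * qh i j z1)) + (\<Sum>i<m. \<beta> i z1 * (g i z1 + \<epsilon> * gh i z1))
      + c z1 * (u z1 + \<epsilon> * h z1) - (p z1 + \<epsilon> * ph)"
    unfolding eq[OF z1\<Omega>, symmetric]
    by (simp add: algebra_simps sum.distrib sum_distrib_left)
  also have "(\<Sum>i<m. \<beta> i z1 * (g i z1 + \<epsilon> * gh i z1)) = 0"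
    by (intro sum.neutral ballI) (simp only: g1 lessThan_iff mult_zero_right)
  finally show False using q1 p1 c_M[OF z1\<Omega> ge] by linarith
qed

text \<open>\<open>sqdist1\<close> and \<open>sqdist2\<close> are the first and second Lie
  derivatives of the squared distance to \<open>x0\<close>, from which both barriers are
  built.\<close>

definition sqdist1 :: "real^'n \<Rightarrow> nat \<Rightarrow> (real^'n) \<times> real \<Rightarrow> real" where
  "sqdist1 x0 i z = 2 * ((fst z - x0) \<bullet> X i (fst z))"

definition sqdist2 :: "real^'n \<Rightarrow> nat \<Rightarrow> nat \<Rightarrow> (real^'n) \<times> real \<Rightarrow> real" where
  "sqdist2 x0 i j z = 2 * (X i (fst z) \<bullet> X j (fst z))
     + 2 * ((fst z - x0) \<bullet> frechet_derivative (X j) (at (fst z)) (X i (fst z)))"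

lemma sqdist1_derivative:
  assumes "i < m" "j < m"
  shows "((\<lambda>x. sqdist1 x0 j (x, t)) has_derivative
     (\<lambda>v. 2 * (v \<bullet> X j x) + 2 * ((x - x0) \<bullet> frechet_derivative (X j) (at x) v))) (at x)"
  unfolding sqdist1_def using smooth_vfield_has_derivative[OF X[OF assms(2)], of x]
  by (auto intro!: derivative_eq_intros simp: algebra_simps)

lemma sqdist_continuous:
  assumes "i < m" "j < m"
  shows "continuous_on S (sqdist1 x0 i)" "continuous_on S (sqdist2 x0 i j)"
proof -
  note comp = continuous_on_compose2[OF _ continuous_on_fst[OF continuous_on_id], of UNIV _ S]
  have Xc: "continuous_on S (\<lambda>z. X k (fst z))" if "k < m" for k
    by (rule comp) (auto intro: smooth_vfield_continuous X that)
  have "continuous_on S (\<lambda>z. frechet_derivative (X j) (at (fst z)) (X i (fst z)))"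
    by (rule comp[of "\<lambda>x. frechet_derivative (X j) (at x) (X i x)"])
       (auto intro: smooth_vfield_continuous smooth_vfield_derivative_along X assms)
  with Xc assms show "continuous_on S (sqdist1 x0 i)" "continuous_on S (sqdist2 x0 i j)"
    unfolding sqdist1_def sqdist2_def by (auto intro!: continuous_intros)
qed

text \<open>The coefficients are replaced by their bounds, which leaves a continuous majorant on a
  compact set. The spare term \<open>b\<close> makes room for the time derivative of a
  barrier.\<close>

lemma sqdist_bound:
  assumes "compact K" "continuous_on K b"
  shows "\<exists>B\<ge>0. \<forall>z\<in>K. (\<Sum>i<m. \<Sum>j<m. a i j z * sqdist2 x0 i j z) + (\<Sum>i<m. \<beta> i z * sqdist1 x0 i z) + b z \<le> B"
proof -
  define S where "S z = (\<Sum>i<m. \<Sum>j<m. C * \<bar>sqdist2 x0 i j z\<bar>) + (\<Sum>i<m. C * \<bar>sqdist1 x0 i z\<bar>) + \<bar>b z\<bar>" for z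
  have "continuous_on K S"
    unfolding S_def using assms(2) by (auto intro!: continuous_intros sqdist_continuous)
  then have "compact (S ` K)" using assms(1) by (rule compact_continuous_image)
  then obtain B where B: "\<And>z. z \<in> K \<Longrightarrow> \<bar>S z\<bar> \<le> B"
    using compact_imp_bounded[of "S ` K"] by (fastforce simp: bounded_iff)
  have "(\<Sum>i<m. \<Sum>j<m. a i j z * sqdist2 x0 i j z) + (\<Sum>i<m. \<beta> i z * sqdist1 x0 i z) + b z \<le> \<bar>B\<bar>" if "z \<in> K" for z
  proof -
    have le: "x * y \<le> C * \<bar>y\<bar>" if "\<bar>x\<bar> \<le> C" for x y :: real
      using mult_right_mono[OF that abs_ge_zero[of y]] abs_ge_self[of "x * y"] by (simp add: abs_mult)
    have "(\<Sum>i<m. \<Sum>j<m. a i j z * sqdist2 x0 i j z) + (\<Sum>i<m. \<beta> i z * sqdist1 x0 i z) + b z \<le> S z"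
      unfolding S_def by (intro add_mono sum_mono le a_bd \<beta>_bd) auto
    then show ?thesis using B[OF that] by linarith
  qed
  then show ?thesis by (intro exI[of _ "\<bar>B\<bar>"]) auto
qed

text \<open>Bony's normal: the length of \<nu> is the radius of a ball that touches the contact set
  at \<open>z\<close> from outside. The vector 0 qualifies at every contact point, which is harmless
  for statements of orthogonality.\<close>

definition exterior_normal :: "(real^'n) \<times> real \<Rightarrow> (real^'n) \<times> real \<Rightarrow> bool" where
  "exterior_normal z \<nu> \<longleftrightarrow> z \<in> \<Omega> \<and> u z = M \<and> (\<forall>w \<in> ball (z + \<nu>) (norm \<nu>) \<inter> \<Omega>. u w \<noteq> M)"

text \<open>Hopf's lemma for the degenerate operator. If one field has a component along the normal,
  ellipticity bounds the second-order part of an exponential barrier from below near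
  \<open>z0\<close>, and the barrier becomes a strict subsolution. A small multiple of it added to
  \<open>u\<close> then creates the interior maximum excluded by
  \<open>no_interior_max\<close>.\<close>

lemma fields_orthogonal_normal:
  assumes \<nu>: "exterior_normal z0 \<nu>" and i0: "i0 < m"
  shows "X i0 (fst z0) \<bullet> fst \<nu> = 0"
proof (rule ccontr)
  assume ne: "X i0 (fst z0) \<bullet> fst \<nu> \<noteq> 0"
  have z0: "z0 \<in> \<Omega>" "u z0 = M" using \<nu> by (auto simp: exterior_normal_def)
  \<comment> \<open>A ball of half the radius touching at the same point: its closure meets the
    contact set in \<open>z0\<close> only.\<close>
  define zc where "zc = z0 + (1/2) *\<^sub>R \<nu>"
  define xc tc where "xc = fst zc" and "tc = snd zc"
  define R2 where "R2 = (norm \<nu>)\<^sup>2 / 4"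
  define \<rho> where "\<rho> z = (fst z - xc) \<bullet> (fst z - xc) + (snd z - tc)\<^sup>2" for z
  have \<rho>_norm: "\<rho> z = (norm (z - zc))\<^sup>2" for z
    by (simp add: \<rho>_def xc_def tc_def norm_prod_def dot_square_norm)
  have \<rho>z0: "\<rho> z0 = R2"
    by (simp add: \<rho>_norm zc_def R2_def power_mult_distrib power_divide)
  have touch: "u z < M" if z: "z \<in> \<Omega>" "\<rho> z \<le> R2" "z \<noteq> z0" for z
  proof -
    define d where "d = z - z0"
    have "(norm (d - (1/2) *\<^sub>R \<nu>))\<^sup>2 \<le> (norm \<nu>)\<^sup>2 / 4"
      using z(2) by (simp add: \<rho>_norm zc_def R2_def d_def algebra_simps)
    then have "d \<bullet> d \<le> d \<bullet> \<nu>"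
      by (simp add: power2_norm_eq_inner inner_diff_left inner_diff_right inner_commute)
    moreover have "d \<bullet> d > 0" using z(3) by (simp add: d_def)
    moreover have "(norm (d - \<nu>))\<^sup>2 = d \<bullet> d - 2 * (d \<bullet> \<nu>) + (norm \<nu>)\<^sup>2"
      by (simp add: power2_norm_eq_inner inner_diff_left inner_diff_right inner_commute)
    ultimately have "(norm (d - \<nu>))\<^sup>2 < (norm \<nu>)\<^sup>2" by linarith
    then have "norm (d - \<nu>) < norm \<nu>" by (rule power2_less_imp_less) simp
    then have "z \<in> ball (z0 + \<nu>) (norm \<nu>)"
      by (simp add: d_def dist_norm algebra_simps norm_minus_commute)
    then have "u z \<noteq> M" using \<nu> z(1) unfolding exterior_normal_def by blast
    then show ?thesis using u_le[OF z(1)] by simp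
  qed
  define r where "r = sqdist1 xc"
  define s where "s = sqdist2 xc"
  define G where "G z = (\<Sum>i<m. (r i z)\<^sup>2)" for z
  have "r i0 z0 = - (X i0 (fst z0) \<bullet> fst \<nu>)"
    by (simp add: r_def sqdist1_def xc_def zc_def inner_commute)
  then have G0: "G z0 > 0"
    unfolding G_def by (intro sum_pos2[of _ i0]) (use ne i0 in auto)
  have Gc: "continuous_on S G" for S
    unfolding G_def r_def by (intro continuous_intros sqdist_continuous) auto
  obtain d1 where d1: "d1 > 0" "\<And>z. dist z z0 < d1 \<Longrightarrow> dist (G z) (G z0) < G z0 / 2"
    using Gc[of UNIV] G0 unfolding continuous_on_iff by (metis UNIV_I half_gt_zero)
  obtain d2 where d2: "d2 > 0" "cball z0 d2 \<subseteq> \<Omega>" using \<Omega> z0(1) open_contains_cball by blast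
  define \<delta> where "\<delta> = min (d1/2) d2"
  have \<delta>: "\<delta> > 0" "cball z0 \<delta> \<subseteq> \<Omega>" using d1 d2 by (auto simp: \<delta>_def)
  define r0 where "r0 = G z0 / 2"
  have r0: "r0 > 0" using G0 by (simp add: r0_def)
  have Gr0: "G z \<ge> r0" if "z \<in> cball z0 \<delta>" for z
  proof -
    have "dist z z0 < d1" using that d1 by (auto simp: \<delta>_def dist_commute)
    from d1(2)[OF this] show ?thesis by (simp add: dist_real_def r0_def abs_if field_simps split: if_splits)
  qed
  have "continuous_on (cball z0 \<delta>) (\<lambda>z. - 2 * (snd z - tc))" by (intro continuous_intros)
  from sqdist_bound[OF compact_cball this, of xc]
  obtain B where B: "B \<ge> 0" "\<And>z. z \<in> cball z0 \<delta> \<Longrightarrow>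
      (\<Sum>i<m. \<Sum>j<m. a i j z * s i j z) + (\<Sum>i<m. \<beta> i z * r i z) + (- 2 * (snd z - tc)) \<le> B"
    unfolding r_def s_def by blast
  \<comment> \<open>With this \<open>k\<close> the leading term \<open>k^2 * r0 / lam\<close>
    dominates the lower-order part \<open>k * B\<close> together with the zero-order bound
    \<open>C\<close>.\<close>
  define k where "k = lam * (B + C + 1) / r0 + 1"
  have k1: "k \<ge> 1" using B C lam r0 by (simp add: k_def)
  have "k * (r0 / lam) \<ge> B + C + 1"
    using r0 lam by (simp add: k_def field_simps)
  then have "k * (k * (r0 / lam)) \<ge> k * (B + C + 1)" using k1 by (intro mult_left_mono) auto
  moreover have "k * (C + 1) \<ge> C + 1" using mult_right_mono[OF k1, of "C + 1"] C by simp
  ultimately have kk: "k\<^sup>2 * r0 / lam - k * B - C > 0" by (simp add: power2_eq_square algebra_simps)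
  define e where "e z = exp (- k * \<rho> z)" for z
  define h where "h z = e z - exp (- k * R2)" for z
  define gh where "gh i z = - k * e z * r i z" for i z
  define qh where "qh i j z = e z * (k\<^sup>2 * r i z * r j z - k * s i j z)" for i j z
  have e_deriv: "((\<lambda>x. e (x, t)) has_derivative (\<lambda>v. e (x, t) * (- k * (2 * ((x - xc) \<bullet> v))))) (at x)" for x t
    unfolding e_def \<rho>_def by (auto intro!: derivative_eq_intros simp: inner_commute algebra_simps)
  have hX: "has_lie_deriv (X i) h z (gh i z)" if "i < m" for i z
  proof -
    have "((\<lambda>x. h (x, snd z)) has_derivative (\<lambda>v. e (fst z, snd z) * (- k * (2 * ((fst z - xc) \<bullet> v))))) (at (fst z))"
      unfolding h_def by (rule has_derivative_eq_rhs[OF has_derivative_diff[OF e_deriv has_derivative_const]]) simp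
    from has_lie_deriv_frechet[OF X[OF that] this] show ?thesis
      by (simp add: gh_def r_def sqdist1_def mult_ac)
  qed
  have ghX: "has_lie_deriv (X i) (gh j) z (qh i j z)" if ij: "i < m" "j < m" for i j z
  proof -
    have "((\<lambda>x. gh j (x, snd z)) has_derivative
      (\<lambda>v. - k * (e (fst z, snd z) * (- k * (2 * ((fst z - xc) \<bullet> v))) * r j z
        + e z * (2 * (v \<bullet> X j (fst z)) + 2 * ((fst z - xc) \<bullet> frechet_derivative (X j) (at (fst z)) v))))) (at (fst z))"
      unfolding gh_def r_def mult.assoc
      by (rule has_derivative_eq_rhs[OF has_derivative_mult_right[OF has_derivative_mult[OF e_deriv sqdist1_derivative[OF ij]]]])
         (auto simp: algebra_simps)
    from has_lie_deriv_frechet[OF X[OF ij(1)] this] show ?thesis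
      by (simp add: qh_def r_def s_def sqdist1_def sqdist2_def algebra_simps power2_eq_square)
  qed
  have ec: "continuous_on S e" for S unfolding e_def \<rho>_def by (intro continuous_intros)
  have qhc: "continuous_on S (qh i j)" if "i < m" "j < m" for i j S
    unfolding qh_def r_def s_def
    by (intro continuous_intros ec sqdist_continuous(1)[OF that(1) that(1)]
        sqdist_continuous(1)[OF that(2) that(2)] sqdist_continuous(2)[OF that])
  have h_t: "((\<lambda>t. h (fst z, t)) has_real_derivative e z * (- k * (2 * (snd z - tc)))) (at (snd z))" for z
    unfolding h_def e_def \<rho>_def by (auto intro!: derivative_eq_intros simp: algebra_simps)
  have Lh: "(\<Sum>i<m. \<Sum>j<m. a i j z * qh i j z) + (\<Sum>i<m. \<beta> i z * gh i z) + c z * h z - e z * (- k * (2 * (snd z - tc))) > 0"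
    if z: "z \<in> cball z0 \<delta>" for z
  proof -
    have z\<Omega>: "z \<in> \<Omega>" using z \<delta> by auto
    have "r0 / lam \<le> 1 / lam * G z" using Gr0[OF z] lam by (simp add: divide_right_mono)
    also have "\<dots> \<le> (\<Sum>i<m. \<Sum>j<m. a i j z * r i z * r j z)" unfolding G_def by (rule ellip)
    finally have "k\<^sup>2 * (r0 / lam) \<le> k\<^sup>2 * (\<Sum>i<m. \<Sum>j<m. a i j z * r i z * r j z)"
      by (intro mult_left_mono) auto
    moreover have "k * ((\<Sum>i<m. \<Sum>j<m. a i j z * s i j z) + (\<Sum>i<m. \<beta> i z * r i z) + (- 2 * (snd z - tc))) \<le> k * B"
      using B(2)[OF z] k1 by (intro mult_left_mono) auto
    ultimately have "0 < k\<^sup>2 * (\<Sum>i<m. \<Sum>j<m. a i j z * r i z * r j z)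
      - k * ((\<Sum>i<m. \<Sum>j<m. a i j z * s i j z) + (\<Sum>i<m. \<beta> i z * r i z) + (- 2 * (snd z - tc))) - C"
      using kk by simp
    then have "0 < e z * (k\<^sup>2 * (\<Sum>i<m. \<Sum>j<m. a i j z * r i z * r j z)
      - k * ((\<Sum>i<m. \<Sum>j<m. a i j z * s i j z) + (\<Sum>i<m. \<beta> i z * r i z) + (- 2 * (snd z - tc))) - C)"
      by (simp add: e_def)
    also have "\<dots> = (\<Sum>i<m. \<Sum>j<m. a i j z * qh i j z) + (\<Sum>i<m. \<beta> i z * gh i z) - e z * C - e z * (- k * (2 * (snd z - tc)))"
      unfolding qh_def gh_def by (simp add: algebra_simps sum.distrib sum_distrib_left sum_subtractf sum_negf)
    also have "\<dots> \<le> (\<Sum>i<m. \<Sum>j<m. a i j z * qh i j z) + (\<Sum>i<m. \<beta> i z * gh i z) + c z * h z - e z * (- k * (2 * (snd z - tc)))"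
    proof -
      have "c z * h z = c z * e z - c z * exp (- k * R2)" by (simp add: h_def algebra_simps)
      moreover have "c z * exp (- k * R2) \<le> 0" using c_nonpos[OF z\<Omega>] by (simp add: mult_nonpos_nonneg)
      moreover have "c z * e z \<ge> - C * e z" using c_bd[of z] by (intro mult_right_mono) (auto simp: e_def)
      ultimately show ?thesis by (simp add: algebra_simps)
    qed
    finally show ?thesis .
  qed
  have hc: "continuous_on S h" for S unfolding h_def by (intro continuous_intros ec)
  have h_le1: "h z \<le> 1" for z
  proof -
    have "e z \<le> 1" unfolding e_def using k1 by (simp add: \<rho>_norm)
    then show ?thesis unfolding h_def using exp_ge_zero[of "- k * R2"] by linarith
  qed
  \<comment> \<open>On the sphere there are two cases. Outside the touching ball \<open>h\<close> is
    negative; inside it, compactness keeps \<open>u\<close> a fixed amount below \<open>M\<close>,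
    because \<open>z0\<close> is not on the sphere, and \<open>h \<le> 1\<close> makes this amount a
    valid factor.\<close>
  define S1 where "S1 = sphere z0 \<delta> \<inter> {z. \<rho> z \<le> R2}"
  have S1\<Omega>: "S1 \<subseteq> \<Omega>" using \<delta> unfolding S1_def by auto
  have "closed {z. \<rho> z \<le> R2}" unfolding \<rho>_def by (intro closed_Collect_le continuous_intros)
  then have "compact S1" unfolding S1_def by (intro compact_Int_closed) auto
  have "\<exists>\<epsilon>>0. \<forall>z\<in>S1. u z + \<epsilon> < M"
  proof (cases "S1 = {}")
    case False
    obtain z' where z': "z' \<in> S1" "\<And>z. z \<in> S1 \<Longrightarrow> u z \<le> u z'"
      using continuous_attains_sup[OF \<open>compact S1\<close> False continuous_on_subset[OF u_cont S1\<Omega>]] by blast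
    have "u z' < M" using z'(1) S1\<Omega> \<delta>(1) by (intro touch) (auto simp: S1_def)
    then show ?thesis using z'(2) by (intro exI[of _ "(M - u z') / 2"]) (force simp: field_simps)
  qed (auto intro: exI[of _ 1])
  then obtain \<epsilon> where \<epsilon>: "\<epsilon> > 0" "\<And>z. z \<in> S1 \<Longrightarrow> u z + \<epsilon> < M" by blast
  have sphere: "u z + \<epsilon> * h z < M" if z: "z \<in> sphere z0 \<delta>" for z
  proof (cases "\<rho> z \<le> R2")
    case True
    then have "u z + \<epsilon> < M" using \<epsilon>(2) z by (auto simp: S1_def)
    moreover have "\<epsilon> * h z \<le> \<epsilon> * 1" using \<epsilon>(1) h_le1 by (intro mult_left_mono) auto
    ultimately show ?thesis by simp
  next
    case False
    then have "h z < 0" unfolding h_def e_def using k1 by simp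
    then have "\<epsilon> * h z < 0" using \<epsilon>(1) by (simp add: mult_pos_neg)
    moreover have "z \<in> \<Omega>" using z \<delta>(2) by auto
    ultimately show ?thesis using u_le[of z] by linarith
  qed
  have "continuous_on (cball z0 \<delta>) (\<lambda>z. u z + \<epsilon> * h z)"
    by (intro continuous_intros hc continuous_on_subset[OF u_cont \<delta>(2)])
  then obtain z1 where z1: "z1 \<in> cball z0 \<delta>" "\<And>z. z \<in> cball z0 \<delta> \<Longrightarrow> u z + \<epsilon> * h z \<le> u z1 + \<epsilon> * h z1"
    using continuous_attains_sup[of "cball z0 \<delta>"] \<delta>(1) by fastforce
  have "h z0 = 0" by (simp add: h_def e_def \<rho>z0)
  then have ge: "M \<le> u z1 + \<epsilon> * h z1" using z1(2)[of z0] z0(2) \<delta>(1) by simp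
  then have "z1 \<notin> sphere z0 \<delta>" using sphere[of z1] by linarith
  then have z1b: "z1 \<in> ball z0 \<delta>" using z1(1) by auto
  have "ball z0 \<delta> \<subseteq> \<Omega>" using \<delta>(2) by auto
  then show False
    by (rule no_interior_max[OF open_ball _ z1b hX ghX qhc h_t \<epsilon>(1) _ ge Lh[OF z1(1)]])
       (use z1(2) in auto)
qed

text \<open>If \<open>u < M\<close> just before \<open>t2\<close>, a paraboloid barrier with vertex
  \<open>(x0, t2)\<close> keeps \<open>u (x0, t)\<close> below \<open>M\<close> by at least
  \<open>\<epsilon> * K * (t2 - t)\<close>. A left slope of this size contradicts the vanishing time
  derivative at the contact point.\<close>

lemma time_step:
  assumes z2: "(x0, t2) \<in> \<Omega>" "u (x0, t2) = M" and rd: "r > 0" "d > 0"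
    and sub: "cball x0 r \<times> {t2 - d..t2} \<subseteq> \<Omega>"
    and less: "\<And>x t. x \<in> cball x0 r \<Longrightarrow> t \<in> {t2 - d..<t2} \<Longrightarrow> u (x, t) < M"
  shows False
proof -
  define r' where "r' = min r 1"
  have r': "r' > 0" "r' \<le> 1" "cball x0 r' \<subseteq> cball x0 r" using rd by (auto simp: r'_def)
  obtain B where B: "B \<ge> 0" "\<And>z. z \<in> cball x0 r \<times> {t2 - d..t2} \<Longrightarrow>
      (\<Sum>i<m. \<Sum>j<m. a i j z * sqdist2 x0 i j z) + (\<Sum>i<m. \<beta> i z * sqdist1 x0 i z) + 0 \<le> B"
    using sqdist_bound[of "cball x0 r \<times> {t2 - d..t2}" "\<lambda>z. 0" x0] by (auto simp: compact_Times)
  \<comment> \<open>The downward speed \<open>K\<close> outweighs the spatial terms, bounded by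
    \<open>B\<close>, and the zero-order term, bounded by \<open>C\<close> because
    \<open>h \<le> 1\<close>.\<close>
  define K where "K = B + C + 1"
  have K: "K > 0" using B C by (simp add: K_def)
  \<comment> \<open>The height is chosen so that the base of the paraboloid fits into the ball of
    radius \<open>r'\<close>; with \<open>r' \<le> 1\<close> this also gives
    \<open>h \<le> 1\<close>.\<close>
  define d' where "d' = min d (r'\<^sup>2 / K)"
  have d': "d' > 0" "d' \<le> d" using rd r' K by (auto simp: d'_def)
  have Kd': "K * d' \<le> r'\<^sup>2" using K by (simp add: d'_def min_def field_simps)
  have r'1: "r'\<^sup>2 \<le> 1" using r' by (simp add: power_le_one)
  define t1 where "t1 = t2 - d'"
  define h where "h z = K * (t2 - snd z) - (fst z - x0) \<bullet> (fst z - x0)" for z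
  have hc: "continuous_on S h" for S unfolding h_def by (intro continuous_intros)
  have hX: "has_lie_deriv (X i) h z (- sqdist1 x0 i z)" if "i < m" for i z
  proof -
    have "((\<lambda>x. h (x, snd z)) has_derivative (\<lambda>v. - (2 * ((fst z - x0) \<bullet> v)))) (at (fst z))"
      unfolding h_def by (auto intro!: derivative_eq_intros simp: inner_commute algebra_simps)
    from has_lie_deriv_frechet[OF X[OF that] this] show ?thesis by (simp add: sqdist1_def)
  qed
  have ghX: "has_lie_deriv (X i) (\<lambda>z. - sqdist1 x0 j z) z (- sqdist2 x0 i j z)" if ij: "i < m" "j < m" for i j z
    using has_lie_deriv_frechet[OF X[OF ij(1)] has_derivative_minus[OF sqdist1_derivative[OF ij]], of _ z]
    by (simp add: sqdist2_def)
  have h_t: "((\<lambda>t. h (fst z, t)) has_real_derivative - K) (at (snd z))" for z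
    unfolding h_def by (auto intro!: derivative_eq_intros)
  have h_le: "h z \<le> r'\<^sup>2" if "snd z \<ge> t1" for z
  proof -
    have "K * (t2 - snd z) \<le> K * d'" using that K by (simp add: t1_def)
    then show ?thesis using Kd' inner_ge_zero[of "fst z - x0"] unfolding h_def by linarith
  qed
  have bsub: "cball x0 r' \<times> {t1} \<subseteq> \<Omega>" using sub r' d' by (auto simp: t1_def)
  obtain zb where zb: "zb \<in> cball x0 r' \<times> {t1}" "\<And>z. z \<in> cball x0 r' \<times> {t1} \<Longrightarrow> u z \<le> u zb"
    using continuous_attains_sup[OF _ _ continuous_on_subset[OF u_cont bsub]] r'(1)
    by (auto simp: compact_Times)
  have "u zb < M" using zb(1) less[of "fst zb" "snd zb"] r' d' by (auto simp: t1_def)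
  \<comment> \<open>Half the gap between \<open>M\<close> and \<open>u\<close> on the base slice,
    where compactness provides a maximum below \<open>M\<close>.\<close>
  define \<epsilon> where "\<epsilon> = (M - u zb) / 2"
  have \<epsilon>: "\<epsilon> > 0" using \<open>u zb < M\<close> by (simp add: \<epsilon>_def)
  define D where "D = (cball x0 r' \<times> {t1..t2}) \<inter> {z. h z \<ge> 0}"
  have D\<Omega>: "D \<subseteq> \<Omega>" using sub r' d' by (auto simp: D_def t1_def)
  have "compact D" unfolding D_def
    by (intro compact_Int_closed compact_Times closed_Collect_le hc continuous_on_const) auto
  moreover have "(x0, t2) \<in> D" using r' d' by (auto simp: D_def h_def t1_def)
  moreover have "continuous_on D (\<lambda>z. u z + \<epsilon> * h z)"
    by (intro continuous_intros hc continuous_on_subset[OF u_cont D\<Omega>])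
  ultimately obtain z1 where z1: "z1 \<in> D" "\<And>z. z \<in> D \<Longrightarrow> u z + \<epsilon> * h z \<le> u z1 + \<epsilon> * h z1"
    using continuous_attains_sup[of D] by blast
  \<comment> \<open>A value above \<open>M\<close> would be attained in the interior:
    \<open>h\<close> vanishes on the lateral boundary and is nonpositive at time \<open>t2\<close>,
    and \<epsilon> takes care of the base.\<close>
  have le: "u z1 + \<epsilon> * h z1 \<le> M"
  proof (rule ccontr)
    assume "\<not> ?thesis"
    then have gt: "u z1 + \<epsilon> * h z1 > M" by simp
    have z1\<Omega>: "z1 \<in> \<Omega>" using z1 D\<Omega> by blast
    have h1: "h z1 > 0" using gt u_le[OF z1\<Omega>] \<epsilon> by (smt (verit) zero_less_mult_pos)
    have "snd z1 \<noteq> t2" using h1 inner_ge_zero[of "fst z1 - x0"] unfolding h_def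
      by (metis diff_self less_diff_eq mult_zero_right add_0 linorder_not_le)
    moreover have "snd z1 \<noteq> t1"
    proof
      assume "snd z1 = t1"
      then have "u z1 \<le> u zb" using z1(1) by (intro zb(2)) (auto simp: D_def mem_Times_iff)
      moreover have "\<epsilon> * h z1 \<le> \<epsilon> * 1"
        using h_le[of z1] r'1 \<epsilon> \<open>snd z1 = t1\<close> by (intro mult_left_mono) auto
      moreover have "u zb + \<epsilon> < M" using \<open>u zb < M\<close> by (simp add: \<epsilon>_def field_simps)
      ultimately show False using gt by linarith
    qed
    ultimately have t: "t1 < snd z1" "snd z1 < t2" using z1(1) by (auto simp: D_def)
    have "(norm (fst z1 - x0))\<^sup>2 < r'\<^sup>2"
    proof -
      have "K * (t2 - snd z1) \<le> K * d'" using t K by (simp add: t1_def)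
      then show ?thesis using h1 Kd' by (simp add: h_def dot_square_norm)
    qed
    then have x: "dist x0 (fst z1) < r'"
      using power2_less_imp_less[of "norm (fst z1 - x0)" r'] r' by (simp add: dist_norm norm_minus_commute)
    define U where "U = (ball x0 r' \<times> {t1<..<t2}) \<inter> {z. h z > 0}"
    have U: "open U" unfolding U_def
      by (intro open_Int open_Times open_Collect_less hc continuous_on_const) auto
    have UD: "U \<subseteq> D" by (auto simp: U_def D_def)
    have z1U: "z1 \<in> U" using t x h1 by (auto simp: U_def mem_Times_iff)
    have "(\<Sum>i<m. \<Sum>j<m. a i j z1 * - sqdist2 x0 i j z1) + (\<Sum>i<m. \<beta> i z1 * - sqdist1 x0 i z1) + c z1 * h z1 - (- K) > 0"
    proof -
      have "z1 \<in> cball x0 r \<times> {t2 - d..t2}" using z1(1) r' d' by (auto simp: D_def t1_def mem_Times_iff)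
      from B(2)[OF this] have "(\<Sum>i<m. \<Sum>j<m. a i j z1 * sqdist2 x0 i j z1) + (\<Sum>i<m. \<beta> i z1 * sqdist1 x0 i z1) \<le> B" by simp
      moreover have "c z1 * h z1 \<ge> - C * 1"
      proof -
        have "h z1 \<le> 1" using h_le[of z1] t r'1 by linarith
        then have "- (c z1 * h z1) \<le> C * 1"
          using c_bd[of z1] h1 C mult_mono[of "- c z1" C "h z1" 1] by simp
        then show ?thesis by simp
      qed
      ultimately show ?thesis by (simp add: sum_negf K_def)
    qed
    from no_interior_max[OF U _ z1U hX ghX _ h_t \<epsilon> _ _ this] UD D\<Omega> z1(2) gt
    show False by (auto intro!: continuous_intros sqdist_continuous)
  qed
  have bd: "u (x0, t) + \<epsilon> * K * (t2 - t) \<le> M" if "t1 \<le> t" "t \<le> t2" for t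
  proof -
    have "(x0, t) \<in> D" using that r' K by (auto simp: D_def h_def)
    from z1(2)[OF this] le show ?thesis by (simp add: h_def mult.assoc)
  qed
  have "((\<lambda>s. u (x0, s)) has_real_derivative 0) (at t2)"
    using u_t[OF z2(1)] time_deriv_max[OF z2] by simp
  then have "((\<lambda>t. u (x0, t) + \<epsilon> * K * (t2 - t)) has_real_derivative - (\<epsilon> * K)) (at t2)"
    by (auto intro!: derivative_eq_intros)
  from DERIV_neg_dec_left[OF this] \<epsilon> K obtain \<delta> where \<delta>: "\<delta> > 0"
    "\<And>h. 0 < h \<Longrightarrow> h < \<delta> \<Longrightarrow> u (x0, t2) + \<epsilon> * K * (t2 - t2) < u (x0, t2 - h) + \<epsilon> * K * (t2 - (t2 - h))"
    by auto
  define h' where "h' = min (\<delta> / 2) d'"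
  have "0 < h'" "h' < \<delta>" "t1 \<le> t2 - h'" using \<delta>(1) d' by (auto simp: h'_def t1_def)
  from \<delta>(2)[OF this(1,2)] bd[OF this(3)] \<open>0 < h'\<close> z2(2) show False by simp
qed

end

section \<open>Propagation in space\<close>

text \<open>Continuous induction: the supremum of the times up to \<open>t\<close> with property
  \<open>P\<close> inherits \<open>P\<close> by closedness, and \<open>ext\<close> would push it
  further.\<close>

lemma interval_continuation:
  fixes a b :: real
  assumes "P a" and closed: "closed {s \<in> {a..b}. P s}"
    and ext: "\<And>s. a \<le> s \<Longrightarrow> s < b \<Longrightarrow> P s \<Longrightarrow> \<exists>d>0. \<forall>s'. s < s' \<and> s' < s + d \<and> s' \<le> b \<longrightarrow> P s'"
    and t: "t \<in> {a..b}"
  shows "P t"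
proof (rule ccontr)
  assume nt: "\<not> P t"
  define T where "T = {s \<in> {a..b}. P s} \<inter> {..t}"
  have T: "closed T" "a \<in> T" "bdd_above T"
    using closed t \<open>P a\<close> by (auto simp: T_def)
  then have S: "Sup T \<in> T" using closed_contains_Sup[of T] by blast
  then have "Sup T < t" using nt by (auto simp: T_def order.strict_iff_order)
  then obtain d where d: "d > 0" "\<And>s'. Sup T < s' \<Longrightarrow> s' < Sup T + d \<Longrightarrow> s' \<le> b \<Longrightarrow> P s'"
    using ext[of "Sup T"] S t by (auto simp: T_def)
  define s' where "s' = min t (Sup T + d / 2)"
  have s': "Sup T < s'" "s' < Sup T + d" "s' \<le> t" using d \<open>Sup T < t\<close> by (auto simp: s'_def)
  then have "s' \<in> T" using d(2)[of s'] S t by (auto simp: T_def)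
  then show False using cSup_upper[OF _ T(3)] s' by force
qed

context max_propagation
begin

text \<open>The distance to the contact set is compared with \<open>(\<eta> + \<epsilon>) exp ((L + 1) \<tau>)\<close>: where the two agree,
  the vector to a nearest point is an exterior normal, to which \<open>Z\<close> does not contribute.\<close>
lemma curve_near_contact_set:
  assumes z0: "u z0 = M" and R: "R > 0" "cball z0 R \<subseteq> \<Omega>" and L: "L \<ge> 0" and \<eta>: "\<eta> \<ge> 0"
    and tang: "\<And>\<tau> z \<nu>. \<tau> \<in> {0..1} \<Longrightarrow> exterior_normal z \<nu> \<Longrightarrow> Z \<tau> z \<bullet> \<nu> = 0"
    and lip: "\<And>\<tau> z w. \<tau> \<in> {0..1} \<Longrightarrow> z \<in> cball z0 R \<Longrightarrow> w \<in> cball z0 R \<Longrightarrow> norm (Z \<tau> z - Z \<tau> w) \<le> L * norm (z - w)"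
    and p': "\<And>\<tau>. \<tau> \<in> {0..1} \<Longrightarrow> (\<gamma> has_vector_derivative \<gamma>' \<tau>) (at \<tau>)"
    and near: "\<And>\<tau>. \<tau> \<in> {0..1} \<Longrightarrow> \<gamma> \<tau> \<in> cball z0 (R/4)" and start: "\<gamma> 0 = z0"
    and err: "\<And>\<tau>. \<tau> \<in> {0..1} \<Longrightarrow> norm (\<gamma>' \<tau> - Z \<tau> (\<gamma> \<tau>)) \<le> \<eta>"
  shows "\<exists>y\<in>\<Omega>. u y = M \<and> norm (\<gamma> 1 - y) \<le> \<eta> * exp (L + 1)"
proof -
  \<comment> \<open>In \<Omega> the contact set is only relatively closed; cut down to a closed ball
    it is closed, so nearest points exist.\<close>
  define F where "F = {z \<in> cball z0 R. u z = M}"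
  have F\<Omega>: "F \<subseteq> \<Omega>" using R by (auto simp: F_def)
  have "closed F" unfolding F_def
    using continuous_closed_preimage_constant[OF continuous_on_subset[OF u_cont R(2)] closed_cball] by simp
  have z0F: "z0 \<in> F" using z0 R by (auto simp: F_def)
  define D where "D \<tau> = infdist (\<gamma> \<tau>) F" for \<tau>
  have c: "isCont \<gamma> \<tau>" if "\<tau> \<in> {0..1}" for \<tau>
    using p'[OF that] by (rule has_vector_derivative_continuous)
  have Dc: "isCont D \<tau>" if "\<tau> \<in> {0..1}" for \<tau>
    unfolding D_def using c[OF that] by (intro continuous_intros)
  \<comment> \<open>The extra \<epsilon> keeps the comparison function positive even if
    \<open>\<eta> = 0\<close>, so that \<nu> is nonzero and the norm is differentiable
    there.\<close>
  have le: "D 1 \<le> (\<eta> + \<epsilon>) * exp (L + 1)" if \<epsilon>: "\<epsilon> > 0" for \<epsilon>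
  proof -
    define \<phi> where "\<phi> \<tau> = (\<eta> + \<epsilon>) * exp ((L + 1) * \<tau>)" for \<tau>
    have \<phi>d: "(\<phi> has_real_derivative (L + 1) * \<phi> \<tau>) (at \<tau>)" for \<tau>
      unfolding \<phi>_def by (auto intro!: derivative_eq_intros)
    have \<phi>c: "isCont \<phi> \<tau>" for \<tau> using \<phi>d DERIV_isCont by blast
    have \<phi>_ge: "\<phi> \<tau> \<ge> \<eta> + \<epsilon>" if "\<tau> \<ge> 0" for \<tau>
      using that L \<eta> \<epsilon> by (simp add: \<phi>_def)
    have "D 1 \<le> \<phi> 1"
    proof (rule interval_continuation[where P="\<lambda>\<tau>. D \<tau> \<le> \<phi> \<tau>" and a=0 and b=1])
      show "D 0 \<le> \<phi> 0" using z0F \<phi>_ge[of 0] \<eta> \<epsilon> by (simp add: D_def start)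
      have "closed {\<tau> \<in> {0..1}. D \<tau> - \<phi> \<tau> \<le> 0}"
        by (rule continuous_on_closed_Collect_le)
           (auto intro!: continuous_at_imp_continuous_on continuous_intros Dc \<phi>c)
      then show "closed {\<tau> \<in> {0..1}. D \<tau> \<le> \<phi> \<tau>}" by simp
      fix s :: real assume s: "0 \<le> s" "s < 1" "D s \<le> \<phi> s"
      have s01: "s \<in> {0..1}" using s by auto
      show "\<exists>d>0. \<forall>s'. s < s' \<and> s' < s + d \<and> s' \<le> 1 \<longrightarrow> D s' \<le> \<phi> s'"
      proof (cases "D s < \<phi> s")
        case True
        have "isCont (\<lambda>\<tau>. \<phi> \<tau> - D \<tau>) s" by (intro continuous_intros Dc \<phi>c s01)
        then have "\<forall>\<^sub>F \<tau> in at s. \<phi> \<tau> - D \<tau> > 0"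
          using order_tendstoD(1)[of "\<lambda>\<tau>. \<phi> \<tau> - D \<tau>" "\<phi> s - D s" "at s" 0] True by (simp add: isCont_def)
        then obtain d where "d > 0" "\<And>\<tau>. \<tau> \<noteq> s \<Longrightarrow> dist \<tau> s < d \<Longrightarrow> \<phi> \<tau> - D \<tau> > 0"
          unfolding eventually_at by auto
        then show ?thesis by (intro exI[of _ d]) (force simp: dist_real_def)
      next
        case False
        then have Ds: "D s = \<phi> s" using s by simp
        obtain y where y: "y \<in> F" "D s = dist (\<gamma> s) y"
          using infdist_attains_inf[OF \<open>closed F\<close>, of "\<gamma> s"] z0F unfolding D_def by blast
        define \<nu> where "\<nu> = \<gamma> s - y"
        have \<nu>: "norm \<nu> = \<phi> s" using y Ds by (simp add: \<nu>_def dist_norm)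
        have \<phi>pos: "\<phi> s \<ge> \<eta> + \<epsilon>" using \<phi>_ge s by simp
        have "D s \<le> dist (\<gamma> s) z0" unfolding D_def by (rule infdist_le[OF z0F])
        then have DsR: "D s \<le> R / 4" "dist (\<gamma> s) z0 \<le> R / 4" using near[OF s01] by (auto simp: dist_commute)
        \<comment> \<open>A contact point closer to \<open>\<gamma> s\<close> than \<open>y\<close>
          would lie within \<open>R / 2\<close> of \<open>z0\<close>, hence in \<open>F\<close>. So
          cutting down to the ball has created no spurious normals.\<close>
        have "exterior_normal y \<nu>"
          unfolding exterior_normal_def
        proof (intro conjI ballI)
          show "y \<in> \<Omega>" "u y = M" using y F\<Omega> by (auto simp: F_def)
          fix w assume w: "w \<in> ball (y + \<nu>) (norm \<nu>) \<inter> \<Omega>"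
          then have dw: "dist (\<gamma> s) w < D s" using \<nu> Ds by (simp add: \<nu>_def)
          show "u w \<noteq> M"
          proof
            assume "u w = M"
            have "dist z0 w \<le> dist (\<gamma> s) z0 + dist (\<gamma> s) w"
              by (rule dist_triangle3)
            then have "w \<in> F" using \<open>u w = M\<close> dw DsR R by (simp add: F_def)
            then show False using infdist_le[of w F "\<gamma> s"] dw by (simp add: D_def)
          qed
        qed
        from tang[OF s01 this] have Zy: "Z s y \<bullet> \<nu> = 0" .
        have nu0: "\<nu> \<noteq> 0" using \<nu> \<phi>pos \<eta> \<epsilon> by auto
        have "((\<lambda>\<tau>. \<gamma> \<tau> - y) has_derivative (\<lambda>h. h *\<^sub>R \<gamma>' s)) (at s)"
          using p'[OF s01] by (auto simp: has_vector_derivative_def intro!: derivative_eq_intros)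
        from has_derivative_compose[OF this, of norm "\<lambda>h. h \<bullet> sgn \<nu>"] has_derivative_norm[of \<nu>] nu0
        have "((\<lambda>\<tau>. norm (\<gamma> \<tau> - y)) has_derivative (\<lambda>h. h * (\<gamma>' s \<bullet> sgn \<nu>))) (at s)"
          by (simp add: \<nu>_def inner_commute)
        then have G: "((\<lambda>\<tau>. norm (\<gamma> \<tau> - y)) has_real_derivative (\<gamma>' s \<bullet> sgn \<nu>)) (at s)"
          unfolding has_field_derivative_def by (rule has_derivative_eq_rhs) (auto simp: fun_eq_iff)
        have "\<gamma>' s \<bullet> \<nu> = (\<gamma>' s - Z s (\<gamma> s)) \<bullet> \<nu> + (Z s (\<gamma> s) - Z s y) \<bullet> \<nu>"
          by (simp add: inner_diff_left Zy)
        also have "\<dots> \<le> norm (\<gamma>' s - Z s (\<gamma> s)) * norm \<nu> + norm (Z s (\<gamma> s) - Z s y) * norm \<nu>"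
          by (intro add_mono norm_cauchy_schwarz)
        also have "\<dots> \<le> \<eta> * norm \<nu> + (L * norm \<nu>) * norm \<nu>"
        proof (intro add_mono mult_right_mono)
          have "\<gamma> s \<in> cball z0 R" "y \<in> cball z0 R" using near[OF s01] R y(1) by (auto simp: F_def)
          then show "norm (Z s (\<gamma> s) - Z s y) \<le> L * norm \<nu>" unfolding \<nu>_def by (intro lip s01)
        qed (use err[OF s01] in auto)
        finally have "\<gamma>' s \<bullet> sgn \<nu> \<le> \<eta> + L * \<phi> s"
          using nu0 by (simp add: sgn_div_norm \<nu>[symmetric] divide_simps algebra_simps)
        \<comment> \<open>The rate \<open>L + 1\<close> leaves room: the distance grows at most at
          rate \<open>\<eta> + L * \<phi> s\<close>, and \<open>\<phi> s\<close> exceeds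
          \<eta>.\<close>
        then have neg: "\<gamma>' s \<bullet> sgn \<nu> - (L + 1) * \<phi> s < 0" using \<phi>pos \<epsilon> by (simp add: algebra_simps)
        have "((\<lambda>\<tau>. norm (\<gamma> \<tau> - y) - \<phi> \<tau>) has_real_derivative (\<gamma>' s \<bullet> sgn \<nu> - (L + 1) * \<phi> s)) (at s)"
          by (intro DERIV_diff G \<phi>d)
        from DERIV_neg_dec_right[OF this neg] obtain d where d: "d > 0"
          "\<And>h. 0 < h \<Longrightarrow> h < d \<Longrightarrow> norm (\<gamma> (s + h) - y) - \<phi> (s + h) < norm (\<gamma> s - y) - \<phi> s" by blast
        have "D s' \<le> \<phi> s'" if "s < s'" "s' < s + d" for s'
        proof -
          have "norm (\<gamma> s' - y) < \<phi> s'" using d(2)[of "s' - s"] that \<nu> by (simp add: \<nu>_def)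
          moreover have "D s' \<le> dist (\<gamma> s') y" unfolding D_def by (rule infdist_le[OF y(1)])
          ultimately show ?thesis by (simp add: dist_norm)
        qed
        then show ?thesis using d(1) by blast
      qed
    qed auto
    then show ?thesis by (simp add: \<phi>_def)
  qed
  have "D 1 \<le> \<eta> * exp (L + 1)"
  proof (rule field_le_epsilon)
    fix e :: real assume "e > 0"
    then show "D 1 \<le> \<eta> * exp (L + 1) + e"
      using le[of "e / exp (L + 1)"] by (simp add: distrib_right)
  qed
  moreover obtain y where "y \<in> F" "D 1 = dist (\<gamma> 1) y"
    using infdist_attains_inf[OF \<open>closed F\<close>, of "\<gamma> 1"] z0F unfolding D_def by blast
  ultimately show ?thesis using F\<Omega> by (auto simp: F_def dist_norm)
qed

section \<open>Brackets of tangential fields\<close>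

definition tangential :: "('n) vfield \<Rightarrow> bool" where
  "tangential Y \<longleftrightarrow> (\<forall>z \<nu>. exterior_normal z \<nu> \<longrightarrow> Y (fst z) \<bullet> fst \<nu> = 0)"

text \<open>The curve \<open>P\<close> below is the second-order expansion of the controlled flow of
  \<open>\<delta> (A' Y1 + B' Y2)\<close> from \<open>x0\<close>. The primitives \<open>A\<close>, \<open>B\<close> vanish at both ends and \<open>A' B\<close>, \<open>B' A\<close> have
  integrals \<open>-1/60\<close>, \<open>1/60\<close>, so \<open>P 1 = x0 + (\<delta>\<^sup>2/60) [Y1, Y2]\<close> exactly, while \<open>P\<close> fails to solve the
  controlled equation only by \<open>o(\<delta>\<^sup>2)\<close>.\<close>
lemma bracket_nonpos_on_normals:
  assumes Y1: "smooth_vfield Y1" "tangential Y1" and Y2: "smooth_vfield Y2" "tangential Y2"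
    and \<nu>: "exterior_normal z0 \<nu>"
  shows "lie_bracket Y1 Y2 (fst z0) \<bullet> fst \<nu> \<le> 0"
proof (rule ccontr)
  assume pos: "\<not> ?thesis"
  define W where "W = lie_bracket Y1 Y2 (fst z0)"
  define \<omega> where "\<omega> = W \<bullet> fst \<nu>"
  have \<omega>: "\<omega> > 0" using pos by (simp add: \<omega>_def W_def)
  then have nu: "norm \<nu> > 0" by (auto simp: \<omega>_def)
  have z0: "z0 \<in> \<Omega>" "u z0 = M" using \<nu> by (auto simp: exterior_normal_def)
  obtain R where R: "R > 0" "cball z0 R \<subseteq> \<Omega>" using \<Omega> z0(1) open_contains_cball by blast
  define x0 t0 where "x0 = fst z0" and "t0 = snd z0"
  define y1 y2 D1 D2 where "y1 = Y1 x0" and "y2 = Y2 x0" and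
    "D1 = frechet_derivative Y1 (at x0)" and "D2 = frechet_derivative Y2 (at x0)"
  have D: "(Y1 has_derivative D1) (at x0)" "(Y2 has_derivative D2) (at x0)"
    unfolding D1_def D2_def using Y1 Y2 smooth_vfield_has_derivative by auto
  have lin: "bounded_linear D1" "bounded_linear D2" using D has_derivative_bounded_linear by auto
  define A B where "A \<tau> = \<tau> - \<tau>^2" and "B \<tau> = \<tau>^2 - \<tau>^3" for \<tau> :: real
  define A' B' where "A' \<tau> = 1 - 2 * \<tau>" and "B' \<tau> = 2 * \<tau> - 3 * \<tau>^2" for \<tau> :: real
  \<comment> \<open>\<open>C1\<close> and \<open>C2\<close> are the primitives of
    \<open>A' * B\<close> and \<open>B' * A\<close> that vanish at 0.\<close>
  define C1 where "C1 \<tau> = \<tau>^3/3 - 3 * \<tau>^4 / 4 + 2 * \<tau>^5 / 5" for \<tau> :: real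
  define C2 where "C2 \<tau> = 2 * \<tau>^3/3 - 5 * \<tau>^4 / 4 + 3 * \<tau>^5 / 5" for \<tau> :: real
  define S where "S \<tau> = ((A \<tau>)^2/2) *\<^sub>R D1 y1 + ((B \<tau>)^2/2) *\<^sub>R D2 y2 + C1 \<tau> *\<^sub>R D1 y2 + C2 \<tau> *\<^sub>R D2 y1" for \<tau>
  define S' where "S' \<tau> = (A' \<tau> * A \<tau>) *\<^sub>R D1 y1 + (B' \<tau> * B \<tau>) *\<^sub>R D2 y2 + (A' \<tau> * B \<tau>) *\<^sub>R D1 y2 + (B' \<tau> * A \<tau>) *\<^sub>R D2 y1" for \<tau>
  have der: "(A has_real_derivative A' \<tau>) (at \<tau>)" "(B has_real_derivative B' \<tau>) (at \<tau>)"
      "(C1 has_real_derivative A' \<tau> * B \<tau>) (at \<tau>)" "(C2 has_real_derivative B' \<tau> * A \<tau>) (at \<tau>)"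
      "((\<lambda>\<tau>. (A \<tau>)^2/2) has_real_derivative A' \<tau> * A \<tau>) (at \<tau>)"
      "((\<lambda>\<tau>. (B \<tau>)^2/2) has_real_derivative B' \<tau> * B \<tau>) (at \<tau>)" for \<tau>
    unfolding A_def B_def A'_def B'_def C1_def C2_def
    by (auto intro!: derivative_eq_intros simp: field_simps power2_eq_square power3_eq_cube power4_eq_xxxx numeral_eq_Suc)
  have S_der: "(S has_vector_derivative S' \<tau>) (at \<tau>)" for \<tau>
    unfolding S_def S'_def
    by (intro has_vector_derivative_add)
       (auto intro!: has_vector_derivative_scaleR[THEN has_vector_derivative_eq_rhs] der)
  have S1: "S 1 = (1/60) *\<^sub>R W"
    by (simp add: S_def A_def B_def C1_def C2_def W_def lie_bracket_def x0_def[symmetric] y1_def y2_def D1_def D2_def scaleR_diff_right)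
  have "continuous_on {0..1} S"
    by (meson S_der continuous_at_imp_continuous_on has_vector_derivative_continuous)
  then have "compact (S ` {0..1})" by (rule compact_continuous_image) simp
  then obtain KS where KS: "\<And>\<tau>. \<tau> \<in> {0..1} \<Longrightarrow> norm (S \<tau>) \<le> KS"
    using compact_imp_bounded[of "S ` {0..1}"] by (fastforce simp: bounded_iff)
  have "KS \<ge> 0" using KS[of 0] norm_ge_zero[of "S 0"] by (simp del: norm_ge_zero)
  obtain K1 where K1: "K1 \<ge> 0" "\<And>x. norm (D1 x) \<le> norm x * K1"
    using lin(1) by (metis bounded_linear.nonneg_bounded)
  obtain K2 where K2: "K2 \<ge> 0" "\<And>x. norm (D2 x) \<le> norm x * K2"
    using lin(2) by (metis bounded_linear.nonneg_bounded)
  define Kh where "Kh = norm y1 + norm y2 + KS"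
  have Kh: "Kh \<ge> 0" using \<open>KS \<ge> 0\<close> by (simp add: Kh_def)
  obtain L1 where L1: "L1 > 0" "\<And>x y. x \<in> cball x0 R \<Longrightarrow> y \<in> cball x0 R \<Longrightarrow> norm (Y1 x - Y1 y) \<le> L1 * norm (x - y)"
    using smooth_vfield_lipschitz[OF Y1(1)] by meson
  obtain L2 where L2: "L2 > 0" "\<And>x y. x \<in> cball x0 R \<Longrightarrow> y \<in> cball x0 R \<Longrightarrow> norm (Y2 x - Y2 y) \<le> L2 * norm (x - y)"
    using smooth_vfield_lipschitz[OF Y2(1)] by meson
  define L where "L = L1 + L2"
  define E where "E = exp (L + 1)"
  have E: "E > 0" by (simp add: E_def)
  \<comment> \<open>The loop moves the endpoint by \<open>\<delta>^2 / 60\<close> times the bracket;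
    half of the resulting approach to the centre \<open>z0 + \<nu>\<close> amounts to
    \<open>\<delta>^2 * \<omega>'\<close>.\<close>
  define \<omega>' where "\<omega>' = \<omega> / (120 * norm \<nu>)"
  have \<omega>': "\<omega>' > 0" using \<omega> nu by (simp add: \<omega>'_def)
  \<comment> \<open>Tolerance for the linearisation of both fields at \<open>x0\<close>: its share
    of the error, amplified by \<open>E\<close>, is to use up at most a quarter of
    \<omega>'.\<close>
  define \<kappa> where "\<kappa> = \<omega>' / (8 * E * (Kh + 1))"
  have \<kappa>: "\<kappa> > 0" using \<omega>' E Kh by (simp add: \<kappa>_def)
  have \<kappa>E: "E * (2 * \<kappa> * Kh) \<le> \<omega>' / 4"
  proof -
    have "E * (2 * (\<omega>' / (8 * E * c)) * Kh) = (\<omega>' / 4) * (Kh / c)" if "c \<noteq> 0" for c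
      using E that by (simp add: field_simps)
    then have "E * (2 * \<kappa> * Kh) = (\<omega>' / 4) * (Kh / (Kh + 1))"
      using Kh unfolding \<kappa>_def by fastforce
    also have "\<dots> \<le> (\<omega>' / 4) * 1" using \<omega>' Kh by (intro mult_left_mono) auto
    finally show ?thesis by simp
  qed
  define K where "K = KS * K1 + KS * K2"
  have K: "K \<ge> 0" using \<open>KS \<ge> 0\<close> K1 K2 by (simp add: K_def)
  obtain d1 where d1: "d1 > 0" "\<And>y. norm (y - x0) < d1 \<Longrightarrow> norm (Y1 y - Y1 x0 - D1 (y - x0)) \<le> \<kappa> * norm (y - x0)"
    using D(1) \<kappa> unfolding has_derivative_at_alt by blast
  obtain d2 where d2: "d2 > 0" "\<And>y. norm (y - x0) < d2 \<Longrightarrow> norm (Y2 y - Y2 x0 - D2 (y - x0)) \<le> \<kappa> * norm (y - x0)"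
    using D(2) \<kappa> unfolding has_derivative_at_alt by blast
  have small: "\<forall>\<^sub>F \<delta> in at_right 0. b * \<delta> < e" if "e > 0" for b e :: real
  proof -
    have "((\<lambda>\<delta>. b * \<delta>) \<longlongrightarrow> b * 0) (at_right 0)" by (intro tendsto_intros)
    then show ?thesis using that by (auto dest: order_tendstoD)
  qed
  \<comment> \<open>The conditions with \<open>Kh\<close> keep the loop where the linearisations
    hold, those with \<open>W\<close> and \<omega> serve the estimate of the distance to the centre,
    and the last one absorbs the cubic error.\<close>
  have "\<forall>\<^sub>F \<delta>::real in at_right 0. \<delta> > 0 \<and> 1 * \<delta> < 1 \<and> Kh * \<delta> < R / 4 \<and> Kh * \<delta> < d1 \<and> Kh * \<delta> < d2
      \<and> (norm W)\<^sup>2 * \<delta> < \<omega> \<and> \<omega> * \<delta> < 2 * (norm \<nu>)\<^sup>2 \<and> (E * K) * \<delta> < \<omega>' / 4"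
    by (intro eventually_conj small eventually_at_right_less) (use R d1 d2 \<omega> nu \<omega>' in auto)
  then obtain \<delta> :: real where \<delta>: "\<delta> > 0" "\<delta> < 1" "Kh * \<delta> < R / 4" "Kh * \<delta> < d1" "Kh * \<delta> < d2"
      "(norm W)\<^sup>2 * \<delta> < \<omega>" "\<omega> * \<delta> < 2 * (norm \<nu>)\<^sup>2" "(E * K) * \<delta> < \<omega>' / 4"
    using eventually_happens[of _ "at_right (0::real)"] by auto
  define P where "P \<tau> = x0 + \<delta> *\<^sub>R (A \<tau> *\<^sub>R y1 + B \<tau> *\<^sub>R y2) + \<delta>^2 *\<^sub>R S \<tau>" for \<tau>
  define P' where "P' \<tau> = \<delta> *\<^sub>R (A' \<tau> *\<^sub>R y1 + B' \<tau> *\<^sub>R y2) + \<delta>^2 *\<^sub>R S' \<tau>" for \<tau>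
  define Z where "Z \<tau> z = (\<delta> *\<^sub>R (A' \<tau> *\<^sub>R Y1 (fst z) + B' \<tau> *\<^sub>R Y2 (fst z)), 0::real)" for \<tau> and z :: "(real^'n) \<times> real"
  define \<eta> where "\<eta> = \<delta>^2 * (2 * \<kappa> * Kh + \<delta> * K)"
  have bds: "\<bar>A \<tau>\<bar> \<le> 1" "\<bar>B \<tau>\<bar> \<le> 1" "\<bar>A' \<tau>\<bar> \<le> 1" "\<bar>B' \<tau>\<bar> \<le> 1" if \<tau>: "\<tau> \<in> {0..1}" for \<tau>
  proof -
    have p: "0 \<le> \<tau>^2" "\<tau>^2 \<le> \<tau>" "0 \<le> \<tau>^3" "\<tau>^3 \<le> \<tau>^2"
      using \<tau> by (auto simp: power2_eq_square power3_eq_cube mult_left_le mult_left_le_one_le)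
    have "0 \<le> \<tau>" "\<tau> \<le> 1" using \<tau> by auto
    with p show "\<bar>A \<tau>\<bar> \<le> 1" "\<bar>B \<tau>\<bar> \<le> 1" "\<bar>A' \<tau>\<bar> \<le> 1"
      unfolding A_def B_def A'_def by linarith+
    have "1 - B' \<tau> = 2 * \<tau>\<^sup>2 + (1 - \<tau>)\<^sup>2" by (simp add: B'_def power2_eq_square algebra_simps)
    moreover have "B' \<tau> + 1 = (1 - \<tau>) * (1 + 3 * \<tau>)" by (simp add: B'_def power2_eq_square algebra_simps)
    moreover have "(1 - \<tau>) * (1 + 3 * \<tau>) \<ge> 0" using \<tau> by (intro mult_nonneg_nonneg) auto
    ultimately show "\<bar>B' \<tau>\<bar> \<le> 1" by (smt (verit) p(1) zero_le_power2)
  qed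
  have hP: "norm (P \<tau> - x0) \<le> Kh * \<delta>" if \<tau>: "\<tau> \<in> {0..1}" for \<tau>
  proof -
    have "norm (P \<tau> - x0) \<le> \<delta> * (\<bar>A \<tau>\<bar> * norm y1 + \<bar>B \<tau>\<bar> * norm y2) + \<delta>^2 * norm (S \<tau>)"
      unfolding P_def using \<delta>(1)
      by (simp add: add.assoc) (intro norm_triangle_le add_mono, auto intro!: norm_triangle_le)
    also have "\<dots> \<le> \<delta> * (1 * norm y1 + 1 * norm y2) + \<delta> * KS"
    proof (intro add_mono mult_left_mono mult_mono mult_right_mono)
      show "\<delta>\<^sup>2 \<le> \<delta>" using \<delta> by (simp add: power2_eq_square)
    qed (use bds[OF \<tau>] KS[OF \<tau>] \<delta> in auto)
    finally show ?thesis by (simp add: Kh_def algebra_simps)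
  qed
  have lin_h: "D1 (P \<tau> - x0) = \<delta> *\<^sub>R (A \<tau> *\<^sub>R D1 y1 + B \<tau> *\<^sub>R D1 y2) + \<delta>^2 *\<^sub>R D1 (S \<tau>)"
     "D2 (P \<tau> - x0) = \<delta> *\<^sub>R (A \<tau> *\<^sub>R D2 y1 + B \<tau> *\<^sub>R D2 y2) + \<delta>^2 *\<^sub>R D2 (S \<tau>)" for \<tau>
    using lin[THEN bounded_linear.linear] unfolding P_def
    by (simp_all add: linear_add linear_scale)
  have fst_near: "fst z \<in> cball x0 R" if "z \<in> cball z0 R" for z
    using that dist_fst_le[of z0 z] by (simp add: x0_def)
  have "\<exists>y\<in>\<Omega>. u y = M \<and> norm ((P 1, t0) - y) \<le> \<eta> * exp (L + 1)"
  proof (rule curve_near_contact_set[where Z=Z and \<gamma>'="\<lambda>\<tau>. (P' \<tau>, 0)" and \<gamma>="\<lambda>\<tau>. (P \<tau>, t0)"])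
    show "u z0 = M" "R > 0" "cball z0 R \<subseteq> \<Omega>" by (fact z0 R)+
    show "L \<ge> 0" using L1 L2 by (simp add: L_def)
    show "\<eta> \<ge> 0" unfolding \<eta>_def using \<delta> \<kappa> Kh K by simp
    show "Z \<tau> z \<bullet> \<mu> = 0" if "exterior_normal z \<mu>" for \<tau> z \<mu>
    proof -
      have "Y1 (fst z) \<bullet> fst \<mu> = 0" "Y2 (fst z) \<bullet> fst \<mu> = 0"
        using that Y1(2) Y2(2) unfolding tangential_def by blast+
      then show ?thesis by (simp add: Z_def inner_prod_def inner_add_left)
    qed
    show "(P 0, t0) = z0"
      by (simp add: P_def A_def B_def S_def C1_def C2_def x0_def t0_def)
    fix \<tau> :: real assume \<tau>: "\<tau> \<in> {0..1}"
    have "(P has_vector_derivative P' \<tau>) (at \<tau>)"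
      unfolding P_def P'_def
      by (auto intro!: derivative_eq_intros has_vector_derivative_scaleR[THEN has_vector_derivative_eq_rhs] der S_der)
    then show "((\<lambda>\<tau>. (P \<tau>, t0)) has_vector_derivative (P' \<tau>, 0)) (at \<tau>)"
      by (intro has_vector_derivative_Pair) auto
    show "(P \<tau>, t0) \<in> cball z0 (R/4)"
    proof -
      have "dist z0 (P \<tau>, t0) = norm (P \<tau> - x0)"
        by (simp add: dist_prod_def x0_def t0_def dist_norm norm_minus_commute prod_eq_iff dist_Pair_Pair split: prod.split)
      then show ?thesis using hP[OF \<tau>] \<delta>(3) by simp
    qed
    show "norm (Z \<tau> z - Z \<tau> w) \<le> L * norm (z - w)" if zw: "z \<in> cball z0 R" "w \<in> cball z0 R" for z w
    proof -
      let ?a = "Y1 (fst z) - Y1 (fst w)" and ?b = "Y2 (fst z) - Y2 (fst w)"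
      have eq: "Z \<tau> z - Z \<tau> w = (\<delta> *\<^sub>R (A' \<tau> *\<^sub>R ?a + B' \<tau> *\<^sub>R ?b), 0)"
        by (simp add: Z_def algebra_simps)
      have "norm (Z \<tau> z - Z \<tau> w) = \<delta> * norm (A' \<tau> *\<^sub>R ?a + B' \<tau> *\<^sub>R ?b)"
        unfolding eq using \<delta>(1) by (simp add: norm_Pair)
      also have "\<dots> \<le> 1 * (\<bar>A' \<tau>\<bar> * norm ?a + \<bar>B' \<tau>\<bar> * norm ?b)"
        using \<delta>(1,2) by (intro mult_mono) (auto intro!: norm_triangle_le)
      also have "\<dots> \<le> 1 * (1 * (L1 * norm (fst z - fst w)) + 1 * (L2 * norm (fst z - fst w)))"
        using bds[OF \<tau>] L1 L2 fst_near zw by (intro mult_left_mono add_mono mult_mono) auto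
      also have "\<dots> = L * norm (fst (z - w))" by (simp add: L_def algebra_simps)
      also have "\<dots> \<le> L * norm (z - w)"
        using L1 L2 dist_fst_le[of z w] by (intro mult_left_mono) (auto simp: L_def dist_norm)
      finally show ?thesis .
    qed
    show "norm ((P' \<tau>, 0) - Z \<tau> (P \<tau>, t0)) \<le> \<eta>"
    proof -
      define e1 where "e1 = Y1 (P \<tau>) - Y1 x0 - D1 (P \<tau> - x0)"
      define e2 where "e2 = Y2 (P \<tau>) - Y2 x0 - D2 (P \<tau> - x0)"
      have "norm e1 \<le> \<kappa> * norm (P \<tau> - x0)" unfolding e1_def using hP[OF \<tau>] \<delta> by (intro d1) auto
      also have "\<dots> \<le> \<kappa> * (Kh * \<delta>)" using hP[OF \<tau>] \<kappa> by (intro mult_left_mono) auto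
      finally have e1: "norm e1 \<le> \<kappa> * (Kh * \<delta>)" .
      have "norm e2 \<le> \<kappa> * norm (P \<tau> - x0)" unfolding e2_def using hP[OF \<tau>] \<delta> by (intro d2) auto
      also have "\<dots> \<le> \<kappa> * (Kh * \<delta>)" using hP[OF \<tau>] \<kappa> by (intro mult_left_mono) auto
      finally have e2: "norm e2 \<le> \<kappa> * (Kh * \<delta>)" .
      have DS: "norm (D1 (S \<tau>)) \<le> KS * K1" "norm (D2 (S \<tau>)) \<le> KS * K2"
        using K1(2)[of "S \<tau>"] K2(2)[of "S \<tau>"] mult_right_mono[OF KS[OF \<tau>] K1(1)] mult_right_mono[OF KS[OF \<tau>] K2(1)]
        by linarith+
      have Y12: "Y1 (P \<tau>) = y1 + \<delta> *\<^sub>R (A \<tau> *\<^sub>R D1 y1 + B \<tau> *\<^sub>R D1 y2) + \<delta>^2 *\<^sub>R D1 (S \<tau>) + e1"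
         "Y2 (P \<tau>) = y2 + \<delta> *\<^sub>R (A \<tau> *\<^sub>R D2 y1 + B \<tau> *\<^sub>R D2 y2) + \<delta>^2 *\<^sub>R D2 (S \<tau>) + e2"
        by (simp_all add: e1_def e2_def y1_def y2_def lin_h)
      \<comment> \<open>By the choice of \<open>S'\<close> everything up to order \<delta>^2 cancels
        except the linearisation errors \<open>e1\<close> and \<open>e2\<close>.\<close>
      have "P' \<tau> - fst (Z \<tau> (P \<tau>, t0)) = - (\<delta> *\<^sub>R (A' \<tau> *\<^sub>R (\<delta>^2 *\<^sub>R D1 (S \<tau>) + e1) + B' \<tau> *\<^sub>R (\<delta>^2 *\<^sub>R D2 (S \<tau>) + e2)))"
        unfolding Z_def fst_conv Y12 P'_def S'_def
        by (simp add: algebra_simps power2_eq_square)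
      then have "norm ((P' \<tau>, 0) - Z \<tau> (P \<tau>, t0)) = \<delta> * norm (A' \<tau> *\<^sub>R (\<delta>^2 *\<^sub>R D1 (S \<tau>) + e1) + B' \<tau> *\<^sub>R (\<delta>^2 *\<^sub>R D2 (S \<tau>) + e2))"
        using \<delta>(1) by (simp add: Z_def norm_Pair)
      also have "\<dots> \<le> \<delta> * (\<bar>A' \<tau>\<bar> * (\<delta>^2 * norm (D1 (S \<tau>)) + norm e1) + \<bar>B' \<tau>\<bar> * (\<delta>^2 * norm (D2 (S \<tau>)) + norm e2))"
        using \<delta>(1) by (intro mult_left_mono norm_triangle_le add_mono) (auto intro!: mult_left_mono norm_triangle_le)
      also have "\<dots> \<le> \<delta> * (1 * (\<delta>^2 * (KS * K1) + \<kappa> * (Kh * \<delta>)) + 1 * (\<delta>^2 * (KS * K2) + \<kappa> * (Kh * \<delta>)))"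
        using \<delta>(1) bds[OF \<tau>] DS e1 e2 by (intro mult_left_mono mult_mono add_mono) auto
      also have "\<dots> = \<eta>" by (simp add: \<eta>_def K_def power2_eq_square algebra_simps)
      finally show ?thesis .
    qed
  qed
  then obtain y where y: "y \<in> \<Omega>" "u y = M" "norm ((P 1, t0) - y) \<le> \<eta> * E"
    by (auto simp: E_def)
  define s where "s = \<delta>^2 / 60"
  have s: "0 < s" "s \<le> \<delta>"
    using \<delta>(1,2) by (auto simp: s_def power2_eq_square mult_left_le_one_le intro: order_trans[of _ "\<delta> * \<delta>"])
  define V where "V = (W, 0::real)"
  have P1: "(P 1, t0) = z0 + s *\<^sub>R V"
    by (simp add: P_def A_def B_def S1 s_def V_def x0_def t0_def prod_eq_iff)
  \<comment> \<open>The endpoint lies deeper than \<open>\<eta> * E\<close> inside the exterior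
    ball, whereas a contact point within that distance must stay outside the ball.\<close>
  have "norm (\<nu> - s *\<^sub>R V) \<le> norm \<nu> - s * \<omega> / (2 * norm \<nu>)"
  proof (rule power2_le_imp_le)
    have "s * \<omega> \<le> \<omega> * \<delta>" using s \<omega> by simp
    also have "\<dots> \<le> 2 * (norm \<nu>)\<^sup>2" using \<delta>(7) by simp
    finally show "0 \<le> norm \<nu> - s * \<omega> / (2 * norm \<nu>)"
      using nu by (simp add: field_simps power2_eq_square)
    have "(norm W)\<^sup>2 * s \<le> (norm W)\<^sup>2 * \<delta>" using s by (intro mult_left_mono) auto
    then have "s * ((norm W)\<^sup>2 * s) \<le> s * \<omega>" using \<delta>(6) s by (intro mult_left_mono) auto
    moreover have "(norm (\<nu> - s *\<^sub>R V))\<^sup>2 = (norm \<nu>)\<^sup>2 - 2 * (s * \<omega>) + s * ((norm W)\<^sup>2 * s)"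
      unfolding power2_norm_eq_inner V_def \<omega>_def
      by (cases \<nu>) (simp add: inner_diff_left inner_diff_right inner_commute algebra_simps)
    moreover have "(norm \<nu> - s * \<omega> / (2 * norm \<nu>))\<^sup>2 = (norm \<nu>)\<^sup>2 - s * \<omega> + (s * \<omega> / (2 * norm \<nu>))\<^sup>2"
      using nu by (simp add: power2_diff)
    ultimately show "(norm (\<nu> - s *\<^sub>R V))\<^sup>2 \<le> (norm \<nu> - s * \<omega> / (2 * norm \<nu>))\<^sup>2"
      using zero_le_power2[of "s * \<omega> / (2 * norm \<nu>)"] by linarith
  qed
  moreover have "norm \<nu> \<le> norm (z0 + \<nu> - y)"
  proof -
    have "y \<notin> ball (z0 + \<nu>) (norm \<nu>)" using \<nu> y(1,2) unfolding exterior_normal_def by blast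
    then show ?thesis by (simp add: dist_norm)
  qed
  moreover have "norm (z0 + \<nu> - y) \<le> norm (\<nu> - s *\<^sub>R V) + norm ((P 1, t0) - y)"
    unfolding P1 using norm_triangle_ineq[of "\<nu> - s *\<^sub>R V" "z0 + s *\<^sub>R V - y"] by (simp add: algebra_simps)
  ultimately have "s * \<omega> / (2 * norm \<nu>) \<le> \<eta> * E" using y(3) by linarith
  then have "\<delta>^2 * \<omega>' \<le> \<delta>^2 * ((2 * \<kappa> * Kh + \<delta> * K) * E)"
    by (simp add: s_def \<omega>'_def \<eta>_def mult_ac)
  then have "\<omega>' \<le> (2 * \<kappa> * Kh + \<delta> * K) * E" using \<delta>(1) by simp
  then show False using \<kappa>E \<delta>(8) \<omega>' by (simp add: algebra_simps)
qed

text \<open>For a bracket the loop yields one inequality; exchanging the two fields changes the sign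
  of the bracket and yields the other.\<close>

lemma lie_algebra_tangential:
  assumes "Y \<in> lie_algebra X m"
  shows "tangential Y"
  using assms
proof induction
  case (gen i)
  then show ?case using fields_orthogonal_normal unfolding tangential_def by blast
next
  case (lin Y Z k l)
  then show ?case unfolding tangential_def by (simp add: inner_add_left)
next
  case (brk Y Z)
  have sm: "smooth_vfield Y" "smooth_vfield Z" using brk lie_algebra_smooth X by blast+
  have anti: "lie_bracket Z Y x = - lie_bracket Y Z x" for x by (simp add: lie_bracket_def)
  show ?case
    unfolding tangential_def
  proof (intro allI impI)
    fix z \<nu> assume \<nu>: "exterior_normal z \<nu>"
    have "lie_bracket Y Z (fst z) \<bullet> fst \<nu> \<le> 0" "lie_bracket Z Y (fst z) \<bullet> fst \<nu> \<le> 0"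
      using bracket_nonpos_on_normals sm brk.IH \<nu> by blast+
    then show "lie_bracket Y Z (fst z) \<bullet> fst \<nu> = 0"
      by (simp add: anti)
  qed
qed

text \<open>By the rank condition some field of the Lie algebra takes the value
  \<open>fst \<nu>\<close> at the point, and its tangency makes \<open>fst \<nu>\<close> orthogonal
  to itself.\<close>

lemma exterior_normal_vertical:
  assumes "exterior_normal z \<nu>"
  shows "fst \<nu> = 0"
proof -
  have "fst \<nu> \<in> {Y (fst z) | Y. Y \<in> lie_algebra X m}" unfolding span by simp
  then obtain Y where Y: "Y \<in> lie_algebra X m" "fst \<nu> = Y (fst z)" by auto
  have "Y (fst z) \<bullet> fst \<nu> = 0" using lie_algebra_tangential[OF Y(1)] assms unfolding tangential_def by blast
  then have "fst \<nu> \<bullet> fst \<nu> = 0" using Y(2) by simp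
  then show ?thesis by simp
qed

text \<open>Since all normals are vertical, every constant horizontal field is tangential, and the
  comparison lemma with \<open>L = 0\<close> and \<open>\<eta> = 0\<close> moves inside the contact
  set without error.\<close>

lemma horizontal_propagation:
  assumes "u z0 = M" "R > 0" "cball z0 R \<subseteq> \<Omega>" "norm w \<le> R / 4"
  shows "u (z0 + (w, 0)) = M"
proof -
  have "\<exists>y\<in>\<Omega>. u y = M \<and> norm ((z0 + 1 *\<^sub>R (w, 0)) - y) \<le> 0 * exp (0 + 1)"
  proof (rule curve_near_contact_set[where Z="\<lambda>\<tau> z. (w, 0)" and \<gamma>'="\<lambda>\<tau>. (w, 0)" and R=R])
    show "(w, 0) \<bullet> \<nu> = 0" if "exterior_normal z \<nu>" for z \<nu>
      using exterior_normal_vertical[OF that] by (simp add: inner_prod_def)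
    fix \<tau> :: real assume \<tau>: "\<tau> \<in> {0..1}"
    show "((\<lambda>\<tau>. z0 + \<tau> *\<^sub>R (w, 0)) has_vector_derivative (w, 0)) (at \<tau>)"
      by (auto intro!: derivative_eq_intros)
    have "\<bar>\<tau>\<bar> * norm w \<le> 1 * norm w" using \<tau> by (intro mult_right_mono) auto
    then show "z0 + \<tau> *\<^sub>R (w, 0) \<in> cball z0 (R / 4)"
      using assms(4) by (simp add: dist_norm norm_Pair)
  qed (use assms in \<open>auto simp: zero_prod_def\<close>)
  then show ?thesis by auto
qed

end

section \<open>Propagation along admissible curves\<close>

definition small_variation :: "real \<Rightarrow> real \<Rightarrow> (real \<Rightarrow> 'a::metric_space) \<Rightarrow> real \<Rightarrow> real \<Rightarrow> bool" where
  "small_variation a b g \<delta> \<epsilon> \<longleftrightarrow> (\<forall>(n::nat) lo hi.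
        (\<forall>k<n. a \<le> lo k \<and> lo k \<le> hi k \<and> hi k \<le> b) \<and>
        (\<forall>k<n. \<forall>l<n. k \<noteq> l \<longrightarrow> hi k \<le> lo l \<or> hi l \<le> lo k) \<and>
        (\<Sum>k<n. hi k - lo k) < \<delta> \<longrightarrow>
        (\<Sum>k<n. dist (g (hi k)) (g (lo k))) < \<epsilon>)"

lemma abs_continuous_on_iff:
  "abs_continuous_on a b g \<longleftrightarrow> (\<forall>\<epsilon>>0. \<exists>\<delta>>0. small_variation a b g \<delta> \<epsilon>)"
  unfolding abs_continuous_on_def small_variation_def by (rule refl)

lemma small_variationD:
  fixes n :: nat
  assumes "small_variation a b g \<delta> \<epsilon>"
    and "\<And>k. k < n \<Longrightarrow> a \<le> lo k" "\<And>k. k < n \<Longrightarrow> lo k \<le> hi k" "\<And>k. k < n \<Longrightarrow> hi k \<le> b"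
    and "\<And>k l. k < n \<Longrightarrow> l < n \<Longrightarrow> k \<noteq> l \<Longrightarrow> hi k \<le> lo l \<or> hi l \<le> lo k"
    and "(\<Sum>k<n. hi k - lo k) < \<delta>"
  shows "(\<Sum>k<n. dist (g (hi k)) (g (lo k))) < \<epsilon>"
  using assms unfolding small_variation_def by simp

lemma small_variationI:
  assumes "\<And>n lo hi. (\<And>k. k < (n::nat) \<Longrightarrow> a \<le> lo k \<and> lo k \<le> hi k \<and> hi k \<le> b) \<Longrightarrow>
      (\<And>k l. k < n \<Longrightarrow> l < n \<Longrightarrow> k \<noteq> l \<Longrightarrow> hi k \<le> lo l \<or> hi l \<le> lo k) \<Longrightarrow>
      (\<Sum>k<n. hi k - lo k) < \<delta> \<Longrightarrow> (\<Sum>k<n. dist (g (hi k)) (g (lo k))) < \<epsilon>"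
  shows "small_variation a b g \<delta> \<epsilon>"
  unfolding small_variation_def
proof (intro allI impI, elim conjE)
  fix n :: nat and lo hi :: "nat \<Rightarrow> real"
  assume "\<forall>k<n. a \<le> lo k \<and> lo k \<le> hi k \<and> hi k \<le> b"
    "\<forall>k<n. \<forall>l<n. k \<noteq> l \<longrightarrow> hi k \<le> lo l \<or> hi l \<le> lo k" "(\<Sum>k<n. hi k - lo k) < \<delta>"
  then show "(\<Sum>k<n. dist (g (hi k)) (g (lo k))) < \<epsilon>" by (intro assms) simp_all
qed

text \<open>A gauge argument. Intervals of a fine tagged division with tag outside the null set grow
  at most at rate \<epsilon>, by differentiability at the tag. Those with tag in the null set lie in
  an open set of measure below \<delta>, so absolute continuity bounds their total contribution by
  \<epsilon>.\<close>

lemma abs_continuous_nonincreasing: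
  fixes g :: "real \<Rightarrow> real"
  assumes ac: "abs_continuous_on a b g" and "a \<le> b"
    and ae: "AE s in lborel. s \<in> {a..b} \<longrightarrow> (\<exists>D\<le>0. (g has_real_derivative D) (at s))"
  shows "g b \<le> g a"
proof (rule field_le_epsilon)
  fix \<epsilon>' :: real assume \<epsilon>': "\<epsilon>' > 0"
  \<comment> \<open>The error budget is \<epsilon> per unit of length plus \<epsilon> for the
    exceptional intervals.\<close>
  define \<epsilon> where "\<epsilon> = \<epsilon>' / (b - a + 1)"
  have \<epsilon>: "\<epsilon> > 0" "\<epsilon> * (b - a) + \<epsilon> = \<epsilon>'"
  proof -
    have pos: "b - a + 1 > 0" using \<open>a \<le> b\<close> by simp
    then show "\<epsilon> > 0" using \<epsilon>' by (simp add: \<epsilon>_def)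
    have "\<epsilon> * (b - a) + \<epsilon> = \<epsilon> * (b - a + 1)" by (simp add: algebra_simps)
    then show "\<epsilon> * (b - a) + \<epsilon> = \<epsilon>'" using pos by (simp add: \<epsilon>_def)
  qed
  obtain N where N0: "{s \<in> space lborel. \<not> (s \<in> {a..b} \<longrightarrow> (\<exists>D\<le>0. (g has_real_derivative D) (at s)))} \<subseteq> N"
      "emeasure lborel N = 0" "N \<in> sets lborel"
    by (rule AE_E[OF ae])
  have N: "\<exists>D\<le>0. (g has_real_derivative D) (at s)" if "s \<in> {a..b}" "s \<notin> N" for s
  proof (rule ccontr)
    assume "\<not> ?thesis"
    then have "s \<in> N" using N0(1) that(1) by (intro subsetD[OF N0(1)]) simp
    then show False using that(2) by contradiction
  qed
  obtain \<delta> where \<delta>: "\<delta> > 0" "small_variation a b g \<delta> \<epsilon>"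
    using ac \<epsilon>(1) unfolding abs_continuous_on_iff by blast
  have Nb: "N \<in> sets borel" "N \<in> null_sets lborel" using N0 by (auto intro: null_setsI)
  obtain U where U: "open U" "N \<subseteq> U" "emeasure lborel (U - N) < \<delta>"
    using outer_regular_lborel[OF Nb(1) \<delta>(1)] by blast
  have Ud: "emeasure lborel U < \<delta>"
    using U emeasure_Diff_null_set[OF Nb(2), of U] by simp
  \<comment> \<open>The conditions on the gauge radius \<open>e\<close> at the tag \<open>x\<close>,
    for exceptional and for regular tags.\<close>
  define Q where "Q x e \<longleftrightarrow> 0 < e \<and> (x \<in> N \<longrightarrow> ball x e \<subseteq> U) \<and>
     (x \<in> {a..b} - N \<longrightarrow> (\<forall>w v. w \<le> x \<and> x \<le> v \<and> {w..v} \<subseteq> ball x e \<longrightarrow> g v - g w \<le> \<epsilon> * (v - w)))" for x e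
  have "\<exists>e. Q x e" for x
  proof (cases "x \<in> N")
    case True
    then have "x \<in> U" using U(2) by auto
    then obtain e where "e > 0" "ball x e \<subseteq> U" using U(1) openE by blast
    then show ?thesis using True by (auto simp: Q_def)
  next
    case False
    show ?thesis
    proof (cases "x \<in> {a..b}")
      case True
      then obtain D where D: "D \<le> 0" "(g has_real_derivative D) (at x)" using N False by blast
      obtain d where d: "d > 0" "\<And>y. norm (y - x) < d \<Longrightarrow> norm (g y - g x - D * (y - x)) \<le> \<epsilon> * norm (y - x)"
        using D(2) \<epsilon>(1) unfolding has_field_derivative_def has_derivative_at_alt by blast
      have "g v - g w \<le> \<epsilon> * (v - w)" if wv: "w \<le> x" "x \<le> v" "{w..v} \<subseteq> ball x d" for w v
      proof -
        have "w \<in> {w..v}" "v \<in> {w..v}" using wv(1,2) by auto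
        then have "w \<in> ball x d" "v \<in> ball x d" using wv(3) by blast+
        then have "\<bar>g v - g x - D * (v - x)\<bar> \<le> \<epsilon> * \<bar>v - x\<bar>" "\<bar>g w - g x - D * (w - x)\<bar> \<le> \<epsilon> * \<bar>w - x\<bar>"
          using d(2)[of v] d(2)[of w] by (auto simp: dist_real_def abs_minus_commute)
        moreover have "D * (v - x) \<le> 0" "D * (w - x) \<ge> 0"
          using D(1) wv by (auto intro: mult_nonpos_nonneg mult_nonpos_nonpos)
        moreover have "\<epsilon> * \<bar>v - x\<bar> + \<epsilon> * \<bar>w - x\<bar> = \<epsilon> * (v - w)"
          using wv by (simp add: algebra_simps)
        ultimately show ?thesis by linarith
      qed
      then show ?thesis using d(1) False unfolding Q_def by blast
    qed (use False in \<open>auto simp: Q_def intro: exI[of _ 1]\<close>)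
  qed
  then have "\<forall>x. \<exists>e. Q x e" by blast
  from choice[OF this] obtain e where "\<And>x. Q x (e x)" by blast
  then have e: "\<And>x. e x > 0" "\<And>x. x \<in> N \<Longrightarrow> ball x (e x) \<subseteq> U"
      "\<And>x w v. x \<in> {a..b} \<Longrightarrow> x \<notin> N \<Longrightarrow> w \<le> x \<Longrightarrow> x \<le> v \<Longrightarrow> {w..v} \<subseteq> ball x (e x) \<Longrightarrow> g v - g w \<le> \<epsilon> * (v - w)"
    unfolding Q_def by blast+
  have "gauge (\<lambda>x. ball x (e x))" using e(1) by (intro gauge_ball_dependent) auto
  then obtain p where p: "p tagged_division_of {a..b}" "(\<lambda>x. ball x (e x)) fine p"
    using fine_division_exists_real by blast
  note pD = tagged_division_ofD[OF p(1)]
  have K: "\<exists>l h. K = {l..h} \<and> Inf K = l \<and> Sup K = h \<and> l \<le> x \<and> x \<le> h \<and> a \<le> l \<and> h \<le> b \<and> {l..h} \<subseteq> ball x (e x)"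
    if xK: "(x, K) \<in> p" for x K
  proof -
    obtain l h where lh: "K = {l..h}" using pD(4)[OF xK] by auto
    have "x \<in> {l..h}" "{l..h} \<subseteq> {a..b}" "{l..h} \<subseteq> ball x (e x)"
      using pD(2,3)[OF xK] fineD[OF p(2) xK] lh by auto
    then show ?thesis using lh by auto
  qed
  \<comment> \<open>Degenerate intervals contribute nothing and are discarded: only for
    nondegenerate ones do disjoint interiors imply that one interval ends before the other
    begins.\<close>
  define P2 where "P2 = {xK \<in> p. fst xK \<in> N \<and> Inf (snd xK) < Sup (snd xK)}"
  have finP2: "finite P2" using pD(1) by (simp add: P2_def)
  have "g b - g a = (\<Sum>(x,K)\<in>p. g (Sup K) - g (Inf K))"
    by (rule additive_tagged_division_1[OF \<open>a \<le> b\<close> p(1), symmetric])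
  also have "\<dots> \<le> (\<Sum>(x,K)\<in>p. \<epsilon> * (Sup K - Inf K) + (if (x,K) \<in> P2 then dist (g (Sup K)) (g (Inf K)) else 0))"
  proof (rule sum_mono, clarify)
    fix x K assume xK: "(x, K) \<in> p"
    obtain l h where lh: "K = {l..h}" "Inf K = l" "Sup K = h" "l \<le> x" "x \<le> h" "a \<le> l" "h \<le> b" "{l..h} \<subseteq> ball x (e x)"
      using K[OF xK] by blast
    have c: "\<epsilon> * (Sup K - Inf K) = \<epsilon> * (h - l)" "\<epsilon> * (h - l) \<ge> 0" using lh \<epsilon>(1) by auto
    show "g (Sup K) - g (Inf K) \<le> \<epsilon> * (Sup K - Inf K) + (if (x,K) \<in> P2 then dist (g (Sup K)) (g (Inf K)) else 0)"
    proof (cases "x \<in> N")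
      case True
      then show ?thesis
      proof (cases "l = h")
        case False
        then have "(x, K) \<in> P2" using True xK lh by (auto simp: P2_def)
        then show ?thesis using c lh by (simp add: dist_real_def)
      qed (use c lh in auto)
    next
      case False
      then have "(x, K) \<notin> P2" by (simp add: P2_def)
      then show ?thesis using c e(3)[of x l h] lh False by simp
    qed
  qed
  also have "\<dots> = \<epsilon> * (\<Sum>(x,K)\<in>p. Sup K - Inf K) + (\<Sum>xK\<in>p. if xK \<in> P2 then dist (g (Sup (snd xK))) (g (Inf (snd xK))) else 0)"
    by (simp add: sum.distrib sum_distrib_left split_def)
  also have "(\<Sum>(x,K)\<in>p. Sup K - Inf K) = b - a"
    by (rule additive_tagged_division_1[OF \<open>a \<le> b\<close> p(1)])
  also have "(\<Sum>xK\<in>p. if xK \<in> P2 then dist (g (Sup (snd xK))) (g (Inf (snd xK))) else 0)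
      = (\<Sum>xK\<in>P2. dist (g (Sup (snd xK))) (g (Inf (snd xK))))"
    using pD(1) by (intro sum.mono_neutral_cong_right) (auto simp: P2_def)
  also have "\<dots> < \<epsilon>"
  proof -
    define n where "n = card P2"
    obtain q where q: "bij_betw q {..<n} P2"
      using ex_bij_betw_nat_finite[OF finP2] by (auto simp: n_def atLeast0LessThan)
    define lo hi where "lo k = Inf (snd (q k))" and "hi k = Sup (snd (q k))" for k
    have qk: "q k \<in> p" "fst (q k) \<in> N" "lo k < hi k" if "k < n" for k
      using bij_betwE[OF q] that by (auto simp: P2_def lo_def hi_def)
    have qK: "snd (q k) = {lo k..hi k}" "a \<le> lo k" "hi k \<le> b" "{lo k..hi k} \<subseteq> U" if kn: "k < n" for k
    proof -
      obtain x K' where xK: "q k = (x, K')" by force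
      then obtain l h where lh: "K' = {l..h}" "Inf K' = l" "Sup K' = h" "a \<le> l" "h \<le> b" "{l..h} \<subseteq> ball x (e x)"
        using K[of x K'] qk(1)[OF kn] by auto
      show "snd (q k) = {lo k..hi k}" "a \<le> lo k" "hi k \<le> b" using lh xK by (auto simp: lo_def hi_def)
      show "{lo k..hi k} \<subseteq> U" using lh xK e(2)[of x] qk(2)[OF kn] by (auto simp: lo_def hi_def)
    qed
    have disj: "{lo k<..<hi k} \<inter> {lo l<..<hi l} = {}" if "k < n" "l < n" "k \<noteq> l" for k l
    proof -
      have "q k \<noteq> q l" using q that unfolding bij_betw_def inj_on_def by blast
      then have "interior (snd (q k)) \<inter> interior (snd (q l)) = {}"
        using pD(5)[of "fst (q k)" "snd (q k)" "fst (q l)" "snd (q l)"] qk(1) that by auto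
      then show ?thesis using qK(1) that by simp
    qed
    have sep: "hi k \<le> lo l \<or> hi l \<le> lo k" if "k < n" "l < n" "k \<noteq> l" for k l
    proof (rule ccontr)
      assume "\<not> ?thesis"
      then have "max (lo k) (lo l) < min (hi k) (hi l)" using qk(3) that by auto
      then obtain y where "max (lo k) (lo l) < y" "y < min (hi k) (hi l)" using dense by blast
      then have "y \<in> {lo k<..<hi k} \<inter> {lo l<..<hi l}" by auto
      then show False using disj[OF that] by blast
    qed
    have "ennreal (\<Sum>k<n. hi k - lo k) = (\<Sum>k<n. emeasure lborel {lo k<..<hi k})"
      using qk(3) by (subst sum_ennreal[symmetric]) (auto intro!: sum.cong simp: less_imp_le)
    also have "\<dots> = emeasure lborel (\<Union>k\<in>{..<n}. {lo k<..<hi k})"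
      by (rule sum_emeasure) (use disj in \<open>auto simp: disjoint_family_on_def\<close>)
    also have "\<dots> \<le> emeasure lborel U"
    proof (rule emeasure_mono)
      show "(\<Union>k\<in>{..<n}. {lo k<..<hi k}) \<subseteq> U" using qK(4) by (force simp: subset_iff)
    qed (use U in simp)
    also have "\<dots> < ennreal \<delta>" using Ud by simp
    finally have len: "ennreal (\<Sum>k<n. hi k - lo k) < ennreal \<delta>" .
    have "(\<Sum>k<n. hi k - lo k) \<ge> 0"
      by (intro sum_nonneg) (use qk(3) in \<open>simp add: less_imp_le\<close>)
    with len have "(\<Sum>k<n. hi k - lo k) < \<delta>" using ennreal_less_iff by blast
    then have "(\<Sum>k<n. dist (g (hi k)) (g (lo k))) < \<epsilon>"
      by (intro small_variationD[OF \<delta>(2)]) (use qK(2,3) qk(3) sep in \<open>simp_all add: less_imp_le\<close>)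
    moreover have "(\<Sum>xK\<in>P2. dist (g (Sup (snd xK))) (g (Inf (snd xK)))) = (\<Sum>k<n. dist (g (hi k)) (g (lo k)))"
      unfolding lo_def hi_def by (rule sum.reindex_bij_betw[OF q, symmetric])
    ultimately show ?thesis by simp
  qed
  finally show "g b \<le> g a + \<epsilon>'" using \<epsilon>(2) by linarith
qed

lemma abs_continuous_on_subinterval:
  assumes "abs_continuous_on a b g" "a \<le> c" "d \<le> b"
  shows "abs_continuous_on c d g"
proof -
  have "small_variation c d g \<delta> \<epsilon>" if "small_variation a b g \<delta> \<epsilon>" for \<delta> \<epsilon>
    by (rule small_variationI, rule small_variationD[OF that])
       (use assms(2,3) in \<open>auto intro: order_trans\<close>)
  then show ?thesis using assms(1) unfolding abs_continuous_on_iff by blast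
qed

lemma abs_continuous_on_snd:
  assumes "abs_continuous_on a b g"
  shows "abs_continuous_on a b (\<lambda>s. snd (g s))"
proof -
  have "small_variation a b (\<lambda>s. snd (g s)) \<delta> \<epsilon>" if "small_variation a b g \<delta> \<epsilon>" for \<delta> \<epsilon>
  proof (rule small_variationI)
    fix n :: nat and lo hi :: "nat \<Rightarrow> real"
    assume H: "\<And>k. k < n \<Longrightarrow> a \<le> lo k \<and> lo k \<le> hi k \<and> hi k \<le> b"
      "\<And>k l. k < n \<Longrightarrow> l < n \<Longrightarrow> k \<noteq> l \<Longrightarrow> hi k \<le> lo l \<or> hi l \<le> lo k" "(\<Sum>k<n. hi k - lo k) < \<delta>"
    have "(\<Sum>k<n. dist (snd (g (hi k))) (snd (g (lo k)))) \<le> (\<Sum>k<n. dist (g (hi k)) (g (lo k)))"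
      by (intro sum_mono dist_snd_le)
    also have "\<dots> < \<epsilon>" by (rule small_variationD[OF that]) (use H in auto)
    finally show "(\<Sum>k<n. dist (snd (g (hi k))) (snd (g (lo k)))) < \<epsilon>" .
  qed
  then show ?thesis using assms unfolding abs_continuous_on_iff by blast
qed

lemma abs_continuous_on_continuous:
  assumes "abs_continuous_on a b g"
  shows "continuous_on {a..b} g"
  unfolding continuous_on_iff
proof (intro ballI allI impI)
  fix x \<epsilon> :: real assume x: "x \<in> {a..b}" and "\<epsilon> > 0"
  then obtain \<delta> where \<delta>: "\<delta> > 0" "small_variation a b g \<delta> \<epsilon>"
    using assms unfolding abs_continuous_on_iff by blast
  have near: "dist (g w) (g v) < \<epsilon>" if "v \<in> {a..b}" "w \<in> {a..b}" "v \<le> w" "w - v < \<delta>" for v w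
    using small_variationD[OF \<delta>(2), of 1 "\<lambda>_. v" "\<lambda>_. w"] that by simp
  have "dist (g y) (g x) < \<epsilon>" if "y \<in> {a..b}" "dist y x < \<delta>" for y
    using near[of x y] near[of y x] that x by (cases "x \<le> y") (auto simp: dist_real_def dist_commute)
  then show "\<exists>d>0. \<forall>x'\<in>{a..b}. dist x' x < d \<longrightarrow> dist (g x') (g x) < \<epsilon>" using \<delta>(1) by blast
qed

section \<open>Contact along curves on which time does not increase\<close>

context max_propagation
begin

lemma cylinder_propagation:
  assumes z0: "(x0, t0) \<in> \<Omega>" "u (x0, t0) = M"
  shows "\<exists>r>0. \<forall>x t. dist x x0 < r \<and> t0 - r < t \<and> t \<le> t0 \<longrightarrow> u (x, t) = M"
proof -
  obtain R where R: "R > 0" "cball (x0, t0) R \<subseteq> \<Omega>" using \<Omega> z0(1) open_contains_cball by blast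
  \<comment> \<open>Points of the cylinder are within \<open>2 * r\<close> of the centre and carry a
    ball of radius \<open>8 * r\<close> in \<Omega>; a quarter of that radius is the diameter
    \<open>2 * r\<close> to be crossed horizontally.\<close>
  define r where "r = R / 10"
  have r: "r > 0" using R by (simp add: r_def)
  have dz: "dist (x0, t0) (x, t) \<le> 2 * r" if "x \<in> cball x0 r" "\<bar>t - t0\<bar> \<le> r" for x t
  proof -
    have "dist (x0, t0) (x, t) \<le> dist x0 x + dist t0 t"
      unfolding dist_Pair_Pair by (rule sqrt_sum_squares_le_sum) auto
    then show ?thesis using that by (simp add: dist_real_def abs_minus_commute)
  qed
  have cb: "cball (x, t) (8 * r) \<subseteq> \<Omega>" if "x \<in> cball x0 r" "\<bar>t - t0\<bar> \<le> r" for x t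
  proof -
    have "cball (x, t) (8 * r) \<subseteq> cball (x0, t0) R"
      using dz[OF that] by (auto simp: cball_subset_cball_iff dist_commute r_def)
    then show ?thesis using R by blast
  qed
  have H: "u (x', t) = M" if "x \<in> cball x0 r" "x' \<in> cball x0 r" "\<bar>t - t0\<bar> \<le> r" "u (x, t) = M" for x x' t
  proof -
    have "dist x x' \<le> 2 * r" using that(1,2) dist_triangle3[of x x' x0] by (simp add: dist_commute)
    then have "norm (x' - x) \<le> 8 * r / 4" by (simp add: dist_norm norm_minus_commute)
    from horizontal_propagation[OF that(4) _ cb[OF that(1,3)] this] r show ?thesis by simp
  qed
  have x0: "x0 \<in> cball x0 r" using r by simp
  have axis: "u (x0, t) = M" if t: "t0 - r \<le> t" "t \<le> t0" for t
  proof (rule ccontr)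
    assume nt: "u (x0, t) \<noteq> M"
    \<comment> \<open>If contact fails at \<open>t\<close>, the lowest contact time on the axis lies
      above \<open>t\<close>. By horizontal propagation the whole cylinder just below it is free of
      contact, as \<open>time_step\<close> requires.\<close>
    define T where "T = {s \<in> {t..t0}. u (x0, s) = M}"
    have sub: "(x, s) \<in> \<Omega>" if "x \<in> cball x0 r" "s \<in> {t..t0}" for x s
      using cb[of x s] that t r by force
    have "continuous_on {t..t0} (\<lambda>s. u (x0, s))"
      by (rule continuous_on_compose2[OF u_cont]) (use sub x0 in \<open>auto intro!: continuous_intros\<close>)
    then have "closed T" unfolding T_def by (intro continuous_closed_preimage_constant) auto
    moreover have "t0 \<in> T" "bdd_below T" using z0(2) t by (auto simp: T_def)
    ultimately have I: "Inf T \<in> T" using closed_contains_Inf[of T] by blast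
    define t2 where "t2 = Inf T"
    have t2: "t2 \<in> {t..t0}" "u (x0, t2) = M" using I by (auto simp: T_def t2_def)
    have "t < t2" using t2 nt by (cases "t = t2") auto
    show False
    proof (rule time_step[of x0 t2 r "t2 - t"])
      show "(x0, t2) \<in> \<Omega>" using sub[OF x0] t2(1) by blast
      show "cball x0 r \<times> {t2 - (t2 - t)..t2} \<subseteq> \<Omega>" using sub t2(1) by auto
      fix x s assume xs: "x \<in> cball x0 r" "s \<in> {t2 - (t2 - t)..<t2}"
      then have s: "s \<in> {t..t0}" "\<bar>s - t0\<bar> \<le> r" using t2(1) t by auto
      show "u (x, s) < M"
      proof (rule ccontr)
        assume "\<not> ?thesis"
        then have "u (x, s) = M" using u_le[OF sub[OF xs(1) s(1)]] by simp
        then have "s \<in> T" using H[OF xs(1) x0 s(2)] s(1) by (simp add: T_def)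
        then have "t2 \<le> s" unfolding t2_def using \<open>bdd_below T\<close> by (rule cInf_lower)
        then show False using xs(2) by simp
      qed
    qed (use t2 r \<open>t < t2\<close> in auto)
  qed
  show ?thesis
  proof (intro exI[of _ r] conjI allI impI r)
    fix x t assume "dist x x0 < r \<and> t0 - r < t \<and> t \<le> t0"
    then show "u (x, t) = M"
      using axis[of t] H[OF x0, of x t] by (auto simp: dist_commute)
  qed
qed

text \<open>Near a contact time the curve stays, for later parameters, in the downward cylinder of
  \<open>cylinder_propagation\<close>, since time does not increase along it.\<close>

lemma curve_propagation:
  assumes \<gamma>: "continuous_on {0..1::real} \<gamma>" "\<gamma> ` {0..1} \<subseteq> \<Omega>" "u (\<gamma> 0) = M"
    and mono: "\<And>s s'. 0 \<le> s \<Longrightarrow> s \<le> s' \<Longrightarrow> s' \<le> 1 \<Longrightarrow> snd (\<gamma> s') \<le> snd (\<gamma> s)"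
    and s: "s \<in> {0..1}"
  shows "u (\<gamma> s) = M"
proof (rule interval_continuation[where P="\<lambda>s. u (\<gamma> s) = M" and a=0 and b=1])
  have "continuous_on {0..1} (\<lambda>s. u (\<gamma> s))"
    by (rule continuous_on_compose2[OF u_cont \<gamma>(1,2)])
  then show "closed {s \<in> {0..1}. u (\<gamma> s) = M}"
    by (intro continuous_closed_preimage_constant) auto
  fix s :: real assume s: "0 \<le> s" "s < 1" "u (\<gamma> s) = M"
  obtain x0 t0 where z0: "\<gamma> s = (x0, t0)" by force
  have "(x0, t0) \<in> \<Omega>" using \<gamma>(2) s z0 by force
  then obtain r where r: "r > 0" "\<And>x t. dist x x0 < r \<Longrightarrow> t0 - r < t \<Longrightarrow> t \<le> t0 \<Longrightarrow> u (x, t) = M"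
    using cylinder_propagation[of x0 t0] s(3) z0 by auto
  obtain d where d: "d > 0" "\<And>s'. s' \<in> {0..1} \<Longrightarrow> dist s' s < d \<Longrightarrow> dist (\<gamma> s') (\<gamma> s) < r"
    using \<gamma>(1) s r(1) unfolding continuous_on_iff by (metis atLeastAtMost_iff less_imp_le)
  have "u (\<gamma> s') = M" if s': "s < s'" "s' < s + d" "s' \<le> 1" for s'
  proof -
    obtain x t where z: "\<gamma> s' = (x, t)" by force
    have "dist (\<gamma> s') (\<gamma> s) < r" using d(2)[of s'] s' s by (auto simp: dist_real_def)
    then have "dist x x0 < r" "dist t t0 < r"
      using dist_fst_le[of "\<gamma> s'" "\<gamma> s"] dist_snd_le[of "\<gamma> s'" "\<gamma> s"] z z0 by auto
    moreover have "t \<le> t0" using mono[of s s'] s s' z z0 by simp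
    ultimately show ?thesis using r(2)[of x t] z by (simp add: dist_real_def)
  qed
  then show "\<exists>d>0. \<forall>s'. s < s' \<and> s' < s + d \<and> s' \<le> 1 \<longrightarrow> u (\<gamma> s') = M" using d(1) by blast
qed (use \<gamma>(3) s in auto)

text \<open>The time component of an admissible curve has derivative -1 almost everywhere, and
  absolute continuity upgrades this to monotonicity.\<close>

lemma attainable_propagation:
  assumes \<zeta>: "u \<zeta> = M" and z: "z \<in> attainable X m \<zeta> \<Omega>"
  shows "u z = M"
proof -
  obtain \<gamma> \<omega> where \<gamma>: "H_admissible X m \<gamma> \<omega>" "\<gamma> 0 = \<zeta>" "\<gamma> 1 = z" "\<gamma> ` {0..1} \<subseteq> \<Omega>"
    using z by (auto simp: attainable_def)
  have ac: "abs_continuous_on 0 1 \<gamma>" using \<gamma>(1) by (simp add: H_admissible_def)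
  have "AE s in lborel. s \<in> {0..1} \<longrightarrow>
        (\<gamma> has_vector_derivative ((\<Sum>i<m. \<omega> i s *\<^sub>R X i (fst (\<gamma> s))), -1)) (at s)"
    using \<gamma>(1) by (simp add: H_admissible_def)
  then have ae: "AE s in lborel. s \<in> {0..1} \<longrightarrow> (\<exists>D\<le>0. ((\<lambda>s. snd (\<gamma> s)) has_real_derivative D) (at s))"
  proof eventually_elim
    case (elim s)
    show ?case
    proof
      assume "s \<in> {0..1}"
      with elim have "(\<gamma> has_vector_derivative ((\<Sum>i<m. \<omega> i s *\<^sub>R X i (fst (\<gamma> s))), -1)) (at s)" by simp
      from bounded_linear.has_vector_derivative[OF bounded_linear_snd this]
      have "((\<lambda>s. snd (\<gamma> s)) has_real_derivative - 1) (at s)"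
        by (simp add: has_real_derivative_iff_has_vector_derivative)
      then show "\<exists>D\<le>0. ((\<lambda>s. snd (\<gamma> s)) has_real_derivative D) (at s)" by (intro exI[of _ "-1"]) auto
    qed
  qed
  have mono: "snd (\<gamma> s') \<le> snd (\<gamma> s)" if s: "0 \<le> s" "s \<le> s'" "s' \<le> 1" for s s'
  proof (rule abs_continuous_nonincreasing[of s s'])
    show "abs_continuous_on s s' (\<lambda>s. snd (\<gamma> s))"
      by (rule abs_continuous_on_subinterval[OF abs_continuous_on_snd[OF ac]]) (use s in auto)
    show "AE x in lborel. x \<in> {s..s'} \<longrightarrow> (\<exists>D\<le>0. ((\<lambda>s. snd (\<gamma> s)) has_real_derivative D) (at x))"
      using ae by eventually_elim (use s in auto)
  qed (use s in auto)
  have "u (\<gamma> 1) = M"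
    by (rule curve_propagation[OF abs_continuous_on_continuous[OF ac] \<gamma>(4) _ mono]) (use \<gamma> \<zeta> in auto)
  then show ?thesis by (simp add: \<gamma>)
qed

text \<open>The contact set is closed relative to \<Omega>, hence the intersection with \<Omega>.
  The value of \<open>f\<close> then follows pointwise from the equation.\<close>

lemma closure_attainable_propagation:
  assumes \<zeta>: "u \<zeta> = M" and z: "z \<in> closure (attainable X m \<zeta> \<Omega>) \<inter> \<Omega>"
  shows "u z = M" "f z = M * c z"
proof -
  have op: "open (\<Omega> \<inter> u -` (- {M}))"
    by (rule continuous_open_preimage[OF u_cont \<Omega>]) (simp add: open_Compl)
  show uz: "u z = M"
  proof (rule ccontr)
    assume "u z \<noteq> M"
    then have "z \<in> (\<Omega> \<inter> u -` (- {M})) \<inter> closure (attainable X m \<zeta> \<Omega>)" using z by auto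
    then have "(\<Omega> \<inter> u -` (- {M})) \<inter> attainable X m \<zeta> \<Omega> \<noteq> {}"
      using open_Int_closure_eq_empty[OF op] by blast
    then show False using attainable_propagation[OF \<zeta>] by auto
  qed
  show "f z = M * c z" using f_at_max uz z by blast
qed

end

section \<open>The maximum principle\<close>

text \<open>The product rule moves the derivatives of \<open>a\<close> into the drift; the sums are
  exchanged so that each first derivative of \<open>u\<close> has a single coefficient.\<close>

lemma H_op_nondivergence:
  assumes X: "\<And>i. i < m \<Longrightarrow> smooth_vfield (X i)"
    and a: "\<And>i j. i < m \<Longrightarrow> j < m \<Longrightarrow> lie_exists (X i) (a i j) z"
    and u: "\<And>i j. i < m \<Longrightarrow> j < m \<Longrightarrow> lie_exists (X i) (lie (X j) u) z"
  shows "H_op X m a b c u z = (\<Sum>i<m. \<Sum>j<m. a i j z * lie (X i) (lie (X j) u) z)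
    + (\<Sum>j<m. ((\<Sum>i<m. lie (X i) (a i j) z) + b j z) * lie (X j) u z) + c z * u z - dt u z"
proof -
  have "lie (X i) (\<lambda>w. a i j w * lie (X j) u w) z
      = lie (X i) (a i j) z * lie (X j) u z + a i j z * lie (X i) (lie (X j) u) z" if "i < m" "j < m" for i j
    by (intro lie_eqI has_lie_deriv_mult has_lie_deriv_lie X a u that)
  then have "(\<Sum>i<m. \<Sum>j<m. lie (X i) (\<lambda>w. a i j w * lie (X j) u w) z)
      = (\<Sum>i<m. \<Sum>j<m. lie (X i) (a i j) z * lie (X j) u z) + (\<Sum>i<m. \<Sum>j<m. a i j z * lie (X i) (lie (X j) u) z)"
    by (simp add: sum.distrib)
  moreover have "(\<Sum>i<m. \<Sum>j<m. lie (X i) (a i j) z * lie (X j) u z)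
      = (\<Sum>j<m. (\<Sum>i<m. lie (X i) (a i j) z) * lie (X j) u z)"
    by (subst sum.swap) (simp add: sum_distrib_right)
  ultimately show ?thesis by (simp add: H_op_def distrib_right sum.distrib)
qed

lemma has_lie_deriv_cmult:
  assumes "smooth_vfield Y" "has_lie_deriv Y u z l"
  shows "has_lie_deriv Y (\<lambda>w. k * u w) z (k * l)"
proof -
  have "has_lie_deriv Y (\<lambda>_. 0) z 0"
    using has_lie_deriv_frechet[OF assms(1), of "\<lambda>_. 0" z "\<lambda>_. 0"] by simp
  from has_lie_deriv_add_scaled[OF assms(1) this assms(2), of k] show ?thesis by simp
qed

text \<open>The sign \<open>s\<close> treats maxima (\<open>s = 1\<close>) and minima (\<open>s = -1\<close>) at once.\<close>
lemma extremum_propagation: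
  fixes X :: "nat \<Rightarrow> ('n::finite) vfield"
  assumes H13: "H1_H3 X m e \<sigma>"
    and H4: "H4 X m a b c M1 M2 \<alpha> lam"
    and \<Omega>: "open \<Omega>"
    and sol: "classical_solution X m a b c \<Omega> u f"
    and c_nonpos: "\<forall>z\<in>\<Omega>. c z \<le> 0"
    and s: "s * s = (1::real)"
    and f: "\<And>z. z \<in> \<Omega> \<Longrightarrow> s * f z \<ge> 0"
    and max: "\<And>z. z \<in> \<Omega> \<Longrightarrow> s * u z \<le> s * u \<zeta>"
    and c_max: "\<And>z y. z \<in> \<Omega> \<Longrightarrow> y \<ge> s * u \<zeta> \<Longrightarrow> c z * y \<le> 0"
    and z: "z \<in> closure (attainable X m \<zeta> \<Omega>) \<inter> \<Omega>"
  shows "u z = u \<zeta> \<and> f z = u \<zeta> * c z"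
proof -
  have X: "smooth_vfield (X i)" if "i < m" for i using H13 that by (simp add: H1_H3_def)
  have a_sym: "a i j = a j i" if "i < m" "j < m" for i j using H4 that by (simp add: H4_def)
  \<comment> \<open>\<open>H4\<close> provides the derivative of \<open>a i j\<close> along
    \<open>X j\<close>; the symmetry of \<open>a\<close> exchanges the indices.\<close>
  have a_ex: "lie_exists (X i) (a i j) z" if "i < m" "j < m" for i j z
    using H4 that unfolding H4_def by metis
  define S where "S = {a i j | i j. i < m \<and> j < m} \<union> {b i | i. i < m} \<union> {c}
            \<union> {lie (X j) (a i j) | i j. i < m \<and> j < m} \<union> {lie (X i) (b i) | i. i < m}"
  have bd: "\<bar>g z\<bar> \<le> M1" if "g \<in> S" for g z
    using H4 that unfolding H4_def S_def by blast
  have M1: "M1 \<ge> 0" using bd[of c undefined] by (force simp: S_def)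
  \<comment> \<open>Each drift coefficient \<beta> is a sum of \<open>m\<close> derivatives of
    \<open>a\<close> and one \<open>b j\<close>, all bounded by \<open>M1\<close>.\<close>
  define C where "C = real (m + 1) * M1"
  have C: "M1 \<le> C" using M1 by (simp add: C_def algebra_simps)
  define \<beta> where "\<beta> j z = (\<Sum>i<m. lie (X i) (a i j) z) + b j z" for j z
  have \<beta>_bd: "\<bar>\<beta> j z\<bar> \<le> C" if j: "j < m" for j z
  proof -
    have "\<bar>lie (X i) (a i j) z\<bar> \<le> M1" if i: "i < m" for i
    proof (rule bd)
      show "lie (X i) (a i j) \<in> S" using a_sym[OF i j] i j unfolding S_def by auto
    qed
    then have "\<bar>\<Sum>i<m. lie (X i) (a i j) z\<bar> \<le> (\<Sum>i<m. M1)"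
      by (intro order_trans[OF sum_abs] sum_mono) simp
    moreover have "\<bar>b j z\<bar> \<le> M1" using j by (intro bd) (auto simp: S_def)
    ultimately show ?thesis by (simp add: \<beta>_def C_def algebra_simps)
  qed
  have C2: "C2_G X m \<Omega> u" using sol by (simp add: classical_solution_def)
  have eq: "(\<Sum>i<m. \<Sum>j<m. a i j z * lie (X i) (lie (X j) u) z) + (\<Sum>j<m. \<beta> j z * lie (X j) u z)
      + c z * u z - dt u z = f z" if "z \<in> \<Omega>" for z
    using sol H_op_nondivergence[of m X a z u b c] X a_ex C2 that
    by (simp add: classical_solution_def C2_G_def \<beta>_def)
  interpret max_propagation X m a "\<lambda>i j z. s * lie (X i) (lie (X j) u) z" \<beta> "\<lambda>i z. s * lie (X i) u z"
    c "\<lambda>z. s * u z" "\<lambda>z. s * f z" "\<lambda>z. s * dt u z" \<Omega> "s * u \<zeta>" C lam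
  proof
    show "{Y x | Y. Y \<in> lie_algebra X m} = UNIV" for x using H13 unfolding H1_H3_def by blast
    show "lam \<ge> 1" using H4 by (simp add: H4_def)
    show "a i j z = a j i z" if "i < m" "j < m" for i j z using a_sym[OF that] by simp
    show "(1 / lam) * (\<Sum>i<m. (v i)\<^sup>2) \<le> (\<Sum>i<m. \<Sum>j<m. a i j z * v i * v j)" for z v
      using H4 unfolding H4_def by blast
    show "C \<ge> 0" using M1 C by simp
    show "\<bar>a i j z\<bar> \<le> C" if "i < m" "j < m" for i j z
      using bd[of "a i j" z] C that by (force simp: S_def)
    show "\<bar>c z\<bar> \<le> C" for z using bd[of c z] C by (force simp: S_def)
    show "continuous_on \<Omega> (\<lambda>z. s * u z)" using C2 by (intro continuous_intros) (simp add: C2_G_def)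
    show "has_lie_deriv (X i) (\<lambda>z. s * u z) z (s * lie (X i) u z)" if "i < m" "z \<in> \<Omega>" for i z
      using C2 that X by (intro has_lie_deriv_cmult has_lie_deriv_lie) (auto simp: C2_G_def)
    show "has_lie_deriv (X i) (\<lambda>z. s * lie (X j) u z) z (s * lie (X i) (lie (X j) u) z)"
      if "i < m" "j < m" "z \<in> \<Omega>" for i j z
      using C2 that X by (intro has_lie_deriv_cmult has_lie_deriv_lie) (auto simp: C2_G_def)
    show "continuous_on \<Omega> (\<lambda>z. s * lie (X i) (lie (X j) u) z)" if "i < m" "j < m" for i j
      using C2 that by (intro continuous_intros) (simp add: C2_G_def)
    show "((\<lambda>t. s * u (fst z, t)) has_real_derivative s * dt u z) (at (snd z))" if "z \<in> \<Omega>" for z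
    proof (rule DERIV_cmult)
      have "(\<lambda>t. u (fst z, t)) differentiable (at (snd z))"
        using C2 that by (simp add: C2_G_def dt_exists_def)
      then show "((\<lambda>t. u (fst z, t)) has_real_derivative dt u z) (at (snd z))"
        unfolding dt_def by (simp add: DERIV_deriv_iff_real_differentiable)
    qed
    fix z assume z: "z \<in> \<Omega>"
    show "(\<Sum>i<m. \<Sum>j<m. a i j z * (s * lie (X i) (lie (X j) u) z)) + (\<Sum>i<m. \<beta> i z * (s * lie (X i) u z))
      + c z * (s * u z) - s * dt u z = s * f z"
      unfolding eq[OF z, symmetric] by (simp add: algebra_simps sum_distrib_left)
  qed (use X \<Omega> \<beta>_bd c_nonpos f max c_max in auto)
  have cancel: "x = y" if "s * x = s * y" for x y
    using arg_cong[OF that, of "\<lambda>x. s * x"] s by (simp flip: mult.assoc)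
  have "s * u z = s * u \<zeta>" "s * f z = s * (u \<zeta> * c z)"
    using closure_attainable_propagation[of \<zeta> z] z by (simp_all add: mult.assoc)
  then show ?thesis using cancel by blast
qed

theorem mainTheorem1:
  fixes X :: "nat \<Rightarrow> 'n::finite vfield" and m :: nat
    and e :: "nat \<Rightarrow> 'n" and \<sigma> :: "'n \<Rightarrow> nat"
    and a :: "nat \<Rightarrow> nat \<Rightarrow> (real^'n) \<times> real \<Rightarrow> real" and b :: "nat \<Rightarrow> (real^'n) \<times> real \<Rightarrow> real"
    and c :: "(real^'n) \<times> real \<Rightarrow> real" and M1 M2 \<alpha> lam :: real
    and \<Omega> :: "((real^'n) \<times> real) set" and u f :: "(real^'n) \<times> real \<Rightarrow> real"
  assumes H13: "H1_H3 X m e \<sigma>"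
    and H4: "H4 X m a b c M1 M2 \<alpha> lam"
    and \<Omega>: "open \<Omega>"
    and f: "continuous_on \<Omega> f"
    and sol: "classical_solution X m a b c \<Omega> u f"
    and c_nonpos: "\<forall>z\<in>\<Omega>. c z \<le> 0"
    and divb: "\<forall>z\<in>\<Omega>. div_G X m b z - c z \<ge> 0"
  shows
    "(\<forall>\<zeta>\<in>\<Omega>. (\<forall>z\<in>\<Omega>. f z \<ge> 0) \<and> (\<forall>z\<in>\<Omega>. u z \<le> u \<zeta>) \<and> u \<zeta> \<ge> 0 \<longrightarrow>
        (\<forall>z \<in> closure (attainable X m \<zeta> \<Omega>) \<inter> \<Omega>. u z = u \<zeta> \<and> f z = u \<zeta> * c z))
   \<and> (\<forall>\<zeta>\<in>\<Omega>. (\<forall>z\<in>\<Omega>. f z \<le> 0) \<and> (\<forall>z\<in>\<Omega>. u z \<ge> u \<zeta>) \<and> u \<zeta> \<le> 0 \<longrightarrow>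
        (\<forall>z \<in> closure (attainable X m \<zeta> \<Omega>) \<inter> \<Omega>. u z = u \<zeta> \<and> f z = u \<zeta> * c z))
   \<and> ((\<forall>z\<in>\<Omega>. c z = 0) \<longrightarrow>
        (\<forall>\<zeta>\<in>\<Omega>. (\<forall>z\<in>\<Omega>. f z \<ge> 0) \<and> (\<forall>z\<in>\<Omega>. u z \<le> u \<zeta>) \<longrightarrow>
           (\<forall>z \<in> closure (attainable X m \<zeta> \<Omega>) \<inter> \<Omega>. u z = u \<zeta> \<and> f z = u \<zeta> * c z))
      \<and> (\<forall>\<zeta>\<in>\<Omega>. (\<forall>z\<in>\<Omega>. f z \<le> 0) \<and> (\<forall>z\<in>\<Omega>. u z \<ge> u \<zeta>) \<longrightarrow>
           (\<forall>z \<in> closure (attainable X m \<zeta> \<Omega>) \<inter> \<Omega>. u z = u \<zeta> \<and> f z = u \<zeta> * c z)))"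
proof -
  note propagate = extremum_propagation[OF H13 H4 \<Omega> sol c_nonpos]
  \<comment> \<open>Either alternative for the extremum gives \<open>c z * y \<le> 0\<close> for all
    \<open>y\<close> above the signed extremal value, so the versions with and without a sign
    condition are obtained together.\<close>
  have max: "u z = u \<zeta> \<and> f z = u \<zeta> * c z"
    if "\<forall>z\<in>\<Omega>. f z \<ge> 0" "\<forall>z\<in>\<Omega>. u z \<le> u \<zeta>" "u \<zeta> \<ge> 0 \<or> (\<forall>z\<in>\<Omega>. c z = 0)"
      "z \<in> closure (attainable X m \<zeta> \<Omega>) \<inter> \<Omega>" for \<zeta> z
    by (rule propagate[of 1]) (use that c_nonpos in \<open>auto intro: mult_nonpos_nonneg\<close>)
  have min: "u z = u \<zeta> \<and> f z = u \<zeta> * c z"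
    if "\<forall>z\<in>\<Omega>. f z \<le> 0" "\<forall>z\<in>\<Omega>. u z \<ge> u \<zeta>" "u \<zeta> \<le> 0 \<or> (\<forall>z\<in>\<Omega>. c z = 0)"
      "z \<in> closure (attainable X m \<zeta> \<Omega>) \<inter> \<Omega>" for \<zeta> z
    by (rule propagate[of "-1"]) (use that c_nonpos in \<open>auto intro: mult_nonpos_nonneg\<close>)
  show ?thesis using max min by blast
qed

end
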